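(* Let $X$ be a topological space such that $\pi_X^{-1}$ has a left adjoint $\mathbb{L}(X,-)$, let $U$ be an open subset of $X$ such that $\pi_U^{-1}$ has a left adjoint $\mathbb{L}(U,-)$, and assume that $U$ contains a closed subset $Y$ of $X$. For any $F\in D(X)$ the natural morphism $$\mathbb{L}^Y(U,F_{|U})\to\mathbb{L}^Y(X,F)$$ is an isomorphism.
   Context: $D(X)$ is the unbounded derived category of sheaves of abelian groups on $X$, $D(\mathbb{Z})$ that of abelian groups, $\pi_X\colon X\to\{*\}$ the projection to a point, $\mathbb{L}(X,-)\colon D(X)\to D(\mathbb{Z})$ the left adjoint of the inverse image $\pi_X^{-1}$. For a closed subset $i\colon Y\hookrightarrow X$ put $F_Y:=i_*i^{-1}F$ and $\mathbb{L}^Y(X,F):=\mathbb{L}(X,F_Y)$. For an open subset $j\colon U\hookrightarrow X$, put $F_U:=j_!j^{-1}F$ ($j_!$ extension by zero). One has $\mathbb{L}(U,-)=\mathbb{L}(X,j_!(-))$, hence $\mathbb{L}^Y(U,F_{|U})=\mathbb{L}(X,j_!((F_{|U})_Y))=\mathbb{L}^Y(X,F_U)$; the natural morphism is obtained by applying $\mathbb{L}^Y(X,-)$ to $F_U\to F$. *)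

theory Defs
  imports
    "HOL-Analysis.Product_Topology"
    "HOL-Algebra.Elementary_Groups"
    "HOL-Library.Equipollence"
begin

section \<open>Categories, functors, adjunctions, localization\<close>

text \<open>
  Morphisms are not tagged with their source and target, so all operations on them take
  the objects as explicit arguments: \<open>Cmp C a b c g f\<close> is the composite
  of \<open>f : a \<rightarrow> b\<close> and \<open>g : b \<rightarrow> c\<close>.
\<close>

record ('o, 'x) category =
  Ob :: "'o set"
  Hom :: "'o \<Rightarrow> 'o \<Rightarrow> 'x set"
  Idn :: "'o \<Rightarrow> 'x"
  Cmp :: "'o \<Rightarrow> 'o \<Rightarrow> 'o \<Rightarrow> 'x \<Rightarrow> 'x \<Rightarrow> 'x"

record ('o, 'x) category0 = "('o, 'x) category" +
  Zero :: "'o \<Rightarrow> 'o \<Rightarrow> 'x"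

definition is_isomorphism :: "('o, 'x, 'z) category_scheme \<Rightarrow> 'o \<Rightarrow> 'o \<Rightarrow> 'x \<Rightarrow> bool" where
  "is_isomorphism C a b f \<longleftrightarrow> f \<in> Hom C a b \<and>
     (\<exists>g \<in> Hom C b a. Cmp C a b a g f = Idn C a \<and> Cmp C b a b f g = Idn C b)"

record ('o, 'x, 'p, 'y) ftor =
  on_ob :: "'o \<Rightarrow> 'p"
  on_arr :: "'o \<Rightarrow> 'o \<Rightarrow> 'x \<Rightarrow> 'y"

definition is_functor ::
  "('o, 'x, 'z) category_scheme \<Rightarrow> ('p, 'y, 'w) category_scheme \<Rightarrow> ('o, 'x, 'p, 'y) ftor \<Rightarrow> bool"
where
  "is_functor C D T \<longleftrightarrow>
     (\<forall>a \<in> Ob C. on_ob T a \<in> Ob D) \<and>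
     (\<forall>a \<in> Ob C. \<forall>b \<in> Ob C. \<forall>f \<in> Hom C a b.
        on_arr T a b f \<in> Hom D (on_ob T a) (on_ob T b)) \<and>
     (\<forall>a \<in> Ob C. on_arr T a a (Idn C a) = Idn D (on_ob T a)) \<and>
     (\<forall>a \<in> Ob C. \<forall>b \<in> Ob C. \<forall>c \<in> Ob C. \<forall>f \<in> Hom C a b. \<forall>g \<in> Hom C b c.
        on_arr T a c (Cmp C a b c g f)
          = Cmp D (on_ob T a) (on_ob T b) (on_ob T c) (on_arr T b c g) (on_arr T a b f))"

definition ftor_comp ::
  "('p, 'y, 'q, 'v) ftor \<Rightarrow> ('o, 'x, 'p, 'y) ftor \<Rightarrow> ('o, 'x, 'q, 'v) ftor" where
  "ftor_comp S T = \<lparr>on_ob = (\<lambda>a. on_ob S (on_ob T a)),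
     on_arr = (\<lambda>a b f. on_arr S (on_ob T a) (on_ob T b) (on_arr T a b f))\<rparr>"

text \<open>
  \<open>L : C \<rightarrow> D\<close> is left adjoint to \<open>R : D \<rightarrow> C\<close> with unit \<open>eta\<close>.
\<close>

definition left_adjoint ::
  "('o, 'x, 'z) category_scheme \<Rightarrow> ('p, 'y, 'w) category_scheme \<Rightarrow>
   ('o, 'x, 'p, 'y) ftor \<Rightarrow> ('p, 'y, 'o, 'x) ftor \<Rightarrow> ('o \<Rightarrow> 'x) \<Rightarrow> bool"
where
  "left_adjoint C D L R eta \<longleftrightarrow>
     is_functor C D L \<and>
     (\<forall>c \<in> Ob C. eta c \<in> Hom C c (on_ob R (on_ob L c))) \<and>
     (\<forall>b \<in> Ob C. \<forall>c \<in> Ob C. \<forall>f \<in> Hom C b c.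
        Cmp C b c (on_ob R (on_ob L c)) (eta c) f
          = Cmp C b (on_ob R (on_ob L b)) (on_ob R (on_ob L c))
              (on_arr (ftor_comp R L) b c f) (eta b)) \<and>
     (\<forall>c \<in> Ob C. \<forall>d \<in> Ob D.
        bij_betw
          (\<lambda>g. Cmp C c (on_ob R (on_ob L c)) (on_ob R d) (on_arr R (on_ob L c) d g) (eta c))
          (Hom D (on_ob L c) d) (Hom C c (on_ob R d)))"

text \<open>The morphism \<open>L c \<rightarrow> d\<close> that corresponds to \<open>h : c \<rightarrow> R d\<close>.\<close>

definition adj_transpose ::
  "('o, 'x, 'z) category_scheme \<Rightarrow> ('p, 'y, 'w) category_scheme \<Rightarrow>
   ('o, 'x, 'p, 'y) ftor \<Rightarrow> ('p, 'y, 'o, 'x) ftor \<Rightarrow> ('o \<Rightarrow> 'x) \<Rightarrow> 'o \<Rightarrow> 'p \<Rightarrow> 'x \<Rightarrow> 'y"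
where
  "adj_transpose C D L R eta c d h =
     (THE g. g \<in> Hom D (on_ob L c) d \<and>
        Cmp C c (on_ob R (on_ob L c)) (on_ob R d) (on_arr R (on_ob L c) d g) (eta c) = h)"

text \<open>
  The localization of \<open>C\<close> at a class \<open>W\<close> of morphisms, by generators and
  relations: morphisms are zigzags modulo the congruence that makes every
  element of \<open>W\<close> invertible. \<open>Bwd a w b\<close> is the formal inverse
  \<open>b \<rightarrow> a\<close> of \<open>w : a \<rightarrow> b\<close>; a zigzag lists its steps in the
  order in which they are traversed.
\<close>

datatype ('o, 'x) step = Fwd 'o 'x 'o | Bwd 'o 'x 'o

inductive zigzag ::
  "('o, 'x, 'z) category_scheme \<Rightarrow> ('o \<Rightarrow> 'o \<Rightarrow> 'x set) \<Rightarrow> 'o \<Rightarrow> ('o, 'x) step list \<Rightarrow> 'o \<Rightarrow> bool"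
  for C W
where
  Nil: "a \<in> Ob C \<Longrightarrow> zigzag C W a [] a"
| Fwd: "\<lbrakk>a \<in> Ob C; b \<in> Ob C; f \<in> Hom C a b; zigzag C W b p c\<rbrakk>
          \<Longrightarrow> zigzag C W a (Fwd a f b # p) c"
| Bwd: "\<lbrakk>a \<in> Ob C; b \<in> Ob C; w \<in> Hom C b a; w \<in> W b a; zigzag C W b p c\<rbrakk>
          \<Longrightarrow> zigzag C W a (Bwd b w a # p) c"

inductive zz_eq ::
  "('o, 'x, 'z) category_scheme \<Rightarrow> ('o \<Rightarrow> 'o \<Rightarrow> 'x set) \<Rightarrow>
   'o \<Rightarrow> ('o, 'x) step list \<Rightarrow> ('o, 'x) step list \<Rightarrow> 'o \<Rightarrow> bool"
  for C W
where
  refl: "zigzag C W a p b \<Longrightarrow> zz_eq C W a p p b"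
| sym: "zz_eq C W a p q b \<Longrightarrow> zz_eq C W a q p b"
| trans: "\<lbrakk>zz_eq C W a p q b; zz_eq C W a q r b\<rbrakk> \<Longrightarrow> zz_eq C W a p r b"
| append: "\<lbrakk>zz_eq C W a p p' b; zz_eq C W b q q' c\<rbrakk> \<Longrightarrow> zz_eq C W a (p @ q) (p' @ q') c"
| ident: "a \<in> Ob C \<Longrightarrow> zz_eq C W a [Fwd a (Idn C a) a] [] a"
| comp: "\<lbrakk>a \<in> Ob C; b \<in> Ob C; c \<in> Ob C; f \<in> Hom C a b; g \<in> Hom C b c\<rbrakk>
          \<Longrightarrow> zz_eq C W a [Fwd a f b, Fwd b g c] [Fwd a (Cmp C a b c g f) c] c"
| inv_left: "\<lbrakk>a \<in> Ob C; b \<in> Ob C; w \<in> Hom C a b; w \<in> W a b\<rbrakk>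
          \<Longrightarrow> zz_eq C W a [Fwd a w b, Bwd a w b] [] a"
| inv_right: "\<lbrakk>a \<in> Ob C; b \<in> Ob C; w \<in> Hom C a b; w \<in> W a b\<rbrakk>
          \<Longrightarrow> zz_eq C W b [Bwd a w b, Fwd a w b] [] b"

definition zz_class ::
  "('o, 'x, 'z) category_scheme \<Rightarrow> ('o \<Rightarrow> 'o \<Rightarrow> 'x set) \<Rightarrow>
   'o \<Rightarrow> 'o \<Rightarrow> ('o, 'x) step list \<Rightarrow> ('o, 'x) step list set" where
  "zz_class C W a b p = {q. zz_eq C W a p q b}"

definition localize ::
  "('o, 'x, 'z) category_scheme \<Rightarrow> ('o \<Rightarrow> 'o \<Rightarrow> 'x set) \<Rightarrow>
   ('o, ('o, 'x) step list set) category" where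
  "localize C W =
    \<lparr>Ob = Ob C,
     Hom = (\<lambda>a b. {zz_class C W a b p | p. zigzag C W a p b}),
     Idn = (\<lambda>a. zz_class C W a a []),
     Cmp = (\<lambda>a b c g f. \<Union>p \<in> f. \<Union>q \<in> g. zz_class C W a c (p @ q))\<rparr>"

definition loc_arr ::
  "('o, 'x, 'z) category_scheme \<Rightarrow> ('o \<Rightarrow> 'o \<Rightarrow> 'x set) \<Rightarrow>
   'o \<Rightarrow> 'o \<Rightarrow> 'x \<Rightarrow> ('o, 'x) step list set" where
  "loc_arr C W a b f = zz_class C W a b [Fwd a f b]"

fun map_step :: "('o, 'x, 'p, 'y) ftor \<Rightarrow> ('o, 'x) step \<Rightarrow> ('p, 'y) step" where
  "map_step T (Fwd a f b) = Fwd (on_ob T a) (on_arr T a b f) (on_ob T b)"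
| "map_step T (Bwd a f b) = Bwd (on_ob T a) (on_arr T a b f) (on_ob T b)"

text \<open>
  The functor to \<open>localize D V\<close> induced by a functor \<open>T\<close> to \<open>D\<close>
  that maps the inverted morphisms of its source to \<open>V\<close>.
\<close>

definition loc_ftor ::
  "('p, 'y, 'z) category_scheme \<Rightarrow> ('p \<Rightarrow> 'p \<Rightarrow> 'y set) \<Rightarrow> ('o, 'x, 'p, 'y) ftor \<Rightarrow>
   ('o, ('o, 'x) step list set, 'p, ('p, 'y) step list set) ftor" where
  "loc_ftor D V T =
    \<lparr>on_ob = on_ob T,
     on_arr = (\<lambda>a b f. \<Union>p \<in> f. zz_class D V (on_ob T a) (on_ob T b) (map (map_step T) p))\<rparr>"


section \<open>Unbounded cochain complexes\<close>

type_synonym ('o, 'x) complex = "(int \<Rightarrow> 'o) \<times> (int \<Rightarrow> 'x)"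

definition Ch :: "('o, 'x, 'z) category0_scheme \<Rightarrow> (('o, 'x) complex, int \<Rightarrow> 'x) category" where
  "Ch C =
    \<lparr>Ob = {(A, d). \<forall>n. A n \<in> Ob C \<and> d n \<in> Hom C (A n) (A (n + 1)) \<and>
            Cmp C (A n) (A (n + 1)) (A (n + 1 + 1)) (d (n + 1)) (d n)
              = Zero C (A n) (A (n + 1 + 1))},
     Hom = (\<lambda>(A, d) (B, e). {f. \<forall>n. f n \<in> Hom C (A n) (B n) \<and>
            Cmp C (A n) (B n) (B (n + 1)) (e n) (f n)
              = Cmp C (A n) (A (n + 1)) (B (n + 1)) (f (n + 1)) (d n)}),
     Idn = (\<lambda>(A, d) n. Idn C (A n)),
     Cmp = (\<lambda>(A, _) (B, _) (E, _) g f n. Cmp C (A n) (B n) (E n) (g n) (f n))\<rparr>"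

definition ch_ftor ::
  "('o, 'x, 'p, 'y) ftor \<Rightarrow> (('o, 'x) complex, int \<Rightarrow> 'x, ('p, 'y) complex, int \<Rightarrow> 'y) ftor"
where
  "ch_ftor T =
    \<lparr>on_ob = (\<lambda>(A, d). (\<lambda>n. on_ob T (A n), \<lambda>n. on_arr T (A n) (A (n + 1)) (d n))),
     on_arr = (\<lambda>(A, _) (B, _) f n. on_arr T (A n) (B n) (f n))\<rparr>"


section \<open>Abelian groups and their derived category\<close>

text \<open>
  Groups are written multiplicatively, as in the library. The type \<open>'u\<close> plays
  the role of the set-theoretic universe: a group is admitted if its carrier is a subset of
  \<open>'u\<close> of strictly smaller cardinality. If the cardinality of \<open>'u\<close> is
  inaccessible these are, up to isomorphism, exactly the groups that are small with respect
  to the corresponding Grothendieck universe. No closure property of \<open>'u\<close> is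
  imposed.
\<close>

definition Ab :: "('u monoid, 'u \<Rightarrow> 'u) category0" where
  "Ab =
    \<lparr>Ob = {G. comm_group G \<and> carrier G \<prec> (UNIV :: 'u set)},
     Hom = (\<lambda>G H. hom G H \<inter> extensional (carrier G)),
     Idn = (\<lambda>G. \<lambda>s \<in> carrier G. s),
     Cmp = (\<lambda>G _ _ g f. compose (carrier G) g f),
     Zero = (\<lambda>G H. \<lambda>s \<in> carrier G. \<one>\<^bsub>H\<^esub>)\<rparr>"

type_synonym 'u ab_complex = "('u monoid, 'u \<Rightarrow> 'u) complex"

definition boundaries :: "'u ab_complex \<Rightarrow> int \<Rightarrow> 'u set" where
  "boundaries = (\<lambda>(A, d) n. d (n - 1) ` carrier (A (n - 1)))"

definition cohomology :: "'u ab_complex \<Rightarrow> int \<Rightarrow> 'u set monoid" where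
  "cohomology = (\<lambda>(A, d) n.
     (A n)\<lparr>carrier := kernel (A n) (A (n + 1)) (d n)\<rparr> Mod boundaries (A, d) n)"

text \<open>The induced map sends the coset of a cocycle \<open>z\<close> to the coset of \<open>f z\<close>.\<close>

definition cohomology_map ::
  "'u ab_complex \<Rightarrow> int \<Rightarrow> (int \<Rightarrow> 'u \<Rightarrow> 'u) \<Rightarrow> 'u set \<Rightarrow> 'u set" where
  "cohomology_map B n f c = boundaries B n <#>\<^bsub>fst B n\<^esub> (f n ` c)"

definition qis_Ab :: "'u ab_complex \<Rightarrow> 'u ab_complex \<Rightarrow> (int \<Rightarrow> 'u \<Rightarrow> 'u) set" where
  "qis_Ab A B = {f \<in> Hom (Ch Ab) A B.
     \<forall>n. cohomology_map B n f \<in> iso (cohomology A n) (cohomology B n)}"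

definition DAb :: "('u ab_complex, ('u ab_complex, int \<Rightarrow> 'u \<Rightarrow> 'u) step list set) category" where
  "DAb = localize (Ch Ab) qis_Ab"


section \<open>Sheaves of abelian groups and their derived category\<close>

text \<open>
  A sheaf of abelian groups on \<open>X\<close> is given by its etale space: a local
  homeomorphism to \<open>X\<close> whose fibres are abelian groups, with continuous group
  operations. Its points are the pairs \<open>(x, s)\<close> with \<open>s\<close> in the stalk
  at \<open>x\<close>, and the projection is \<open>fst\<close>. The sections over
  \<open>S\<close> are the continuous sections of the projection.
\<close>

record ('a, 'u) sheaf =
  stalk :: "'a \<Rightarrow> 'u monoid"
  etop :: "('a \<times> 'u) topology"

definition is_sheaf :: "'a topology \<Rightarrow> ('a, 'u) sheaf \<Rightarrow> bool" where
  "is_sheaf X F \<longleftrightarrow>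
     (\<forall>x \<in> topspace X. stalk F x \<in> Ob Ab) \<and>
     topspace (etop F) = (SIGMA x : topspace X. carrier (stalk F x)) \<and>
     (\<forall>e \<in> topspace (etop F). \<exists>W. openin (etop F) W \<and> e \<in> W \<and> openin X (fst ` W) \<and>
        homeomorphic_map (subtopology (etop F) W) (subtopology X (fst ` W)) fst) \<and>
     continuous_map
       (subtopology (prod_topology (etop F) (etop F)) {(p, q). fst p = fst q}) (etop F)
       (\<lambda>((x, s), (_, t)). (x, s \<otimes>\<^bsub>stalk F x\<^esub> t)) \<and>
     continuous_map (etop F) (etop F) (\<lambda>(x, s). (x, inv\<^bsub>stalk F x\<^esub> s))"

definition sections :: "'a topology \<Rightarrow> ('a, 'u) sheaf \<Rightarrow> 'a set \<Rightarrow> ('a \<Rightarrow> 'u) set" where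
  "sections X F S = {\<sigma> \<in> extensional S.
     continuous_map (subtopology X S) (etop F) (\<lambda>x. (x, \<sigma> x))}"

definition Sh :: "'a topology \<Rightarrow> (('a, 'u) sheaf, 'a \<Rightarrow> 'u \<Rightarrow> 'u) category0" where
  "Sh X =
    \<lparr>Ob = {F. is_sheaf X F},
     Hom = (\<lambda>F G. {\<phi> \<in> extensional (topspace X).
        (\<forall>x \<in> topspace X. \<phi> x \<in> Hom Ab (stalk F x) (stalk G x)) \<and>
        continuous_map (etop F) (etop G) (\<lambda>(x, s). (x, \<phi> x s))}),
     Idn = (\<lambda>F. \<lambda>x \<in> topspace X. Idn Ab (stalk F x)),
     Cmp = (\<lambda>F G H \<psi> \<phi>. \<lambda>x \<in> topspace X.
        Cmp Ab (stalk F x) (stalk G x) (stalk H x) (\<psi> x) (\<phi> x)),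
     Zero = (\<lambda>F G. \<lambda>x \<in> topspace X. Zero Ab (stalk F x) (stalk G x))\<rparr>"

type_synonym ('a, 'u) sh_complex = "(('a, 'u) sheaf, 'a \<Rightarrow> 'u \<Rightarrow> 'u) complex"

type_synonym ('a, 'u) sh_darr =
  "(('a, 'u) sh_complex, int \<Rightarrow> 'a \<Rightarrow> 'u \<Rightarrow> 'u) step list set"

type_synonym 'u ab_darr = "('u ab_complex, int \<Rightarrow> 'u \<Rightarrow> 'u) step list set"

definition stalk_ftor :: "'a \<Rightarrow> (('a, 'u) sheaf, 'a \<Rightarrow> 'u \<Rightarrow> 'u, 'u monoid, 'u \<Rightarrow> 'u) ftor" where
  "stalk_ftor x = \<lparr>on_ob = (\<lambda>F. stalk F x), on_arr = (\<lambda>_ _ \<phi>. \<phi> x)\<rparr>"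

text \<open>
  Taking stalks commutes with cohomology, and a morphism of sheaves is an isomorphism iff it
  is one on all stalks; so quasi-isomorphisms are tested on stalk complexes.
\<close>

definition qis_Sh ::
  "'a topology \<Rightarrow> ('a, 'u) sh_complex \<Rightarrow> ('a, 'u) sh_complex \<Rightarrow> (int \<Rightarrow> 'a \<Rightarrow> 'u \<Rightarrow> 'u) set" where
  "qis_Sh X F G = {f \<in> Hom (Ch (Sh X)) F G. \<forall>x \<in> topspace X.
     on_arr (ch_ftor (stalk_ftor x)) F G f
       \<in> qis_Ab (on_ob (ch_ftor (stalk_ftor x)) F) (on_ob (ch_ftor (stalk_ftor x)) G)}"

definition DSh :: "'a topology \<Rightarrow> (('a, 'u) sh_complex, ('a, 'u) sh_darr) category" where
  "DSh X = localize (Ch (Sh X)) (qis_Sh X)"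

text \<open>
  All functors below are exact, so they act on derived categories by termwise application to
  complexes.
\<close>

definition der_Sh ::
  "'a topology \<Rightarrow> ('o, 'x, ('a, 'u) sheaf, 'a \<Rightarrow> 'u \<Rightarrow> 'u) ftor \<Rightarrow>
   (('o, 'x) complex, (('o, 'x) complex, int \<Rightarrow> 'x) step list set,
    ('a, 'u) sh_complex, ('a, 'u) sh_darr) ftor" where
  "der_Sh X T = loc_ftor (Ch (Sh X)) (qis_Sh X) (ch_ftor T)"


section \<open>Inverse and direct images\<close>

text \<open>
  The inverse image under the projection of \<open>X\<close> to a point: the constant sheaf,
  whose etale space is the product of \<open>X\<close> with the discrete group.
\<close>

definition const_ftor ::
  "'a topology \<Rightarrow> ('u monoid, 'u \<Rightarrow> 'u, ('a, 'u) sheaf, 'a \<Rightarrow> 'u \<Rightarrow> 'u) ftor" where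
  "const_ftor X =
    \<lparr>on_ob = (\<lambda>M. \<lparr>stalk = (\<lambda>_. M),
        etop = prod_topology X (discrete_topology (carrier M))\<rparr>),
     on_arr = (\<lambda>_ _ h. \<lambda>x \<in> topspace X. h)\<rparr>"

definition const_D ::
  "'a topology \<Rightarrow> ('u ab_complex, 'u ab_darr, ('a, 'u) sh_complex, ('a, 'u) sh_darr) ftor" where
  "const_D X = der_Sh X (const_ftor X)"

text \<open>The inverse image under the inclusion of the subspace \<open>S\<close> in \<open>X\<close>.\<close>

definition restr_ftor ::
  "'a topology \<Rightarrow> 'a set \<Rightarrow>
   (('a, 'u) sheaf, 'a \<Rightarrow> 'u \<Rightarrow> 'u, ('a, 'u) sheaf, 'a \<Rightarrow> 'u \<Rightarrow> 'u) ftor" where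
  "restr_ftor X S =
    \<lparr>on_ob = (\<lambda>F. \<lparr>stalk = stalk F, etop = subtopology (etop F) (S \<times> UNIV)\<rparr>),
     on_arr = (\<lambda>_ _ \<phi>. restrict \<phi> (topspace (subtopology X S)))\<rparr>"

definition restr_D ::
  "'a topology \<Rightarrow> 'a set \<Rightarrow>
   (('a, 'u) sh_complex, ('a, 'u) sh_darr, ('a, 'u) sh_complex, ('a, 'u) sh_darr) ftor" where
  "restr_D X S = der_Sh (subtopology X S) (restr_ftor X S)"

text \<open>
  Both the direct image along a closed embedding and the extension by zero along an open
  embedding keep the stalks on \<open>S\<close> and have trivial stalks elsewhere. The functions
  \<open>\<sigma> \<in> \<Gamma> V\<close> are the sections over the open set \<open>V\<close>, given by
  their values on \<open>V \<inter> S\<close>; their graphs generate the etale topology.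
\<close>

definition ext_sheaf ::
  "'a topology \<Rightarrow> 'a set \<Rightarrow> ('a set \<Rightarrow> ('a \<Rightarrow> 'u) set) \<Rightarrow> ('a, 'u) sheaf \<Rightarrow> ('a, 'u) sheaf" where
  "ext_sheaf X S \<Gamma> G =
    \<lparr>stalk = (\<lambda>x. if x \<in> S then stalk G x else singleton_group undefined),
     etop = topology_generated_by
       {(\<lambda>x. (x, if x \<in> S then \<sigma> x else undefined)) ` V | V \<sigma>. openin X V \<and> \<sigma> \<in> \<Gamma> V}\<rparr>"

definition ext_map :: "'a topology \<Rightarrow> 'a set \<Rightarrow> ('a \<Rightarrow> 'u \<Rightarrow> 'u) \<Rightarrow> ('a \<Rightarrow> 'u \<Rightarrow> 'u)" where
  "ext_map X S \<phi> = (\<lambda>x \<in> topspace X. if x \<in> S then \<phi> x else (\<lambda>s \<in> {undefined}. undefined))"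

text \<open>Direct image along the inclusion of a closed subset \<open>Y\<close>.\<close>

definition push_ftor ::
  "'a topology \<Rightarrow> 'a set \<Rightarrow>
   (('a, 'u) sheaf, 'a \<Rightarrow> 'u \<Rightarrow> 'u, ('a, 'u) sheaf, 'a \<Rightarrow> 'u \<Rightarrow> 'u) ftor" where
  "push_ftor X Y =
    \<lparr>on_ob = (\<lambda>G. ext_sheaf X Y (\<lambda>V. sections (subtopology X Y) G (V \<inter> Y)) G),
     on_arr = (\<lambda>_ _. ext_map X Y)\<rparr>"

text \<open>
  Extension by zero along the inclusion of an open subset \<open>U\<close>: its sections over
  \<open>V\<close> are those over \<open>V \<inter> U\<close> whose support is closed in
  \<open>V\<close>.
\<close>

definition shriek_ftor ::
  "'a topology \<Rightarrow> 'a set \<Rightarrow>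
   (('a, 'u) sheaf, 'a \<Rightarrow> 'u \<Rightarrow> 'u, ('a, 'u) sheaf, 'a \<Rightarrow> 'u \<Rightarrow> 'u) ftor" where
  "shriek_ftor X U =
    \<lparr>on_ob = (\<lambda>G. ext_sheaf X U
        (\<lambda>V. {\<sigma> \<in> sections (subtopology X U) G (V \<inter> U).
           closedin (subtopology X V) {x \<in> V \<inter> U. \<sigma> x \<noteq> \<one>\<^bsub>stalk G x\<^esub>}}) G),
     on_arr = (\<lambda>_ _. ext_map X U)\<rparr>"

definition push_D ::
  "'a topology \<Rightarrow> 'a set \<Rightarrow>
   (('a, 'u) sh_complex, ('a, 'u) sh_darr, ('a, 'u) sh_complex, ('a, 'u) sh_darr) ftor" where
  "push_D X Y = der_Sh X (push_ftor X Y)"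

definition shriek_D ::
  "'a topology \<Rightarrow> 'a set \<Rightarrow>
   (('a, 'u) sh_complex, ('a, 'u) sh_darr, ('a, 'u) sh_complex, ('a, 'u) sh_darr) ftor" where
  "shriek_D X U = der_Sh X (shriek_ftor X U)"

text \<open>The functors \<open>F \<mapsto> F\<^sub>Y\<close> and \<open>F \<mapsto> F\<^sub>U\<close>.\<close>

definition closed_part ::
  "'a topology \<Rightarrow> 'a set \<Rightarrow>
   (('a, 'u) sh_complex, ('a, 'u) sh_darr, ('a, 'u) sh_complex, ('a, 'u) sh_darr) ftor" where
  "closed_part X Y = ftor_comp (push_D X Y) (restr_D X Y)"

definition open_part ::
  "'a topology \<Rightarrow> 'a set \<Rightarrow>
   (('a, 'u) sh_complex, ('a, 'u) sh_darr, ('a, 'u) sh_complex, ('a, 'u) sh_darr) ftor" where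
  "open_part X U = ftor_comp (shriek_D X U) (restr_D X U)"

text \<open>The functor \<open>F \<mapsto> L\<^sup>Y(X, F) = L(X, F\<^sub>Y)\<close>.\<close>

definition supported ::
  "'a topology \<Rightarrow> 'a set \<Rightarrow>
   (('a, 'u) sh_complex, ('a, 'u) sh_darr, 'u ab_complex, 'u ab_darr) ftor \<Rightarrow>
   (('a, 'u) sh_complex, ('a, 'u) sh_darr, 'u ab_complex, 'u ab_darr) ftor" where
  "supported X Y L = ftor_comp L (closed_part X Y)"


section \<open>The natural morphism\<close>

text \<open>
  If complexes \<open>F\<close>, \<open>G\<close> have the same stalks at all points of \<open>X\<close>,
  this is the morphism in the derived category given by the identity maps of the stalks.
\<close>

definition stalkwise_id ::
  "'a topology \<Rightarrow> ('a, 'u) sh_complex \<Rightarrow> ('a, 'u) sh_complex \<Rightarrow> ('a, 'u) sh_darr" where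
  "stalkwise_id X F G = loc_arr (Ch (Sh X)) (qis_Sh X) F G (Idn (Ch (Sh X)) F)"

definition shriek_unit ::
  "'a topology \<Rightarrow> 'a set \<Rightarrow> ('a, 'u) sh_complex \<Rightarrow> ('a, 'u) sh_darr" where
  "shriek_unit X U G =
     stalkwise_id (subtopology X U) G (on_ob (ftor_comp (restr_D X U) (shriek_D X U)) G)"

text \<open>The morphism \<open>F\<^sub>U \<rightarrow> F\<close>.\<close>

definition open_part_incl ::
  "'a topology \<Rightarrow> 'a set \<Rightarrow> ('a, 'u) sh_complex \<Rightarrow> ('a, 'u) sh_darr" where
  "open_part_incl X U F =
     loc_arr (Ch (Sh X)) (qis_Sh X) (on_ob (open_part X U) F) F
       (\<lambda>n. \<lambda>x \<in> topspace X.
          if x \<in> U then Idn Ab (stalk (fst F n) x)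
          else (\<lambda>s \<in> {undefined}. \<one>\<^bsub>stalk (fst F n) x\<^esub>))"

text \<open>
  Let \<open>j\<close> be the inclusion of the open subset \<open>U\<close>. Since \<open>L(X, j\<^sub>! -)\<close>
  is left adjoint to the composite of the inverse images under \<open>j\<close> and under the
  projection of \<open>X\<close> to a point, which is the inverse image under the projection of
  \<open>U\<close>, it is identified with \<open>L(U, -)\<close>: the isomorphism
  \<open>L(U, G) \<rightarrow> L(X, j\<^sub>! G)\<close> corresponds by adjunction to the unit of the composite
  adjunction. The two ways to form constant sheaves on \<open>U\<close> give equal objects
  by \<open>restr_const_D\<close> below.
\<close>

definition shriek_ident ::
  "'a topology \<Rightarrow> 'a set \<Rightarrow>
   (('a, 'u) sh_complex, ('a, 'u) sh_darr, 'u ab_complex, 'u ab_darr) ftor \<Rightarrow>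
   (('a, 'u) sh_complex \<Rightarrow> ('a, 'u) sh_darr) \<Rightarrow>
   (('a, 'u) sh_complex, ('a, 'u) sh_darr, 'u ab_complex, 'u ab_darr) ftor \<Rightarrow>
   (('a, 'u) sh_complex \<Rightarrow> ('a, 'u) sh_darr) \<Rightarrow> ('a, 'u) sh_complex \<Rightarrow> 'u ab_darr" where
  "shriek_ident X U LX etaX LU etaU G =
    (let jG = on_ob (shriek_D X U) G;
         cL = on_ob (const_D X) (on_ob LX jG);
         u = Cmp (DSh (subtopology X U)) G (on_ob (restr_D X U) jG) (on_ob (restr_D X U) cL)
               (on_arr (restr_D X U) jG cL (etaX jG)) (shriek_unit X U G)
     in adj_transpose (DSh (subtopology X U)) DAb LU (const_D (subtopology X U)) etaU
          G (on_ob LX jG) u)"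

text \<open>
  The natural morphism is the composite
  \<open>L(U, (F|U)\<^sub>Y) \<rightarrow> L(X, j\<^sub>! ((F|U)\<^sub>Y)) \<rightarrow> L(X, (F\<^sub>U)\<^sub>Y) \<rightarrow> L(X, F\<^sub>Y)\<close>
  of the identification above, the canonical isomorphism
  of \<open>j\<^sub>! ((F|U)\<^sub>Y)\<close> with \<open>(F\<^sub>U)\<^sub>Y\<close>, and the morphism induced by
  \<open>F\<^sub>U \<rightarrow> F\<close>.
\<close>

definition natural_morphism ::
  "'a topology \<Rightarrow> 'a set \<Rightarrow> 'a set \<Rightarrow>
   (('a, 'u) sh_complex, ('a, 'u) sh_darr, 'u ab_complex, 'u ab_darr) ftor \<Rightarrow>
   (('a, 'u) sh_complex \<Rightarrow> ('a, 'u) sh_darr) \<Rightarrow>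
   (('a, 'u) sh_complex, ('a, 'u) sh_darr, 'u ab_complex, 'u ab_darr) ftor \<Rightarrow>
   (('a, 'u) sh_complex \<Rightarrow> ('a, 'u) sh_darr) \<Rightarrow> ('a, 'u) sh_complex \<Rightarrow> 'u ab_darr" where
  "natural_morphism X U Y LX etaX LU etaU F =
    (let G = on_ob (closed_part (subtopology X U) Y) (on_ob (restr_D X U) F);
         jG = on_ob (shriek_D X U) G;
         FU = on_ob (open_part X U) F;
         FU_Y = on_ob (closed_part X Y) FU;
         t1 = shriek_ident X U LX etaX LU etaU G;
         t2 = on_arr LX jG FU_Y (stalkwise_id X jG FU_Y);
         t3 = on_arr (supported X Y LX) FU F (open_part_incl X U F)
     in Cmp DAb (on_ob LU G) (on_ob LX FU_Y) (on_ob (supported X Y LX) F) t3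
          (Cmp DAb (on_ob LU G) (on_ob LX jG) (on_ob LX FU_Y) t2 t1))"

lemma restr_const:
  "on_ob (restr_ftor X U) (on_ob (const_ftor X) M) = on_ob (const_ftor (subtopology X U)) M"
proof -
  have "subtopology (prod_topology X (discrete_topology (carrier M))) (U \<times> UNIV)
      = prod_topology (subtopology X U) (subtopology (discrete_topology (carrier M)) UNIV)"
    by (rule subtopology_Times)
  then show ?thesis
    by (simp add: restr_ftor_def const_ftor_def)
qed

lemma restr_const_D:
  "on_ob (restr_D X U) (on_ob (const_D X) M) = on_ob (const_D (subtopology X U)) M"
proof -
  have "restrict (restrict h (topspace X)) (topspace X \<inter> U) = restrict h (topspace X \<inter> U)"
    for h :: "'a \<Rightarrow> 'b \<Rightarrow> 'b"
    by auto
  then show ?thesis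
    by (cases M) (simp add: restr_D_def const_D_def der_Sh_def loc_ftor_def ch_ftor_def
      restr_const, simp add: restr_ftor_def const_ftor_def)
qed

end

theory Submission
  imports Defs
begin

text \<open>
  Put \<open>G = (F|U)\<^sub>Y\<close>. Extension by zero \<open>j\<^sub>!\<close> and restriction \<open>j\<^sup>-\<^sup>1\<close> are exact and
  adjoint, with unit and counit the identities of the stalks over \<open>U\<close>, so the adjunction passes to the
  derived categories. As \<open>j\<^sup>-\<^sup>1\<close> carries constant sheaves to constant sheaves, both \<open>L(U, G)\<close> and
  \<open>L(X, j\<^sub>! G)\<close> represent \<open>Hom(G, const -)\<close>, and their identification is invertible. The other two
  factors of the natural morphism are images under \<open>L(X, -)\<close> of invertible morphisms: since
  \<open>Y \<subseteq> U\<close>, both \<open>j\<^sub>! G \<rightarrow> (F\<^sub>U)\<^sub>Y\<close> and \<open>(F\<^sub>U)\<^sub>Y \<rightarrow> F\<^sub>Y\<close> are the identity on every stalk.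
\<close>

section \<open>Localized categories\<close>

text \<open>Morphisms of the derived categories are classes of zigzags, and no calculus of fractions
  is set up. Hence every statement about them is proved on representing zigzags, step by step, from
  an equation between morphisms of complexes; this is why adjunctions are handled through unit,
  counit and triangle identities. Complexes in turn reduce to sheaves degree by degree. For sheaves
  the algebra takes place on stalks and is immediate; the obstacle is topological. The etale
  topologies of direct image and extension by zero are generated by graphs of sections, and two
  sheaves with equal stalks may carry topologies built in different ways. Continuity of a fibrewise
  map is therefore always tested on local sections through each point. A stalkwise identity has to
  be continuous in one direction only: it is then a quasi-isomorphism, and localization supplies the
  inverse. A degenerate case has to be excluded as well: the extensions have singleton groups as
  stalks, and these must be small enough for the universe.\<close>

locale cat =
  fixes C :: "('o, 'x, 'z) category_scheme"
  assumes Idn_in: "a \<in> Ob C \<Longrightarrow> Idn C a \<in> Hom C a a"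
    and Cmp_in: "\<lbrakk>a \<in> Ob C; b \<in> Ob C; c \<in> Ob C; f \<in> Hom C a b; g \<in> Hom C b c\<rbrakk>
      \<Longrightarrow> Cmp C a b c g f \<in> Hom C a c"
    and Cmp_Idn: "\<lbrakk>a \<in> Ob C; b \<in> Ob C; f \<in> Hom C a b\<rbrakk> \<Longrightarrow> Cmp C a a b f (Idn C a) = f"
    and Idn_Cmp: "\<lbrakk>a \<in> Ob C; b \<in> Ob C; f \<in> Hom C a b\<rbrakk> \<Longrightarrow> Cmp C a b b (Idn C b) f = f"
    and Cmp_assoc: "\<lbrakk>a \<in> Ob C; b \<in> Ob C; c \<in> Ob C; d \<in> Ob C;
        f \<in> Hom C a b; g \<in> Hom C b c; h \<in> Hom C c d\<rbrakk>
      \<Longrightarrow> Cmp C a c d h (Cmp C a b c g f) = Cmp C a b d (Cmp C b c d h g) f"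

lemma functor_Ob: "is_functor C D T \<Longrightarrow> a \<in> Ob C \<Longrightarrow> on_ob T a \<in> Ob D"
  by (simp add: is_functor_def)

lemma functor_Hom:
  "\<lbrakk>is_functor C D T; a \<in> Ob C; b \<in> Ob C; f \<in> Hom C a b\<rbrakk>
    \<Longrightarrow> on_arr T a b f \<in> Hom D (on_ob T a) (on_ob T b)"
  by (simp add: is_functor_def)

lemma functor_Idn: "is_functor C D T \<Longrightarrow> a \<in> Ob C \<Longrightarrow> on_arr T a a (Idn C a) = Idn D (on_ob T a)"
  by (simp add: is_functor_def)

lemma functor_Cmp:
  "\<lbrakk>is_functor C D T; a \<in> Ob C; b \<in> Ob C; c \<in> Ob C; f \<in> Hom C a b; g \<in> Hom C b c\<rbrakk>
    \<Longrightarrow> on_arr T a c (Cmp C a b c g f)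
      = Cmp D (on_ob T a) (on_ob T b) (on_ob T c) (on_arr T b c g) (on_arr T a b f)"
  by (simp add: is_functor_def)

lemma is_functor_comp:
  "is_functor C D T \<Longrightarrow> is_functor D E S \<Longrightarrow> is_functor C E (ftor_comp S T)"
  unfolding is_functor_def ftor_comp_def by simp

lemma functor_isomorphism:
  assumes "is_functor C D T" "a \<in> Ob C" "b \<in> Ob C" "is_isomorphism C a b f"
  shows "is_isomorphism D (on_ob T a) (on_ob T b) (on_arr T a b f)"
proof -
  obtain g where "f \<in> Hom C a b" "g \<in> Hom C b a"
    "Cmp C a b a g f = Idn C a" "Cmp C b a b f g = Idn C b"
    using assms(4) by (auto simp: is_isomorphism_def)
  then show ?thesis
    unfolding is_isomorphism_def
    using functor_Hom[OF assms(1)] functor_Cmp[OF assms(1)] functor_Idn[OF assms(1)] assms(2,3)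
    by (metis (no_types, lifting))
qed

lemma (in cat) isomorphism_Cmp:
  assumes "a \<in> Ob C" "b \<in> Ob C" "c \<in> Ob C" "is_isomorphism C a b f" "is_isomorphism C b c g"
  shows "is_isomorphism C a c (Cmp C a b c g f)"
proof -
  obtain f' g' where f: "f \<in> Hom C a b" "f' \<in> Hom C b a"
      "Cmp C a b a f' f = Idn C a" "Cmp C b a b f f' = Idn C b"
    and g: "g \<in> Hom C b c" "g' \<in> Hom C c b"
      "Cmp C b c b g' g = Idn C b" "Cmp C c b c g g' = Idn C c"
    using assms(4,5) by (auto simp: is_isomorphism_def)
  have "Cmp C a c a (Cmp C c b a f' g') (Cmp C a b c g f) = Cmp C a b a f' (Cmp C a c b g' (Cmp C a b c g f))"
    using assms f g by (metis Cmp_assoc Cmp_in)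
  also have "\<dots> = Idn C a"
    using assms f g by (metis Cmp_assoc Idn_Cmp)
  finally have 1: "Cmp C a c a (Cmp C c b a f' g') (Cmp C a b c g f) = Idn C a" .
  have "Cmp C c a c (Cmp C a b c g f) (Cmp C c b a f' g') = Cmp C c b c g (Cmp C c a b f (Cmp C c b a f' g'))"
    using assms f g by (metis Cmp_assoc Cmp_in)
  also have "\<dots> = Idn C c"
    using assms f g by (metis Cmp_assoc Idn_Cmp)
  finally have 2: "Cmp C c a c (Cmp C a b c g f) (Cmp C c b a f' g') = Idn C c" .
  show ?thesis
    unfolding is_isomorphism_def using 1 2 assms f g Cmp_in by blast
qed

section \<open>Zigzags and composition in a localization\<close>

lemma zigzag_append: "zigzag C W a p b \<Longrightarrow> zigzag C W b q c \<Longrightarrow> zigzag C W a (p @ q) c"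
  by (induction rule: zigzag.induct) (auto intro: zigzag.intros)

lemma zigzag_Fwd1:
  "\<lbrakk>a \<in> Ob C; b \<in> Ob C; f \<in> Hom C a b\<rbrakk> \<Longrightarrow> zigzag C W a [Fwd a f b] b"
  by (auto intro: zigzag.intros)

lemma zigzag_Bwd1:
  "\<lbrakk>a \<in> Ob C; b \<in> Ob C; w \<in> Hom C a b; w \<in> W a b\<rbrakk> \<Longrightarrow> zigzag C W b [Bwd a w b] a"
  by (auto intro: zigzag.intros)

lemma zz_class_eqI: "zz_eq C W a p q b \<Longrightarrow> zz_class C W a b p = zz_class C W a b q"
  unfolding zz_class_def by (blast intro: zz_eq.sym zz_eq.trans)

lemma zz_class_self: "zigzag C W a p b \<Longrightarrow> p \<in> zz_class C W a b p"
  unfolding zz_class_def by (auto intro: zz_eq.refl)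

lemma localize_Ob [simp]: "Ob (localize C W) = Ob C"
  and localize_Idn: "Idn (localize C W) a = zz_class C W a a []"
  by (simp_all add: localize_def)

lemma localize_HomE:
  assumes "f \<in> Hom (localize C W) a b"
  obtains p where "zigzag C W a p b" "f = zz_class C W a b p"
  using assms by (auto simp: localize_def)

lemma localize_HomI: "zigzag C W a p b \<Longrightarrow> zz_class C W a b p \<in> Hom (localize C W) a b"
  by (auto simp: localize_def)

text \<open>\<open>Cmp\<close> of the localization is a union over all pairs of representatives. The
  congruence rule \<open>append\<close> makes every member of the union the same class, and
  \<open>p\<close> and \<open>q\<close> themselves show that the family is nonempty, so the union is
  that class.\<close>

lemma localize_Cmp:
  assumes "zigzag C W a p b" "zigzag C W b q c"
  shows "Cmp (localize C W) a b c (zz_class C W b c q) (zz_class C W a b p) = zz_class C W a c (p @ q)"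
proof -
  have "zz_class C W a c (p' @ q') = zz_class C W a c (p @ q)"
    if "p' \<in> zz_class C W a b p" "q' \<in> zz_class C W b c q" for p' q'
    using that by (intro zz_class_eqI zz_eq.append) (auto simp: zz_class_def intro: zz_eq.sym)
  then show ?thesis
    using zz_class_self[OF assms(1)] zz_class_self[OF assms(2)]
    unfolding localize_def category.simps by (blast intro!: SUP_eq_const)
qed

lemma cat_localize: "cat C \<Longrightarrow> cat (localize C W)"
proof
  fix a assume "a \<in> Ob (localize C W)"
  then show "Idn (localize C W) a \<in> Hom (localize C W) a a"
    by (auto simp: localize_Idn intro: localize_HomI zigzag.intros)
qed (auto elim!: localize_HomE simp: localize_Cmp localize_Idn zigzag.intros zigzag_append
    intro!: localize_HomI)

lemma loc_arr_in:
  "\<lbrakk>a \<in> Ob C; b \<in> Ob C; f \<in> Hom C a b\<rbrakk> \<Longrightarrow> loc_arr C W a b f \<in> Hom (localize C W) a b"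
  unfolding loc_arr_def by (intro localize_HomI zigzag_Fwd1)

text \<open>The inverse is the class of the single backward step along \<open>w\<close>; the
  relations \<open>inv_left\<close> and \<open>inv_right\<close> are the two equations
  required.\<close>

lemma loc_arr_isomorphism:
  assumes "a \<in> Ob C" "b \<in> Ob C" "w \<in> Hom C a b" "w \<in> W a b"
  shows "is_isomorphism (localize C W) a b (loc_arr C W a b w)"
proof -
  have "zigzag C W a [Fwd a w b] b" "zigzag C W b [Bwd a w b] a"
    using assms by (auto intro: zigzag_Fwd1 zigzag_Bwd1)
  moreover have "zz_class C W a a [Fwd a w b, Bwd a w b] = zz_class C W a a []"
    "zz_class C W b b [Bwd a w b, Fwd a w b] = zz_class C W b b []"
    using assms by (auto intro!: zz_class_eqI zz_eq.inv_left zz_eq.inv_right)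
  ultimately show ?thesis
    unfolding is_isomorphism_def loc_arr_def localize_Idn
    by (metis append_Cons append_Nil localize_Cmp localize_HomI)
qed

section \<open>Functors induced on localizations\<close>

text \<open>The condition for \<open>loc_ftor\<close> to be well defined: a backward step has to go
  to a backward step, so the image of an inverted morphism must be inverted again. Membership in
  \<open>Hom C a b\<close> is asked separately because \<open>W\<close> is an arbitrary family of
  sets.\<close>

definition preserves :: "('o, 'x, 'z) category_scheme \<Rightarrow> ('o \<Rightarrow> 'o \<Rightarrow> 'x set) \<Rightarrow>
    ('p \<Rightarrow> 'p \<Rightarrow> 'y set) \<Rightarrow> ('o, 'x, 'p, 'y) ftor \<Rightarrow> bool" where
  "preserves C W V T \<longleftrightarrow> (\<forall>a \<in> Ob C. \<forall>b \<in> Ob C. \<forall>w \<in> Hom C a b.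
     w \<in> W a b \<longrightarrow> on_arr T a b w \<in> V (on_ob T a) (on_ob T b))"

lemma preserves_comp:
  "\<lbrakk>is_functor C D T; preserves C W V T; preserves D V V' S\<rbrakk> \<Longrightarrow> preserves C W V' (ftor_comp S T)"
  unfolding preserves_def is_functor_def ftor_comp_def by simp

lemma zigzag_map:
  assumes "is_functor C D T" "preserves C W V T"
  shows "zigzag C W a p b \<Longrightarrow> zigzag D V (on_ob T a) (map (map_step T) p) (on_ob T b)"
proof (induction rule: zigzag.induct)
  case (Nil a)
  then show ?case using assms by (auto intro: zigzag.intros functor_Ob)
next
  case (Fwd a b f p c)
  then show ?case using assms by (auto intro!: zigzag.intros intro: functor_Ob functor_Hom)
next
  case (Bwd a b w p c)
  then show ?case using assms
    by (auto simp: preserves_def intro!: zigzag.intros intro: functor_Ob functor_Hom)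
qed

lemma zz_eq_map:
  assumes "is_functor C D T" "preserves C W V T"
  shows "zz_eq C W a p q b \<Longrightarrow>
    zz_eq D V (on_ob T a) (map (map_step T) p) (map (map_step T) q) (on_ob T b)"
proof (induction rule: zz_eq.induct)
  case (refl a p b)
  then show ?case using zigzag_map[OF assms] by (blast intro: zz_eq.refl)
next
  case (sym a p q b)
  then show ?case by (blast intro: zz_eq.sym)
next
  case (trans a p q b r)
  then show ?case by (blast intro: zz_eq.trans)
next
  case (append a p p' b q q' c)
  then show ?case by (auto intro: zz_eq.append)
next
  case (ident a)
  then show ?case using zz_eq.ident[of "on_ob T a" D V] assms by (simp add: functor_Ob functor_Idn)
next
  case (comp a b c f g)
  then show ?case using assms
    by (auto simp: functor_Cmp intro!: zz_eq.comp intro: functor_Ob functor_Hom)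
next
  case (inv_left a b w)
  then show ?case using assms
    by (auto simp: preserves_def intro!: zz_eq.inv_left intro: functor_Ob functor_Hom)
next
  case (inv_right a b w)
  then show ?case using assms
    by (auto simp: preserves_def intro!: zz_eq.inv_right intro: functor_Ob functor_Hom)
qed

lemma loc_ftor_on_ob [simp]: "on_ob (loc_ftor D V T) = on_ob T"
  by (simp add: loc_ftor_def)

text \<open>As for composition, \<open>on_arr\<close> of \<open>loc_ftor\<close> is a union over
  representatives. By \<open>zz_eq_map\<close> equivalent zigzags have equivalent images, so a
  single representative computes it.\<close>

lemma loc_ftor_class:
  assumes "is_functor C D T" "preserves C W V T" "zigzag C W a p b"
  shows "on_arr (loc_ftor D V T) a b (zz_class C W a b p)
    = zz_class D V (on_ob T a) (on_ob T b) (map (map_step T) p)"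
proof -
  have "zz_class D V (on_ob T a) (on_ob T b) (map (map_step T) q)
      = zz_class D V (on_ob T a) (on_ob T b) (map (map_step T) p)"
    if "q \<in> zz_class C W a b p" for q
    using that zz_eq_map[OF assms(1,2)]
    by (intro zz_class_eqI) (auto simp: zz_class_def intro: zz_eq.sym)
  then show ?thesis
    using zz_class_self[OF assms(3)] unfolding loc_ftor_def ftor.simps by (blast intro!: SUP_eq_const)
qed

lemma loc_ftor_loc_arr:
  assumes "is_functor C D T" "preserves C W V T" "a \<in> Ob C" "b \<in> Ob C" "f \<in> Hom C a b"
  shows "on_arr (loc_ftor D V T) a b (loc_arr C W a b f)
    = loc_arr D V (on_ob T a) (on_ob T b) (on_arr T a b f)"
  using loc_ftor_class[OF assms(1,2) zigzag_Fwd1[OF assms(3-5)]] by (simp add: loc_arr_def)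

lemma is_functor_loc_ftor:
  assumes "is_functor C D T" "preserves C W V T"
  shows "is_functor (localize C W) (localize D V) (loc_ftor D V T)"
proof -
  note [simp] = loc_ftor_class[OF assms]
  have "zz_class D V (on_ob T a) (on_ob T b) (map (map_step T) p)
      \<in> Hom (localize D V) (on_ob T a) (on_ob T b)" if "zigzag C W a p b" for a p b
    using zigzag_map[OF assms that] by (rule localize_HomI)
  moreover have "on_arr (loc_ftor D V T) a a (zz_class C W a a []) = zz_class D V (on_ob T a) (on_ob T a) []"
    if "a \<in> Ob C" for a
    using that zigzag.Nil[of a C W] by simp
  moreover have "on_arr (loc_ftor D V T) a c (Cmp (localize C W) a b c g f)
    = Cmp (localize D V) (on_ob T a) (on_ob T b) (on_ob T c)
       (on_arr (loc_ftor D V T) b c g) (on_arr (loc_ftor D V T) a b f)"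
    if f: "f \<in> Hom (localize C W) a b" and g: "g \<in> Hom (localize C W) b c" for a b c f g
  proof -
    obtain p q where "zigzag C W a p b" "f = zz_class C W a b p"
      "zigzag C W b q c" "g = zz_class C W b c q"
      using f g by (auto elim!: localize_HomE)
    then show ?thesis
      using zigzag_map[OF assms] by (simp add: localize_Cmp zigzag_append)
  qed
  ultimately show ?thesis
    using assms(1) unfolding is_functor_def[of "localize C W"]
    by (auto simp: localize_Idn functor_Ob elim!: localize_HomE)
qed

section \<open>Natural transformations and formal inverses\<close>

text \<open>Inverting the two parallel sides of a commutative square leaves it commutative: append
  \<open>w'\<close> and its formal inverse after \<open>s\<close>, exchange \<open>s\<close>,
  \<open>w'\<close> for \<open>w\<close>, \<open>t\<close> by the square, and cancel the formal
  inverse of \<open>w\<close> against \<open>w\<close>.\<close>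

lemma zz_eq_square_Bwd:
  assumes ob: "a \<in> Ob D" "a' \<in> Ob D" "b \<in> Ob D" "b' \<in> Ob D"
    and w: "w \<in> Hom D a b" "w \<in> V a b" and w': "w' \<in> Hom D a' b'" "w' \<in> V a' b'"
    and s: "s \<in> Hom D a a'" and t: "t \<in> Hom D b b'"
    and comm: "Cmp D a b b' t w = Cmp D a a' b' w' s"
  shows "zz_eq D V b [Bwd a w b, Fwd a s a'] [Fwd b t b', Bwd a' w' b'] a'"
proof -
  have sq: "zz_eq D V a [Fwd a s a', Fwd a' w' b'] [Fwd a w b, Fwd b t b'] b'"
    using zz_eq.comp[OF ob(1,2,4) s w'(1), of V] zz_eq.comp[OF ob(1,3,4) w(1) t, of V] comm
    by (auto intro: zz_eq.trans zz_eq.sym)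
  have Bw: "zz_eq D V b [Bwd a w b] [Bwd a w b] a"
    and Bw': "zz_eq D V b' [Bwd a' w' b'] [Bwd a' w' b'] a'"
    and Fs: "zz_eq D V a [Fwd a s a'] [Fwd a s a'] a'"
    and Ft: "zz_eq D V b [Fwd b t b'] [Fwd b t b'] b'"
    using assms by (auto intro!: zz_eq.refl zigzag_Fwd1 zigzag_Bwd1)
  have "zz_eq D V b ([Bwd a w b] @ [Fwd a s a'] @ [Fwd a' w' b', Bwd a' w' b'])
      ([Bwd a w b] @ [Fwd a s a'] @ []) a'"
    by (intro zz_eq.append[OF Bw] zz_eq.append[OF Fs] zz_eq.inv_left ob w')
  then have 1: "zz_eq D V b [Bwd a w b, Fwd a s a'] ([Bwd a w b] @ [Fwd a s a', Fwd a' w' b'] @ [Bwd a' w' b']) a'"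
    by (auto intro: zz_eq.sym)
  have 2: "zz_eq D V b ([Bwd a w b] @ [Fwd a s a', Fwd a' w' b'] @ [Bwd a' w' b'])
      ([Bwd a w b] @ [Fwd a w b, Fwd b t b'] @ [Bwd a' w' b']) a'"
    by (intro zz_eq.append[OF Bw] zz_eq.append[OF sq] Bw')
  have "zz_eq D V b ([Bwd a w b, Fwd a w b] @ ([Fwd b t b'] @ [Bwd a' w' b']))
      ([] @ ([Fwd b t b'] @ [Bwd a' w' b'])) a'"
    by (intro zz_eq.append[OF zz_eq.inv_right] zz_eq.append[OF Ft Bw'] ob w)
  then show ?thesis
    using 1 2 by (auto intro: zz_eq.trans)
qed

text \<open>The induction hypothesis carries the component of \<open>\<tau>\<close> from the end of
  the tail to its beginning; one more step remains to be passed. A forward step is passed by the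
  naturality square, a backward step by \<open>zz_eq_square_Bwd\<close> applied to the naturality
  square of the inverted morphism.\<close>

lemma zz_eq_natural:
  assumes T: "is_functor C D T" "preserves C W V T"
    and S: "is_functor C D S" "preserves C W V S"
    and tau: "\<And>a. a \<in> Ob C \<Longrightarrow> \<tau> a \<in> Hom D (on_ob T a) (on_ob S a)"
    and nat: "\<And>a b f. \<lbrakk>a \<in> Ob C; b \<in> Ob C; f \<in> Hom C a b\<rbrakk> \<Longrightarrow>
      Cmp D (on_ob T a) (on_ob T b) (on_ob S b) (\<tau> b) (on_arr T a b f)
      = Cmp D (on_ob T a) (on_ob S a) (on_ob S b) (on_arr S a b f) (\<tau> a)"
  shows "zigzag C W a p b \<Longrightarrow> zz_eq D V (on_ob T a)
    (map (map_step T) p @ [Fwd (on_ob T b) (\<tau> b) (on_ob S b)])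
    (Fwd (on_ob T a) (\<tau> a) (on_ob S a) # map (map_step S) p) (on_ob S b)"
proof (induction rule: zigzag.induct)
  case (Nil a)
  then show ?case using tau T S by (auto intro!: zz_eq.refl zigzag_Fwd1 intro: functor_Ob)
next
  case (Fwd a b f p c)
  let ?Tf = "Fwd (on_ob T a) (on_arr T a b f) (on_ob T b)"
  let ?Sf = "Fwd (on_ob S a) (on_arr S a b f) (on_ob S b)"
  let ?ta = "Fwd (on_ob T a) (\<tau> a) (on_ob S a)" and ?tb = "Fwd (on_ob T b) (\<tau> b) (on_ob S b)"
  let ?tc = "Fwd (on_ob T c) (\<tau> c) (on_ob S c)"
  note ob = functor_Ob[OF T(1) Fwd(1)] functor_Ob[OF T(1) Fwd(2)]
    functor_Ob[OF S(1) Fwd(1)] functor_Ob[OF S(1) Fwd(2)]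
  note arr = functor_Hom[OF T(1) Fwd(1-3)] functor_Hom[OF S(1) Fwd(1-3)]
  have "zz_eq D V (on_ob T a) ([?Tf] @ (map (map_step T) p @ [?tc])) ([?Tf] @ (?tb # map (map_step S) p)) (on_ob S c)"
    by (intro zz_eq.append[OF _ Fwd.IH] zz_eq.refl zigzag_Fwd1 ob arr)
  moreover have "zz_eq D V (on_ob T a) [?Tf, ?tb] [?ta, ?Sf] (on_ob S b)"
    using zz_eq.comp[OF ob(1,2,4) arr(1) tau[OF Fwd(2)], of V]
      zz_eq.comp[OF ob(1,3,4) tau[OF Fwd(1)] arr(2), of V] nat[OF Fwd(1-3)]
    by (auto intro: zz_eq.trans zz_eq.sym)
  then have "zz_eq D V (on_ob T a) ([?Tf, ?tb] @ map (map_step S) p) ([?ta, ?Sf] @ map (map_step S) p) (on_ob S c)"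
    by (rule zz_eq.append) (intro zz_eq.refl zigzag_map[OF S] Fwd)
  ultimately show ?case
    by (auto intro: zz_eq.trans)
next
  case (Bwd a b w p c)
  let ?Tw = "Bwd (on_ob T b) (on_arr T b a w) (on_ob T a)"
  let ?Sw = "Bwd (on_ob S b) (on_arr S b a w) (on_ob S a)"
  let ?ta = "Fwd (on_ob T a) (\<tau> a) (on_ob S a)" and ?tb = "Fwd (on_ob T b) (\<tau> b) (on_ob S b)"
  let ?tc = "Fwd (on_ob T c) (\<tau> c) (on_ob S c)"
  note ob = functor_Ob[OF T(1) Bwd(1)] functor_Ob[OF T(1) Bwd(2)]
    functor_Ob[OF S(1) Bwd(1)] functor_Ob[OF S(1) Bwd(2)]
  note arr = functor_Hom[OF T(1) Bwd(2,1,3)] functor_Hom[OF S(1) Bwd(2,1,3)]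
  have W: "on_arr T b a w \<in> V (on_ob T b) (on_ob T a)" "on_arr S b a w \<in> V (on_ob S b) (on_ob S a)"
    using T(2) S(2) Bwd by (auto simp: preserves_def)
  have "zz_eq D V (on_ob T a) ([?Tw] @ (map (map_step T) p @ [?tc])) ([?Tw] @ (?tb # map (map_step S) p)) (on_ob S c)"
    by (intro zz_eq.append[OF _ Bwd.IH] zz_eq.refl zigzag_Bwd1 ob arr W)
  moreover have "zz_eq D V (on_ob T a) [?Tw, ?tb] [?ta, ?Sw] (on_ob S b)"
    by (rule zz_eq_square_Bwd) (use ob arr W tau nat Bwd in auto)
  then have "zz_eq D V (on_ob T a) ([?Tw, ?tb] @ map (map_step S) p) ([?ta, ?Sw] @ map (map_step S) p) (on_ob S c)"
    by (rule zz_eq.append) (intro zz_eq.refl zigzag_map[OF S] Bwd)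
  ultimately show ?case
    by (auto intro: zz_eq.trans)
qed

definition id_ftor :: "('o, 'x, 'o, 'x) ftor" where
  "id_ftor = \<lparr>on_ob = (\<lambda>a. a), on_arr = (\<lambda>a b f. f)\<rparr>"

lemma map_step_id_ftor: "map_step id_ftor = id"
proof
  show "map_step id_ftor s = id s" for s :: "('a, 'b) step"
    by (cases s) (auto simp: id_ftor_def)
qed

lemma map_step_ftor_comp: "map_step (ftor_comp S T) = map_step S \<circ> map_step T"
proof
  show "map_step (ftor_comp S T) s = (map_step S \<circ> map_step T) s" for s
    by (cases s) (auto simp: ftor_comp_def)
qed

lemma is_functor_id_ftor: "is_functor C C id_ftor"
  and preserves_id_ftor: "preserves C W W id_ftor"
  by (auto simp: is_functor_def preserves_def id_ftor_def)

lemma on_ob_ftor_comp [simp]: "on_ob (ftor_comp S T) a = on_ob S (on_ob T a)"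
  by (simp add: ftor_comp_def)

lemma on_arr_ftor_comp [simp]:
  "on_arr (ftor_comp S T) a b f = on_arr S (on_ob T a) (on_ob T b) (on_arr T a b f)"
  by (simp add: ftor_comp_def)

lemma on_ob_id_ftor [simp]: "on_ob id_ftor a = a"
  and on_arr_id_ftor [simp]: "on_arr id_ftor a b f = f"
  by (simp_all add: id_ftor_def)

section \<open>Adjunctions given by unit and counit\<close>

definition natural :: "('o, 'x, 'z) category_scheme \<Rightarrow> ('p, 'y, 'w) category_scheme \<Rightarrow>
    ('o, 'x, 'p, 'y) ftor \<Rightarrow> ('o, 'x, 'p, 'y) ftor \<Rightarrow> ('o \<Rightarrow> 'y) \<Rightarrow> bool" where
  "natural C D T S \<tau> \<longleftrightarrow>
    (\<forall>a \<in> Ob C. \<tau> a \<in> Hom D (on_ob T a) (on_ob S a)) \<and>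
    (\<forall>a \<in> Ob C. \<forall>b \<in> Ob C. \<forall>f \<in> Hom C a b.
      Cmp D (on_ob T a) (on_ob T b) (on_ob S b) (\<tau> b) (on_arr T a b f)
      = Cmp D (on_ob T a) (on_ob S a) (on_ob S b) (on_arr S a b f) (\<tau> a))"

text \<open>\<open>J\<close> is the left adjoint. In contrast to \<open>left_adjoint\<close>, which
  asks for bijections of Hom sets, this form is purely equational, and equations can be transported
  to complexes degree by degree and to localizations along zigzags.\<close>

definition unit_counit :: "('o, 'x, 'z) category_scheme \<Rightarrow> ('p, 'y, 'w) category_scheme \<Rightarrow>
    ('o, 'x, 'p, 'y) ftor \<Rightarrow> ('p, 'y, 'o, 'x) ftor \<Rightarrow> ('o \<Rightarrow> 'x) \<Rightarrow> ('p \<Rightarrow> 'y) \<Rightarrow> bool" where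
  "unit_counit C D J R \<eta> \<epsilon> \<longleftrightarrow>
    is_functor C D J \<and> is_functor D C R \<and>
    natural C C id_ftor (ftor_comp R J) \<eta> \<and> natural D D (ftor_comp J R) id_ftor \<epsilon> \<and>
    (\<forall>a \<in> Ob C. Cmp D (on_ob J a) (on_ob J (on_ob R (on_ob J a))) (on_ob J a)
        (\<epsilon> (on_ob J a)) (on_arr J a (on_ob R (on_ob J a)) (\<eta> a)) = Idn D (on_ob J a)) \<and>
    (\<forall>d \<in> Ob D. Cmp C (on_ob R d) (on_ob R (on_ob J (on_ob R d))) (on_ob R d)
        (on_arr R (on_ob J (on_ob R d)) d (\<epsilon> d)) (\<eta> (on_ob R d)) = Idn C (on_ob R d))"

text \<open>Unit and counit stay natural on zigzags, because naturality squares persist for formal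
  inverses.\<close>

lemma loc_adjunction:
  assumes uc: "unit_counit C D J R \<eta> \<epsilon>"
    and J: "preserves C W V J" and R: "preserves D V W R"
    and a: "a \<in> Ob C" and d: "d \<in> Ob D"
  shows "bij_betw (\<lambda>h. Cmp (localize C W) a (on_ob R (on_ob J a)) (on_ob R d)
      (on_arr (loc_ftor C W R) (on_ob J a) d h) (loc_arr C W a (on_ob R (on_ob J a)) (\<eta> a)))
    (Hom (localize D V) (on_ob J a) d) (Hom (localize C W) a (on_ob R d))"
proof -
  define \<Phi> where "\<Phi> h = Cmp (localize C W) a (on_ob R (on_ob J a)) (on_ob R d)
      (on_arr (loc_ftor C W R) (on_ob J a) d h) (loc_arr C W a (on_ob R (on_ob J a)) (\<eta> a))" for h
  \<comment> \<open>The inverse transposition: apply \<open>J\<close>, then the counit. On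
    representing zigzags \<open>\<Phi>\<close> puts the unit in front of the image of
    \<open>p\<close> under \<open>R\<close>, and \<open>\<Psi>\<close> puts the counit behind the
    image of \<open>q\<close> under \<open>J\<close>.\<close>
  define \<Psi> where "\<Psi> k = Cmp (localize D V) (on_ob J a) (on_ob J (on_ob R d)) d
      (loc_arr D V (on_ob J (on_ob R d)) d (\<epsilon> d)) (on_arr (loc_ftor D V J) a (on_ob R d) k)" for k
  have Jf: "is_functor C D J" and Rf: "is_functor D C R"
    and \<eta>: "natural C C id_ftor (ftor_comp R J) \<eta>" and \<epsilon>: "natural D D (ftor_comp J R) id_ftor \<epsilon>"
    and tri1: "\<And>a. a \<in> Ob C \<Longrightarrow> Cmp D (on_ob J a) (on_ob J (on_ob R (on_ob J a))) (on_ob J a)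
        (\<epsilon> (on_ob J a)) (on_arr J a (on_ob R (on_ob J a)) (\<eta> a)) = Idn D (on_ob J a)"
    and tri2: "\<And>d. d \<in> Ob D \<Longrightarrow> Cmp C (on_ob R d) (on_ob R (on_ob J (on_ob R d))) (on_ob R d)
        (on_arr R (on_ob J (on_ob R d)) d (\<epsilon> d)) (\<eta> (on_ob R d)) = Idn C (on_ob R d)"
    using uc by (auto simp: unit_counit_def)
  have \<eta>_in: "\<eta> c \<in> Hom C c (on_ob R (on_ob J c))" if "c \<in> Ob C" for c
    using \<eta> that by (auto simp: natural_def)
  have \<epsilon>_in: "\<epsilon> c \<in> Hom D (on_ob J (on_ob R c)) c" if "c \<in> Ob D" for c
    using \<epsilon> that by (auto simp: natural_def)
  note ob = a d functor_Ob[OF Jf a] functor_Ob[OF Rf d]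
    functor_Ob[OF Rf functor_Ob[OF Jf a]] functor_Ob[OF Jf functor_Ob[OF Rf d]]
  let ?F\<eta> = "\<lambda>c. Fwd c (\<eta> c) (on_ob R (on_ob J c))"
  let ?F\<epsilon> = "\<lambda>c. Fwd (on_ob J (on_ob R c)) (\<epsilon> c) c"
  have z\<eta>: "zigzag C W c [?F\<eta> c] (on_ob R (on_ob J c))" if "c \<in> Ob C" for c
    using that Jf Rf \<eta>_in by (intro zigzag_Fwd1) (auto intro: functor_Ob)
  have z\<epsilon>: "zigzag D V (on_ob J (on_ob R c)) [?F\<epsilon> c] c" if "c \<in> Ob D" for c
    using that Jf Rf \<epsilon>_in by (intro zigzag_Fwd1) (auto intro: functor_Ob)
  note mR = zigzag_map[OF Rf R] and mJ = zigzag_map[OF Jf J]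
  have \<Phi>: "\<Phi> (zz_class D V (on_ob J a) d p) = zz_class C W a (on_ob R d) (?F\<eta> a # map (map_step R) p)"
    if "zigzag D V (on_ob J a) p d" for p
    using localize_Cmp[OF z\<eta>[OF a] mR[OF that]]
    by (simp add: \<Phi>_def loc_arr_def loc_ftor_class[OF Rf R that])
  have \<Psi>: "\<Psi> (zz_class C W a (on_ob R d) q) = zz_class D V (on_ob J a) d (map (map_step J) q @ [?F\<epsilon> d])"
    if "zigzag C W a q (on_ob R d)" for q
    using localize_Cmp[OF mJ[OF that] z\<epsilon>[OF d]]
    by (simp add: \<Psi>_def loc_arr_def loc_ftor_class[OF Jf J that])
  have z\<Phi>: "zigzag C W a (?F\<eta> a # map (map_step R) p) (on_ob R d)"
    if "zigzag D V (on_ob J a) p d" for p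
    using zigzag_append[OF z\<eta>[OF a] mR[OF that]] by simp
  have z\<Psi>: "zigzag D V (on_ob J a) (map (map_step J) q @ [?F\<epsilon> d]) d"
    if "zigzag C W a q (on_ob R d)" for q
    using zigzag_append[OF mJ[OF that] z\<epsilon>[OF d]] .
  have 1: "\<Psi> (\<Phi> h) = h" if h: "h \<in> Hom (localize D V) (on_ob J a) d" for h
  proof -
    obtain p where p: "zigzag D V (on_ob J a) p d" and hp: "h = zz_class D V (on_ob J a) d p"
      using h by (rule localize_HomE)
    let ?J\<eta> = "map_step J (?F\<eta> a)"
    \<comment> \<open>\<open>\<Psi> (\<Phi> h)\<close> is represented by \<open>?J\<eta>\<close>,
      the image of \<open>p\<close> under \<open>J\<close> after \<open>R\<close>, and the counit at
      \<open>d\<close>. Naturality moves the counit in front of \<open>p\<close>, where it meets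
      \<open>?J\<eta>\<close> and cancels by the first triangle identity.\<close>
    have "zz_eq D V (on_ob J (on_ob R (on_ob J a)))
       (map (map_step (ftor_comp J R)) p @ [?F\<epsilon> d]) (?F\<epsilon> (on_ob J a) # p) d"
      using zz_eq_natural[OF is_functor_comp[OF Rf Jf] preserves_comp[OF Rf R J]
          is_functor_id_ftor preserves_id_ftor _ _ p, of \<epsilon>] \<epsilon>
      by (simp add: natural_def map_step_id_ftor)
    then have "zz_eq D V (on_ob J a)
       ([?J\<eta>] @ (map (map_step J \<circ> map_step R) p @ [?F\<epsilon> d])) ([?J\<eta>] @ (?F\<epsilon> (on_ob J a) # p)) d"
      using mJ[OF z\<eta>[OF a]] by (intro zz_eq.append) (auto simp: map_step_ftor_comp intro: zz_eq.refl)
    moreover have "zz_eq D V (on_ob J a) [?J\<eta>, ?F\<epsilon> (on_ob J a)] [] (on_ob J a)"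
    proof -
      have "zz_eq D V (on_ob J a) [?J\<eta>, ?F\<epsilon> (on_ob J a)] [Fwd (on_ob J a) (Idn D (on_ob J a)) (on_ob J a)] (on_ob J a)"
        using zz_eq.comp[OF ob(3) functor_Ob[OF Jf ob(5)] ob(3) functor_Hom[OF Jf a ob(5) \<eta>_in[OF a]] \<epsilon>_in[OF ob(3)], of V]
        by (simp add: tri1[OF a])
      then show ?thesis
        using zz_eq.ident[OF ob(3), of V] by (rule zz_eq.trans)
    qed
    then have "zz_eq D V (on_ob J a) ([?J\<eta>, ?F\<epsilon> (on_ob J a)] @ p) ([] @ p) d"
      by (rule zz_eq.append) (rule zz_eq.refl[OF p])
    ultimately have "zz_eq D V (on_ob J a) (?J\<eta> # map (map_step J \<circ> map_step R) p @ [?F\<epsilon> d]) p d"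
      by (auto intro: zz_eq.trans)
    then have "zz_class D V (on_ob J a) d (?J\<eta> # map (map_step J \<circ> map_step R) p @ [?F\<epsilon> d]) = h"
      unfolding hp by (rule zz_class_eqI)
    then show ?thesis
      by (simp add: hp \<Phi>[OF p] \<Psi>[OF z\<Phi>[OF p]])
  qed
  have 2: "\<Phi> (\<Psi> k) = k" if k: "k \<in> Hom (localize C W) a (on_ob R d)" for k
  proof -
    obtain q where q: "zigzag C W a q (on_ob R d)" and kq: "k = zz_class C W a (on_ob R d) q"
      using k by (rule localize_HomE)
    let ?R\<epsilon> = "map_step R (?F\<epsilon> d)"
    have zR\<epsilon>: "zigzag C W (on_ob R (on_ob J (on_ob R d))) [?R\<epsilon>] (on_ob R d)"
      using mR[OF z\<epsilon>[OF d]] by simp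
    \<comment> \<open>Dually, \<open>\<Phi> (\<Psi> k)\<close> begins with the unit at
      \<open>a\<close>. Naturality moves it behind \<open>q\<close>, where it meets
      \<open>?R\<epsilon>\<close> and cancels by the second triangle identity.\<close>
    have "zz_eq C W a (q @ [?F\<eta> (on_ob R d)]) (?F\<eta> a # map (map_step (ftor_comp R J)) q)
       (on_ob R (on_ob J (on_ob R d)))"
      using zz_eq_natural[OF is_functor_id_ftor preserves_id_ftor
          is_functor_comp[OF Jf Rf] preserves_comp[OF Jf J R] _ _ q, of \<eta>] \<eta>
      by (simp add: natural_def map_step_id_ftor)
    then have "zz_eq C W a ((?F\<eta> a # map (map_step R \<circ> map_step J) q) @ [?R\<epsilon>])
       ((q @ [?F\<eta> (on_ob R d)]) @ [?R\<epsilon>]) (on_ob R d)"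
      unfolding map_step_ftor_comp by (rule zz_eq.append[OF zz_eq.sym zz_eq.refl[OF zR\<epsilon>]])
    moreover have "zz_eq C W (on_ob R d) [?F\<eta> (on_ob R d), ?R\<epsilon>] [] (on_ob R d)"
    proof -
      have "zz_eq C W (on_ob R d) [?F\<eta> (on_ob R d), ?R\<epsilon>] [Fwd (on_ob R d) (Idn C (on_ob R d)) (on_ob R d)] (on_ob R d)"
        using zz_eq.comp[OF ob(4) functor_Ob[OF Rf ob(6)] ob(4) \<eta>_in[OF ob(4)] functor_Hom[OF Rf ob(6) d \<epsilon>_in[OF d]], of W]
        by (simp add: tri2[OF d])
      then show ?thesis
        using zz_eq.ident[OF ob(4), of W] by (rule zz_eq.trans)
    qed
    then have "zz_eq C W a (q @ [?F\<eta> (on_ob R d), ?R\<epsilon>]) (q @ []) (on_ob R d)"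
      by (intro zz_eq.append[OF zz_eq.refl[OF q]])
    ultimately have "zz_eq C W a (?F\<eta> a # map (map_step R \<circ> map_step J) q @ [?R\<epsilon>]) q (on_ob R d)"
      by (auto intro: zz_eq.trans)
    then have "zz_class C W a (on_ob R d) (?F\<eta> a # map (map_step R \<circ> map_step J) q @ [?R\<epsilon>]) = k"
      unfolding kq by (rule zz_class_eqI)
    then show ?thesis
      by (simp add: kq \<Psi>[OF q] \<Phi>[OF z\<Psi>[OF q]])
  qed
  have "\<Phi> h \<in> Hom (localize C W) a (on_ob R d)" if "h \<in> Hom (localize D V) (on_ob J a) d" for h
    using that by (rule localize_HomE) (simp add: \<Phi> localize_HomI[OF z\<Phi>])
  moreover have "\<Psi> k \<in> Hom (localize D V) (on_ob J a) d" if "k \<in> Hom (localize C W) a (on_ob R d)" for k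
    using that by (rule localize_HomE) (simp add: \<Psi> localize_HomI[OF z\<Psi>])
  ultimately have "bij_betw \<Phi> (Hom (localize D V) (on_ob J a) d) (Hom (localize C W) a (on_ob R d))"
    using 1 2 by (intro bij_betw_byWitness[where f' = \<Psi>]) auto
  then show ?thesis
    unfolding \<Phi>_def .
qed

section \<open>Complexes\<close>

lemma Ch_Ob:
  "(A, d) \<in> Ob (Ch C) \<longleftrightarrow> (\<forall>n. A n \<in> Ob C \<and> d n \<in> Hom C (A n) (A (n + 1)) \<and>
    Cmp C (A n) (A (n + 1)) (A (n + 1 + 1)) (d (n + 1)) (d n) = Zero C (A n) (A (n + 1 + 1)))"
  by (simp add: Ch_def)

lemma Ch_Hom:
  "f \<in> Hom (Ch C) (A, d) (B, e) \<longleftrightarrow> (\<forall>n. f n \<in> Hom C (A n) (B n) \<and>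
    Cmp C (A n) (B n) (B (n + 1)) (e n) (f n) = Cmp C (A n) (A (n + 1)) (B (n + 1)) (f (n + 1)) (d n))"
  by (simp add: Ch_def)

lemma Ch_Idn: "Idn (Ch C) A = (\<lambda>n. Idn C (fst A n))"
  by (cases A) (simp add: Ch_def)

lemma Ch_Cmp: "Cmp (Ch C) A B E g f = (\<lambda>n. Cmp C (fst A n) (fst B n) (fst E n) (g n) (f n))"
  by (cases A; cases B; cases E) (simp add: Ch_def)

lemma Ch_Ob_fst: "A \<in> Ob (Ch C) \<Longrightarrow> fst A n \<in> Ob C"
  by (cases A) (simp add: Ch_Ob)

lemma Ch_Hom_component: "f \<in> Hom (Ch C) A B \<Longrightarrow> f n \<in> Hom C (fst A n) (fst B n)"
  by (cases A; cases B) (simp add: Ch_Hom)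

lemma cat_Ch:
  assumes "cat C"
  shows "cat (Ch C)"
proof -
  interpret cat C by fact
  show ?thesis
  proof
    fix a assume "a \<in> Ob (Ch C)"
    then show "Idn (Ch C) a \<in> Hom (Ch C) a a"
      by (cases a) (simp add: Ch_Idn Ch_Ob Ch_Hom Idn_in Cmp_Idn Idn_Cmp)
  next
    fix a b c f g
    assume ob: "a \<in> Ob (Ch C)" "b \<in> Ob (Ch C)" "c \<in> Ob (Ch C)"
      and f: "f \<in> Hom (Ch C) a b" and g: "g \<in> Hom (Ch C) b c"
    obtain A dA B dB E dE where [simp]: "a = (A, dA)" "b = (B, dB)" "c = (E, dE)"
      by (metis surj_pair)
    have [simp]: "A n \<in> Ob C" "B n \<in> Ob C" "E n \<in> Ob C" for n
      using ob by (auto simp: Ch_Ob)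
    have [simp]: "dA n \<in> Hom C (A n) (A (n + 1))" "dB n \<in> Hom C (B n) (B (n + 1))"
      "dE n \<in> Hom C (E n) (E (n + 1))" "f n \<in> Hom C (A n) (B n)" "g n \<in> Hom C (B n) (E n)" for n
      using ob f g by (auto simp: Ch_Ob Ch_Hom)
    have "Cmp C (A n) (E n) (E (n + 1)) (dE n) (Cmp C (A n) (B n) (E n) (g n) (f n))
      = Cmp C (A n) (A (n + 1)) (E (n + 1))
         (Cmp C (A (n + 1)) (B (n + 1)) (E (n + 1)) (g (n + 1)) (f (n + 1))) (dA n)" for n
    proof -
      have "Cmp C (A n) (E n) (E (n + 1)) (dE n) (Cmp C (A n) (B n) (E n) (g n) (f n))
        = Cmp C (A n) (B n) (E (n + 1)) (Cmp C (B n) (E n) (E (n + 1)) (dE n) (g n)) (f n)"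
        by (simp add: Cmp_assoc)
      also have "\<dots> = Cmp C (A n) (B n) (E (n + 1)) (Cmp C (B n) (B (n + 1)) (E (n + 1)) (g (n + 1)) (dB n)) (f n)"
        using g by (simp add: Ch_Hom)
      also have "\<dots> = Cmp C (A n) (B (n + 1)) (E (n + 1)) (g (n + 1)) (Cmp C (A n) (B n) (B (n + 1)) (dB n) (f n))"
        by (rule Cmp_assoc[symmetric]) simp_all
      also have "\<dots> = Cmp C (A n) (B (n + 1)) (E (n + 1)) (g (n + 1)) (Cmp C (A n) (A (n + 1)) (B (n + 1)) (f (n + 1)) (dA n))"
        using f by (simp add: Ch_Hom)
      also have "\<dots> = Cmp C (A n) (A (n + 1)) (E (n + 1))
         (Cmp C (A (n + 1)) (B (n + 1)) (E (n + 1)) (g (n + 1)) (f (n + 1))) (dA n)"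
        by (rule Cmp_assoc) simp_all
      finally show ?thesis .
    qed
    then show "Cmp (Ch C) a b c g f \<in> Hom (Ch C) a c"
      by (simp add: Ch_Cmp Ch_Hom Cmp_in[of _ "B _"])
  next
    fix a b f
    assume "a \<in> Ob (Ch C)" "b \<in> Ob (Ch C)" "f \<in> Hom (Ch C) a b"
    then show "Cmp (Ch C) a a b f (Idn (Ch C) a) = f" "Cmp (Ch C) a b b (Idn (Ch C) b) f = f"
      by (auto simp: Ch_Cmp Ch_Idn Ch_Ob_fst Ch_Hom_component Cmp_Idn Idn_Cmp)
  next
    fix a b c d f g h
    assume "a \<in> Ob (Ch C)" "b \<in> Ob (Ch C)" "c \<in> Ob (Ch C)" "d \<in> Ob (Ch C)"
      "f \<in> Hom (Ch C) a b" "g \<in> Hom (Ch C) b c" "h \<in> Hom (Ch C) c d"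
    then show "Cmp (Ch C) a c d h (Cmp (Ch C) a b c g f) = Cmp (Ch C) a b d (Cmp (Ch C) b c d h g) f"
      by (auto simp: Ch_Cmp Ch_Ob_fst intro!: Cmp_assoc Ch_Hom_component)
  qed
qed

section \<open>Termwise functors between complexes\<close>

lemma ch_ftor_on_ob: "on_ob (ch_ftor T) (A, d) = (\<lambda>n. on_ob T (A n), \<lambda>n. on_arr T (A n) (A (n + 1)) (d n))"
  by (simp add: ch_ftor_def)

lemma fst_ch_ftor [simp]: "fst (on_ob (ch_ftor T) A) = (\<lambda>n. on_ob T (fst A n))"
  by (cases A) (simp add: ch_ftor_on_ob)

lemma ch_ftor_on_arr: "on_arr (ch_ftor T) A B f = (\<lambda>n. on_arr T (fst A n) (fst B n) (f n))"
  by (cases A; cases B) (simp add: ch_ftor_def)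

lemma ch_ftor_comp: "ch_ftor (ftor_comp S T) = ftor_comp (ch_ftor S) (ch_ftor T)"
  by (auto simp: ch_ftor_def ftor_comp_def fun_eq_iff)

lemma ch_ftor_id: "ch_ftor id_ftor = id_ftor"
  by (auto simp: ch_ftor_def id_ftor_def fun_eq_iff)

text \<open>Preserving zero morphisms is what keeps the composite of two differentials zero, hence
  what termwise application to complexes demands. Exactness proper is not part of it; it enters
  through \<open>preserves\<close>, as the preservation of quasi-isomorphisms.\<close>

definition exact0 :: "('o, 'x, 'z) category0_scheme \<Rightarrow> ('p, 'y, 'w) category0_scheme \<Rightarrow>
    ('o, 'x, 'p, 'y) ftor \<Rightarrow> bool" where
  "exact0 C D T \<longleftrightarrow> is_functor C D T \<and>
    (\<forall>a \<in> Ob C. \<forall>b \<in> Ob C. on_arr T a b (Zero C a b) = Zero D (on_ob T a) (on_ob T b))"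

lemma is_functor_ch:
  assumes T: "exact0 C D T"
  shows "is_functor (Ch C) (Ch D) (ch_ftor T)"
proof -
  have F: "is_functor C D T"
    and Z: "\<And>a b. a \<in> Ob C \<Longrightarrow> b \<in> Ob C \<Longrightarrow> on_arr T a b (Zero C a b) = Zero D (on_ob T a) (on_ob T b)"
    using T by (auto simp: exact0_def)
  note fo = functor_Ob[OF F] functor_Hom[OF F]
  have "on_ob (ch_ftor T) X \<in> Ob (Ch D)" if "X \<in> Ob (Ch C)" for X
  proof -
    obtain A d where X: "X = (A, d)" by (metis surj_pair)
    have h: "\<And>n. A n \<in> Ob C" "\<And>n. d n \<in> Hom C (A n) (A (n + 1))"
      "\<And>n. Cmp C (A n) (A (n + 1)) (A (n + 1 + 1)) (d (n + 1)) (d n) = Zero C (A n) (A (n + 1 + 1))"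
      using that by (auto simp: X Ch_Ob)
    have "Cmp D (on_ob T (A n)) (on_ob T (A (n + 1))) (on_ob T (A (n + 1 + 1)))
        (on_arr T (A (n + 1)) (A (n + 1 + 1)) (d (n + 1))) (on_arr T (A n) (A (n + 1)) (d n))
      = Zero D (on_ob T (A n)) (on_ob T (A (n + 1 + 1)))" for n
      using functor_Cmp[OF F h(1) h(1) h(1) h(2) h(2), of n] h(3)[of n] Z[OF h(1) h(1)] by simp
    then show ?thesis
      using h fo by (simp add: X Ch_Ob ch_ftor_on_ob)
  qed
  moreover have "on_arr (ch_ftor T) X Y f \<in> Hom (Ch D) (on_ob (ch_ftor T) X) (on_ob (ch_ftor T) Y)"
    if X: "X \<in> Ob (Ch C)" and Y: "Y \<in> Ob (Ch C)" and f: "f \<in> Hom (Ch C) X Y" for X Y f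
  proof -
    obtain A d B e where XY: "X = (A, d)" "Y = (B, e)" by (metis surj_pair)
    have h: "\<And>n. A n \<in> Ob C" "\<And>n. d n \<in> Hom C (A n) (A (n + 1))"
      "\<And>n. B n \<in> Ob C" "\<And>n. e n \<in> Hom C (B n) (B (n + 1))"
      "\<And>n. f n \<in> Hom C (A n) (B n)"
      "\<And>n. Cmp C (A n) (B n) (B (n + 1)) (e n) (f n) = Cmp C (A n) (A (n + 1)) (B (n + 1)) (f (n + 1)) (d n)"
      using X Y f by (auto simp: XY Ch_Ob Ch_Hom)
    have "Cmp D (on_ob T (A n)) (on_ob T (B n)) (on_ob T (B (n + 1)))
        (on_arr T (B n) (B (n + 1)) (e n)) (on_arr T (A n) (B n) (f n))
      = Cmp D (on_ob T (A n)) (on_ob T (A (n + 1))) (on_ob T (B (n + 1)))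
        (on_arr T (A (n + 1)) (B (n + 1)) (f (n + 1))) (on_arr T (A n) (A (n + 1)) (d n))" for n
      using functor_Cmp[OF F h(1) h(3) h(3) h(5) h(4), of n]
        functor_Cmp[OF F h(1) h(1) h(3) h(2) h(5), of n] h(6)[of n] by simp
    then show ?thesis
      using h fo by (simp add: XY Ch_Hom ch_ftor_on_ob ch_ftor_on_arr)
  qed
  moreover have "on_arr (ch_ftor T) X X (Idn (Ch C) X) = Idn (Ch D) (on_ob (ch_ftor T) X)"
    if "X \<in> Ob (Ch C)" for X
    using that by (simp add: ch_ftor_on_arr Ch_Idn functor_Idn[OF F] Ch_Ob_fst)
  moreover have "on_arr (ch_ftor T) X Z (Cmp (Ch C) X Y Z g f)
    = Cmp (Ch D) (on_ob (ch_ftor T) X) (on_ob (ch_ftor T) Y) (on_ob (ch_ftor T) Z)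
       (on_arr (ch_ftor T) Y Z g) (on_arr (ch_ftor T) X Y f)"
    if "X \<in> Ob (Ch C)" "Y \<in> Ob (Ch C)" "Z \<in> Ob (Ch C)"
      "f \<in> Hom (Ch C) X Y" "g \<in> Hom (Ch C) Y Z" for X Y Z f g
    using that by (simp add: ch_ftor_on_arr Ch_Cmp functor_Cmp[OF F] Ch_Ob_fst Ch_Hom_component)
  ultimately show ?thesis
    by (simp add: is_functor_def)
qed

text \<open>That the components form a morphism of complexes is naturality of \<open>\<tau>\<close>
  at the differentials.\<close>

lemma natural_ch:
  assumes T: "is_functor C D T" and S: "is_functor C D S" and nat: "natural C D T S \<tau>"
  shows "natural (Ch C) (Ch D) (ch_ftor T) (ch_ftor S) (\<lambda>A n. \<tau> (fst A n))"
proof -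
  have tau: "\<And>a. a \<in> Ob C \<Longrightarrow> \<tau> a \<in> Hom D (on_ob T a) (on_ob S a)"
    and sq: "\<And>a b f. \<lbrakk>a \<in> Ob C; b \<in> Ob C; f \<in> Hom C a b\<rbrakk> \<Longrightarrow>
      Cmp D (on_ob T a) (on_ob T b) (on_ob S b) (\<tau> b) (on_arr T a b f)
      = Cmp D (on_ob T a) (on_ob S a) (on_ob S b) (on_arr S a b f) (\<tau> a)"
    using nat by (auto simp: natural_def)
  have "(\<lambda>n. \<tau> (fst X n)) \<in> Hom (Ch D) (on_ob (ch_ftor T) X) (on_ob (ch_ftor S) X)"
    if "X \<in> Ob (Ch C)" for X
  proof -
    obtain A d where X: "X = (A, d)" by (metis surj_pair)
    show ?thesis
      using that tau sq by (simp add: X Ch_Ob Ch_Hom ch_ftor_on_ob)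
  qed
  then show ?thesis
    using sq by (simp add: natural_def ch_ftor_on_arr Ch_Cmp Ch_Ob_fst Ch_Hom_component)
qed

lemma unit_counit_ch:
  assumes J: "exact0 C D J" and R: "exact0 D C R"
    and uc: "unit_counit C D J R \<eta> \<epsilon>"
  shows "unit_counit (Ch C) (Ch D) (ch_ftor J) (ch_ftor R)
    (\<lambda>A n. \<eta> (fst A n)) (\<lambda>A n. \<epsilon> (fst A n))"
proof -
  have JR: "is_functor C D J" "is_functor D C R"
    using J R by (auto simp: exact0_def)
  have "natural (Ch C) (Ch C) id_ftor (ftor_comp (ch_ftor R) (ch_ftor J)) (\<lambda>A n. \<eta> (fst A n))"
    using natural_ch[OF is_functor_id_ftor is_functor_comp[OF JR], of \<eta>] uc
    by (simp add: ch_ftor_id ch_ftor_comp unit_counit_def)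
  moreover have "natural (Ch D) (Ch D) (ftor_comp (ch_ftor J) (ch_ftor R)) id_ftor (\<lambda>A n. \<epsilon> (fst A n))"
    using natural_ch[OF is_functor_comp[OF JR(2,1)] is_functor_id_ftor, of \<epsilon>] uc
    by (simp add: ch_ftor_id ch_ftor_comp unit_counit_def)
  ultimately show ?thesis
    using is_functor_ch[OF J] is_functor_ch[OF R] uc
    by (simp add: unit_counit_def Ch_Cmp Ch_Idn ch_ftor_on_arr Ch_Ob_fst)
qed


section \<open>Abelian groups\<close>

lemma Ab_Ob: "G \<in> Ob Ab \<longleftrightarrow> comm_group G \<and> carrier G \<prec> (UNIV :: 'u set)" for G :: "'u monoid"
  by (simp add: Ab_def)

lemma Ab_comm_group: "G \<in> Ob Ab \<Longrightarrow> comm_group G"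
  by (simp add: Ab_Ob)

lemma Ab_group: "G \<in> Ob Ab \<Longrightarrow> group G"
  by (simp add: Ab_Ob comm_group.axioms(2))

lemma Ab_Hom: "f \<in> Hom Ab G H \<longleftrightarrow> f \<in> hom G H \<and> f \<in> extensional (carrier G)"
  by (simp add: Ab_def)

lemma Ab_Idn: "Idn Ab G = (\<lambda>s \<in> carrier G. s)"
  by (simp add: Ab_def)

lemma Ab_Cmp: "Cmp Ab G H K g f = compose (carrier G) g f"
  by (simp add: Ab_def)

lemma Ab_Zero: "Zero Ab G H = (\<lambda>s \<in> carrier G. \<one>\<^bsub>H\<^esub>)"
  by (simp add: Ab_def)

lemma Ab_Hom_carrier: "f \<in> Hom Ab G H \<Longrightarrow> s \<in> carrier G \<Longrightarrow> f s \<in> carrier H"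
  by (auto simp: Ab_Hom hom_def)

lemma Ab_Hom_one: "\<lbrakk>f \<in> Hom Ab G H; G \<in> Ob Ab; H \<in> Ob Ab\<rbrakk> \<Longrightarrow> f \<one>\<^bsub>G\<^esub> = \<one>\<^bsub>H\<^esub>"
  by (simp add: Ab_Hom Ab_group hom_one)

lemma cat_Ab: "cat Ab"
proof
  show "Idn Ab a \<in> Hom Ab a a" if "a \<in> Ob Ab" for a :: "'u monoid"
  proof -
    interpret comm_group a by (rule Ab_comm_group[OF that])
    show ?thesis by (auto simp: Ab_Hom Ab_Idn hom_def)
  qed
next
  fix a b c :: "'u monoid" and f g
  assume "a \<in> Ob Ab" "f \<in> Hom Ab a b" "g \<in> Hom Ab b c"
  then show "Cmp Ab a b c g f \<in> Hom Ab a c"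
    using group.hom_compose[OF Ab_group, of a f b g c] by (simp add: Ab_Hom Ab_Cmp)
next
  fix a b :: "'u monoid" and f assume f: "f \<in> Hom Ab a b"
  show "Cmp Ab a a b f (Idn Ab a) = f"
    using f by (auto simp: Ab_Hom Ab_Cmp Ab_Idn compose_def extensional_def fun_eq_iff)
  show "Cmp Ab a b b (Idn Ab b) f = f"
    using f Ab_Hom_carrier[OF f] by (auto simp: Ab_Hom Ab_Cmp Ab_Idn compose_def extensional_def fun_eq_iff)
next
  fix a b c d :: "'u monoid" and f g h assume f: "f \<in> Hom Ab a b"
  show "Cmp Ab a c d h (Cmp Ab a b c g f) = Cmp Ab a b d (Cmp Ab b c d h g) f"
    using Ab_Hom_carrier[OF f] by (auto simp: Ab_Cmp compose_def fun_eq_iff)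
qed

text \<open>If the universe has a single element, then no group is admitted, not even a trivial one.\<close>

lemma singleton_group_Ab:
  assumes "M \<in> (Ob Ab :: 'u monoid set)"
  shows "singleton_group (undefined :: 'u) \<in> Ob Ab"
proof -
  interpret comm_group M by (rule Ab_comm_group[OF assms])
  \<comment> \<open>The unit of \<open>M\<close> is the one element sure to exist. Sending
    \<open>undefined\<close> to it bounds the singleton by a carrier already known to be smaller
    than the universe.\<close>
  have "{undefined :: 'u} \<lesssim> carrier M"
    using one_closed by (auto simp: lepoll_def intro!: exI[of _ "\<lambda>_. \<one>\<^bsub>M\<^esub>"])
  then show ?thesis
    using assms by (auto simp: Ab_Ob intro: lesspoll_trans1)
qed

text \<open>Identity components force the two differentials to coincide, so source and target are
  the same complex and the induced map on cohomology is the identity. The groups are required to be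
  equal, not just isomorphic; this is the situation on the stalks for all canonical morphisms
  considered below.\<close>

lemma qis_Ab_identity:
  assumes A: "A \<in> Ob (Ch Ab)" and B: "B \<in> Ob (Ch Ab)" and f: "f \<in> Hom (Ch Ab) A B"
    and same: "\<And>n. fst B n = fst A n" and id: "\<And>n. f n = Idn Ab (fst A n)"
  shows "f \<in> qis_Ab A B"
proof -
  interpret AB: cat Ab by (rule cat_Ab)
  obtain G d e where AB: "A = (G, d)" "B = (G, e)"
    by (metis same ext fst_conv surj_pair)
  have G: "G n \<in> Ob Ab" and d: "d n \<in> Hom Ab (G n) (G (n + 1))"
    and dd: "Cmp Ab (G n) (G (n + 1)) (G (n + 1 + 1)) (d (n + 1)) (d n) = Zero Ab (G n) (G (n + 1 + 1))"
    and e: "e n \<in> Hom Ab (G n) (G (n + 1))" for n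
    using A B by (auto simp: AB Ch_Ob)
  \<comment> \<open>The equation of a chain map, read for identity components.\<close>
  have "d n = e n" for n
    using f AB.Idn_Cmp[OF G G d, of n] AB.Cmp_Idn[OF G G e, of n] id by (simp add: AB Ch_Hom)
  then have BA: "B = A" by (auto simp: AB fun_eq_iff)
  have "cohomology_map A n f \<in> iso (cohomology A n) (cohomology A n)" for n
  proof -
    interpret G: comm_group "G n" by (rule Ab_comm_group[OF G])
    let ?K = "kernel (G n) (G (n + 1)) (d n)"
    let ?B = "d (n - 1) ` carrier (G (n - 1))"
    have hd: "group_hom (G n) (G (n + 1)) (d n)"
      using G d Ab_group by (auto simp: group_hom_def group_hom_axioms_def Ab_Hom)
    have "d (n - 1) \<in> Hom Ab (G (n - 1)) (G n)"
      using d[of "n - 1"] by simp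
    then have hd': "group_hom (G (n - 1)) (G n) (d (n - 1))"
      using G Ab_group by (auto simp: group_hom_def group_hom_axioms_def Ab_Hom)
    have K: "subgroup ?K (G n)"
      by (rule group_hom.subgroup_kernel[OF hd])
    have Bsub: "subgroup ?B (G n)"
      by (rule group_hom.img_is_subgroup[OF hd'])
    have "d n (d (n - 1) s) = \<one>\<^bsub>G (n + 1)\<^esub>" if "s \<in> carrier (G (n - 1))" for s
      using fun_cong[OF dd[of "n - 1"], of s] that by (simp add: Ab_Cmp Ab_Zero compose_def)
    then have BK: "?B \<subseteq> ?K"
      using subgroup.subset[OF Bsub] by (auto simp: kernel_def)
    \<comment> \<open>Commutativity of the group of cocycles makes the boundaries a normal subgroup,
      so that the quotient is a group and the product of two classes is again a class.\<close>
    interpret K: comm_group "(G n)\<lparr>carrier := ?K\<rparr>"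
      using subgroup.subset[OF K]
      by (intro group.group_comm_groupI[OF G.subgroup_imp_group[OF K]]) (auto simp: subset_iff G.m_comm)
    have "subgroup ?B ((G n)\<lparr>carrier := ?K\<rparr>)"
      by (rule G.subgroup_incl[OF Bsub K BK])
    then have norm: "?B \<lhd> (G n)\<lparr>carrier := ?K\<rparr>"
      by (rule K.subgroup_imp_normal)
    have grp: "group (cohomology A n)"
      using normal.factorgroup_is_group[OF norm] by (simp add: cohomology_def boundaries_def AB)
    \<comment> \<open>\<open>cohomology_map\<close> multiplies the image of a coset by the
      boundaries. For the identity this turns \<open>?B x\<close> into \<open>?B ?B x\<close>, which
      is \<open>?B x\<close> because \<open>?B\<close> is a subgroup.\<close>
    have "cohomology_map A n f c = c" if c: "c \<in> carrier (cohomology A n)" for c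
    proof -
      have "c \<in> rcosets\<^bsub>(G n)\<lparr>carrier := ?K\<rparr>\<^esub> ?B"
        using c by (simp add: cohomology_def boundaries_def AB FactGroup_def)
      then obtain x where x: "x \<in> ?K" and cx: "c = ?B #>\<^bsub>(G n)\<lparr>carrier := ?K\<rparr>\<^esub> x"
        by (auto simp: RCOSETS_def)
      have xG: "x \<in> carrier (G n)"
        using x by (auto simp: kernel_def)
      have cx': "c = ?B #>\<^bsub>G n\<^esub> x"
        using cx by (simp add: r_coset_def)
      have "c \<subseteq> carrier (G n)"
        using cx' xG subgroup.subset[OF Bsub] G.r_coset_subset_G by blast
      then have "f n ` c = c"
        by (force simp: id AB Ab_Idn)
      moreover have "?B <#>\<^bsub>G n\<^esub> (?B #>\<^bsub>G n\<^esub> x) = ?B #>\<^bsub>G n\<^esub> x"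
        using G.setmult_rcos_assoc[OF subgroup.subset[OF Bsub] subgroup.subset[OF Bsub] xG]
          G.subgroup_mult_id[OF Bsub] by simp
      ultimately show ?thesis
        by (simp add: cohomology_map_def boundaries_def AB cx')
    qed
    then show ?thesis
      using group.is_monoid[OF grp] unfolding iso_def hom_def bij_betw_def inj_on_def
      by (auto simp: monoid.m_closed image_iff)
  qed
  then show ?thesis
    using f by (simp add: qis_Ab_def BA)
qed

section \<open>Local sections of etale spaces\<close>

text \<open>A variant of \<open>sections\<close> over open sets without the extensionality
  condition: values outside \<open>V\<close> are free, so one function can be restricted, compared
  and combined over varying open sets.\<close>

definition local_section :: "'a topology \<Rightarrow> ('a, 'u) sheaf \<Rightarrow> 'a set \<Rightarrow> ('a \<Rightarrow> 'u) \<Rightarrow> bool" where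
  "local_section X F V g \<longleftrightarrow>
     openin X V \<and> continuous_map (subtopology X V) (etop F) (\<lambda>x. (x, g x))"

lemma local_section_open: "local_section X F V g \<Longrightarrow> openin X V"
  by (simp add: local_section_def)

lemma local_section_preimage:
  assumes "local_section X F V g" "openin (etop F) W"
  shows "openin X {x \<in> V. (x, g x) \<in> W}"
proof -
  have V: "openin X V" and c: "continuous_map (subtopology X V) (etop F) (\<lambda>x. (x, g x))"
    using assms by (auto simp: local_section_def)
  have "{x \<in> topspace (subtopology X V). (x, g x) \<in> W} = {x \<in> V. (x, g x) \<in> W}"
    using openin_subset[OF V] by auto
  then show ?thesis
    using openin_continuous_map_preimage[OF c assms(2)] openin_trans_full[OF _ V] by metis
qed

lemma local_section_topspace:
  assumes "local_section X F V g" "x \<in> V"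
  shows "(x, g x) \<in> topspace (etop F)" "x \<in> topspace X"
  using assms openin_subset[of X V] unfolding local_section_def continuous_map_def
  by (auto simp: Pi_iff)

lemma local_section_mono:
  assumes "local_section X F V g" "openin X V'" "V' \<subseteq> V"
  shows "local_section X F V' g"
  using assms continuous_map_from_subtopology_mono unfolding local_section_def by blast

text \<open>Continuity is local on the base. The local sections \<open>g'\<close> may be given by
  other expressions than \<open>g\<close>, which suits sections that are described differently on
  different parts of \<open>V\<close>.\<close>

lemma local_section_glue:
  assumes V: "openin X V"
    and loc: "\<And>x. x \<in> V \<Longrightarrow> \<exists>V' g'. local_section X F V' g' \<and> x \<in> V' \<and> V' \<subseteq> V \<and> (\<forall>y \<in> V'. g' y = g y)"
  shows "local_section X F V g"
proof -
  have "(x, g x) \<in> topspace (etop F)" if "x \<in> V" for x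
    using loc[OF that] local_section_topspace by metis
  moreover have "openin (subtopology X V) {x \<in> V. (x, g x) \<in> W}" if W: "openin (etop F) W" for W
  proof -
    have "openin X {x \<in> V. (x, g x) \<in> W}"
    proof (subst openin_subopen, intro ballI)
      fix x assume x: "x \<in> {x \<in> V. (x, g x) \<in> W}"
      then obtain V' g' where l: "local_section X F V' g'" "x \<in> V'" "V' \<subseteq> V" "\<forall>y \<in> V'. g' y = g y"
        using loc by blast
      then show "\<exists>T. openin X T \<and> x \<in> T \<and> T \<subseteq> {x \<in> V. (x, g x) \<in> W}"
        using local_section_preimage[OF l(1) W] x by (intro exI[of _ "{y \<in> V'. (y, g' y) \<in> W}"]) auto
    qed
    then show ?thesis
      using V by (auto simp: openin_open_subtopology)
  qed
  ultimately show ?thesis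
    using V openin_subset[OF V] by (simp add: local_section_def continuous_map_def Int_absorb1)
qed

lemma local_section_cong:
  assumes "local_section X F V g" "\<And>x. x \<in> V \<Longrightarrow> g x = h x"
  shows "local_section X F V h"
  using assms local_section_open by (intro local_section_glue) auto

lemma local_section_comp:
  assumes "local_section X F V g"
    and "continuous_map (etop F) (etop G) (\<lambda>(x, s). (x, \<phi> x s))"
  shows "local_section X G V (\<lambda>x. \<phi> x (g x))"
  using assms continuous_map_compose[OF _ assms(2), of "subtopology X V" "\<lambda>x. (x, g x)"]
  by (simp add: local_section_def o_def)

lemma sheaf_stalk: "is_sheaf X F \<Longrightarrow> x \<in> topspace X \<Longrightarrow> stalk F x \<in> Ob Ab"
  by (simp add: is_sheaf_def)

lemma sheaf_topspace: "is_sheaf X F \<Longrightarrow> topspace (etop F) = (SIGMA x : topspace X. carrier (stalk F x))"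
  by (simp add: is_sheaf_def)

lemma sheaf_chart:
  assumes "is_sheaf X F" "e \<in> topspace (etop F)"
  obtains W where "openin (etop F) W" "e \<in> W" "openin X (fst ` W)"
    "homeomorphic_map (subtopology (etop F) W) (subtopology X (fst ` W)) fst"
  using assms unfolding is_sheaf_def by meson

lemma sheaf_chart_inj:
  assumes "openin E W" "homeomorphic_map (subtopology E W) (subtopology X (fst ` W)) fst"
  shows "inj_on fst W"
  using assms openin_subset[OF assms(1)] by (simp add: homeomorphic_map_def Int_absorb1)

lemma local_section_carrier:
  "\<lbrakk>is_sheaf X F; local_section X F V g; x \<in> V\<rbrakk> \<Longrightarrow> g x \<in> carrier (stalk F x)"
  using local_section_topspace[of X F V g x] by (auto simp: sheaf_topspace)

lemma sheaf_fst:
  assumes F: "is_sheaf X F"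
  shows "continuous_map (etop F) X fst"
proof -
  have "openin (etop F) {e \<in> topspace (etop F). fst e \<in> N}" if N: "openin X N" for N
  proof (subst openin_subopen, intro ballI)
    fix e assume e: "e \<in> {e \<in> topspace (etop F). fst e \<in> N}"
    then obtain W where W: "openin (etop F) W" "e \<in> W"
      "homeomorphic_map (subtopology (etop F) W) (subtopology X (fst ` W)) fst"
      using sheaf_chart[OF F] by blast
    have "continuous_map (subtopology (etop F) W) X fst"
      using homeomorphic_imp_continuous_map[OF W(3)] continuous_map_into_fulltopology by blast
    then have "openin (subtopology (etop F) W) {e \<in> topspace (subtopology (etop F) W). fst e \<in> N}"
      using N openin_continuous_map_preimage by blast
    then have "openin (etop F) {e \<in> topspace (subtopology (etop F) W). fst e \<in> N}"
      using openin_trans_full W(1) by blast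
    then show "\<exists>T. openin (etop F) T \<and> e \<in> T \<and> T \<subseteq> {e \<in> topspace (etop F). fst e \<in> N}"
      using e W(2) by (intro exI[of _ "{e \<in> topspace (subtopology (etop F) W). fst e \<in> N}"]) auto
  qed
  then show ?thesis
    using F by (auto simp: continuous_map_def sheaf_topspace)
qed

text \<open>The inverse of the projection on a chart around \<open>(x, s)\<close> is a section with
  value \<open>s\<close> at \<open>x\<close>.\<close>

lemma local_section_through:
  assumes F: "is_sheaf X F" and x: "x \<in> topspace X" and s: "s \<in> carrier (stalk F x)"
  obtains V g where "local_section X F V g" "x \<in> V" "g x = s"
proof -
  have e: "(x, s) \<in> topspace (etop F)"
    using assms by (simp add: sheaf_topspace)
  obtain W where W: "openin (etop F) W" "(x, s) \<in> W" "openin X (fst ` W)"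
      "homeomorphic_map (subtopology (etop F) W) (subtopology X (fst ` W)) fst"
    using sheaf_chart[OF F e] .
  obtain k where k: "homeomorphic_maps (subtopology (etop F) W) (subtopology X (fst ` W)) fst k"
    using W(4) homeomorphic_map_maps by blast
  have tW: "topspace (subtopology (etop F) W) = W" "topspace (subtopology X (fst ` W)) = fst ` W"
    using openin_subset[OF W(1)] openin_subset[OF W(3)] by auto
  have k1: "k (fst e) = e" if "e \<in> W" for e
    using k that tW by (auto simp: homeomorphic_maps_def)
  have k2: "fst (k y) = y" if "y \<in> fst ` W" for y
    using k that tW by (auto simp: homeomorphic_maps_def)
  have "continuous_map (subtopology X (fst ` W)) (etop F) k"
    using k continuous_map_into_fulltopology by (auto simp: homeomorphic_maps_def)
  then have "continuous_map (subtopology X (fst ` W)) (etop F) (\<lambda>y. (y, snd (k y)))"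
    by (rule continuous_map_eq) (use k2 tW in \<open>auto simp: prod_eq_iff\<close>)
  then have "local_section X F (fst ` W) (\<lambda>y. snd (k y))"
    using W(3) by (simp add: local_section_def)
  moreover have "x \<in> fst ` W" "snd (k x) = s"
    using W(2) k1[OF W(2)] by force+
  ultimately show thesis
    using that by blast
qed

text \<open>If two sections agree at \<open>x\<close>, both stay near \<open>x\<close> in one chart
  around the common value, and the projection is injective on that chart.\<close>

lemma local_section_agree:
  assumes F: "is_sheaf X F" and g: "local_section X F V g" and h: "local_section X F V' h"
  shows "openin X {x \<in> V \<inter> V'. g x = h x}"
proof (subst openin_subopen, intro ballI)
  fix x assume x: "x \<in> {x \<in> V \<inter> V'. g x = h x}"
  then have e: "(x, g x) \<in> topspace (etop F)"
    using local_section_topspace[OF g, of x] by simp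
  obtain W where W: "openin (etop F) W" "(x, g x) \<in> W"
      "homeomorphic_map (subtopology (etop F) W) (subtopology X (fst ` W)) fst"
    using sheaf_chart[OF F e] by blast
  have "openin X ({y \<in> V. (y, g y) \<in> W} \<inter> {y \<in> V'. (y, h y) \<in> W})"
    using local_section_preimage[OF g W(1)] local_section_preimage[OF h W(1)] by blast
  then show "\<exists>T. openin X T \<and> x \<in> T \<and> T \<subseteq> {x \<in> V \<inter> V'. g x = h x}"
    using x W(2) sheaf_chart_inj[OF W(1,3)]
    by (intro exI[of _ "{y \<in> V. (y, g y) \<in> W} \<inter> {y \<in> V'. (y, h y) \<in> W}"]) (force simp: inj_on_def)
qed

text \<open>Over the open set where \<open>g\<close> stays in a chart, every point of the chart lies
  on the graph, because the projection is injective there. Together with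
  \<open>local_section_through\<close> this makes the graphs of local sections a basis of the etale
  topology.\<close>

lemma local_section_graph_open:
  assumes F: "is_sheaf X F" and g: "local_section X F V g"
  shows "openin (etop F) ((\<lambda>x. (x, g x)) ` V)"
proof (subst openin_subopen, intro ballI)
  fix e assume "e \<in> (\<lambda>x. (x, g x)) ` V"
  then obtain x where x: "x \<in> V" "e = (x, g x)" by auto
  then have e: "e \<in> topspace (etop F)"
    using local_section_topspace[OF g] by auto
  obtain W where W: "openin (etop F) W" "e \<in> W"
      "homeomorphic_map (subtopology (etop F) W) (subtopology X (fst ` W)) fst"
    using sheaf_chart[OF F e] by blast
  let ?N = "{y \<in> V. (y, g y) \<in> W}"
  let ?T = "W \<inter> {e \<in> topspace (etop F). fst e \<in> ?N}"
  have "openin (etop F) ?T"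
    using W(1) openin_continuous_map_preimage[OF sheaf_fst[OF F] local_section_preimage[OF g W(1)]] by blast
  moreover have "e \<in> ?T"
    using e x W(2) by auto
  moreover have "?T \<subseteq> (\<lambda>x. (x, g x)) ` V"
  proof
    fix d assume d: "d \<in> ?T"
    have "d = (fst d, g (fst d))"
      by (rule inj_onD[OF sheaf_chart_inj[OF W(1,3)]]) (use d in auto)
    then show "d \<in> (\<lambda>x. (x, g x)) ` V"
      using d by blast
  qed
  ultimately show "\<exists>T. openin (etop F) T \<and> e \<in> T \<and> T \<subseteq> (\<lambda>x. (x, g x)) ` V"
    by blast
qed

lemma local_section_mult:
  assumes F: "is_sheaf X F" and g: "local_section X F V g" and h: "local_section X F V' h"
  shows "local_section X F (V \<inter> V') (\<lambda>x. g x \<otimes>\<^bsub>stalk F x\<^esub> h x)"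
proof -
  have o: "openin X (V \<inter> V')"
    using local_section_open[OF g] local_section_open[OF h] by blast
  have "local_section X F (V \<inter> V') g" "local_section X F (V \<inter> V') h"
    using o g h by (auto intro: local_section_mono)
  then have "continuous_map (subtopology X (V \<inter> V'))
      (subtopology (prod_topology (etop F) (etop F)) {(p, q). fst p = fst q}) (\<lambda>x. ((x, g x), (x, h x)))"
    by (intro continuous_map_into_subtopology continuous_map_pairedI) (auto simp: local_section_def)
  moreover have "continuous_map
       (subtopology (prod_topology (etop F) (etop F)) {(p, q). fst p = fst q}) (etop F)
       (\<lambda>((x, s), (_, t)). (x, s \<otimes>\<^bsub>stalk F x\<^esub> t))"
    using F by (simp add: is_sheaf_def)
  ultimately have "continuous_map (subtopology X (V \<inter> V')) (etop F)
      ((\<lambda>((x, s), (_, t)). (x, s \<otimes>\<^bsub>stalk F x\<^esub> t)) \<circ> (\<lambda>x. ((x, g x), (x, h x))))"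
    by (rule continuous_map_compose)
  then show ?thesis
    using o by (simp add: local_section_def o_def)
qed

lemma local_section_inv:
  assumes F: "is_sheaf X F" and g: "local_section X F V g"
  shows "local_section X F V (\<lambda>x. inv\<^bsub>stalk F x\<^esub> (g x))"
  using local_section_comp[OF g, where \<phi> = "\<lambda>x s. inv\<^bsub>stalk F x\<^esub> s"] F by (simp add: is_sheaf_def)

text \<open>\<open>is_sheaf\<close> mentions only multiplication and inversion. Continuity of the
  unit follows by writing it near each point as the product of a local section with its
  inverse.\<close>

lemma local_section_one:
  assumes F: "is_sheaf X F" and V: "openin X V"
  shows "local_section X F V (\<lambda>x. \<one>\<^bsub>stalk F x\<^esub>)"
proof (rule local_section_glue[OF V])
  fix x assume xV: "x \<in> V"
  then have x: "x \<in> topspace X"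
    using openin_subset[OF V] by blast
  have grp: "group (stalk F y)" if "y \<in> topspace X" for y
    using that F by (simp add: Ab_group sheaf_stalk)
  have "\<one>\<^bsub>stalk F x\<^esub> \<in> carrier (stalk F x)"
    using grp[OF x] by (simp add: group.is_monoid monoid.one_closed)
  then obtain W g where g: "local_section X F W g" "x \<in> W"
    using local_section_through[OF F x] by metis
  have "local_section X F (W \<inter> W) (\<lambda>y. g y \<otimes>\<^bsub>stalk F y\<^esub> inv\<^bsub>stalk F y\<^esub> (g y))"
    by (intro local_section_mult local_section_inv F g)
  then have 1: "local_section X F W (\<lambda>y. g y \<otimes>\<^bsub>stalk F y\<^esub> inv\<^bsub>stalk F y\<^esub> (g y))"
    by simp
  have "g y \<otimes>\<^bsub>stalk F y\<^esub> inv\<^bsub>stalk F y\<^esub> (g y) = \<one>\<^bsub>stalk F y\<^esub>" if "y \<in> W" for y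
    using that g grp local_section_carrier[OF F g(1)] local_section_topspace(2)[OF g(1)]
    by (simp add: group.r_inv)
  moreover have "local_section X F (W \<inter> V) (\<lambda>y. g y \<otimes>\<^bsub>stalk F y\<^esub> inv\<^bsub>stalk F y\<^esub> (g y))"
    by (rule local_section_mono[OF 1]) (use V local_section_open[OF g(1)] in auto)
  ultimately show "\<exists>V' g'. local_section X F V' g' \<and> x \<in> V' \<and> V' \<subseteq> V \<and> (\<forall>y \<in> V'. g' y = \<one>\<^bsub>stalk F y\<^esub>)"
    using xV g(2) by (intro exI[of _ "W \<inter> V"] exI[of _ "\<lambda>y. g y \<otimes>\<^bsub>stalk F y\<^esub> inv\<^bsub>stalk F y\<^esub> (g y)"]) auto
qed

section \<open>Continuity and the sheaf property tested on local sections\<close>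

text \<open>One local section through each point suffices as a test: if \<open>\<phi>\<close>
  carries \<open>g\<close> to a local section, the preimage of an open \<open>W\<close> contains the
  graph of \<open>g\<close> over the open set where the image section lies in \<open>W\<close>, and
  this graph is open.\<close>

lemma fibre_map_continuous:
  assumes F: "is_sheaf X F"
    and thru: "\<And>x s. x \<in> topspace X \<Longrightarrow> s \<in> carrier (stalk F x) \<Longrightarrow>
      \<exists>V g. x \<in> V \<and> local_section X F V g \<and> g x = s \<and> local_section X G V (\<lambda>y. \<phi> y (g y))"
  shows "continuous_map (etop F) (etop G) (\<lambda>(x, s). (x, \<phi> x s))"
proof -
  have "(x, \<phi> x s) \<in> topspace (etop G)" if "(x, s) \<in> topspace (etop F)" for x s
    using that thru[of x s] local_section_topspace(1) by (fastforce simp: sheaf_topspace[OF F])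
  moreover have "openin (etop F) {e \<in> topspace (etop F). (\<lambda>(x, s). (x, \<phi> x s)) e \<in> W}"
    if W: "openin (etop G) W" for W
  proof (subst openin_subopen, intro ballI)
    fix e assume e: "e \<in> {e \<in> topspace (etop F). (\<lambda>(x, s). (x, \<phi> x s)) e \<in> W}"
    obtain x s where xs: "e = (x, s)" by (cases e)
    have "x \<in> topspace X" "s \<in> carrier (stalk F x)"
      using e xs by (auto simp: sheaf_topspace[OF F])
    then obtain V g where g: "x \<in> V" "local_section X F V g" "g x = s" "local_section X G V (\<lambda>y. \<phi> y (g y))"
      using thru by blast
    let ?N = "{y \<in> V. (y, \<phi> y (g y)) \<in> W}"
    have "local_section X F ?N g"
      by (rule local_section_mono[OF g(2) local_section_preimage[OF g(4) W]]) auto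
    then have "openin (etop F) ((\<lambda>y. (y, g y)) ` ?N)"
      by (rule local_section_graph_open[OF F])
    then show "\<exists>T. openin (etop F) T \<and> e \<in> T \<and> T \<subseteq> {e \<in> topspace (etop F). (\<lambda>(x, s). (x, \<phi> x s)) e \<in> W}"
      using e xs g by (intro exI[of _ "(\<lambda>y. (y, g y)) ` ?N"]) (auto simp: local_section_topspace)
  qed
  ultimately show ?thesis
    by (auto simp: continuous_map_def)
qed

text \<open>\<open>S\<close> is a supply of distinguished sections with open graphs that pass
  through every point. Their graphs serve as charts, and near a given point or pair of points the
  group operations are computed along the distinguished sections, where they yield local
  sections.\<close>

lemma is_sheafI:
  assumes st: "\<And>x. x \<in> topspace X \<Longrightarrow> stalk F x \<in> Ob Ab"
    and top: "topspace (etop F) = (SIGMA x : topspace X. carrier (stalk F x))"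
    and proj: "continuous_map (etop F) X fst"
    and sec: "\<And>V g. S V g \<Longrightarrow> local_section X F V g"
    and opn: "\<And>V g. S V g \<Longrightarrow> openin (etop F) ((\<lambda>x. (x, g x)) ` V)"
    and thru: "\<And>x s. x \<in> topspace X \<Longrightarrow> s \<in> carrier (stalk F x) \<Longrightarrow> \<exists>V g. S V g \<and> x \<in> V \<and> g x = s"
    and mult: "\<And>V g W h. S V g \<Longrightarrow> S W h \<Longrightarrow> local_section X F (V \<inter> W) (\<lambda>x. g x \<otimes>\<^bsub>stalk F x\<^esub> h x)"
    and inv: "\<And>V g. S V g \<Longrightarrow> local_section X F V (\<lambda>x. inv\<^bsub>stalk F x\<^esub> (g x))"
  shows "is_sheaf X F"
proof -
  have thru': "\<exists>V g. S V g \<and> x \<in> V \<and> g x = s" if "(x, s) \<in> topspace (etop F)" for x s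
    using that thru by (auto simp: top)
  have chart: "\<exists>W. openin (etop F) W \<and> e \<in> W \<and> openin X (fst ` W) \<and>
        homeomorphic_map (subtopology (etop F) W) (subtopology X (fst ` W)) fst"
    if e: "e \<in> topspace (etop F)" for e
  proof -
    obtain x s where xs: "e = (x, s)" by (cases e)
    obtain V g where g: "S V g" "x \<in> V" "g x = s"
      using thru' e xs by blast
    let ?W = "(\<lambda>x. (x, g x)) ` V"
    have W: "fst ` ?W = V"
      by (auto simp: image_image)
    have "homeomorphic_maps (subtopology (etop F) ?W) (subtopology X V) fst (\<lambda>x. (x, g x))"
      unfolding homeomorphic_maps_def
      using sec[OF g(1)] by (auto simp: local_section_def
        intro!: continuous_map_into_subtopology continuous_map_from_subtopology[OF proj])
    then have "homeomorphic_map (subtopology (etop F) ?W) (subtopology X (fst ` ?W)) fst"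
      unfolding W using homeomorphic_map_maps by blast
    then show ?thesis
      using opn[OF g(1)] local_section_open[OF sec[OF g(1)]] g W xs by (intro exI[of _ ?W]) auto
  qed
  let ?Z = "subtopology (prod_topology (etop F) (etop F)) {(p, q). fst p = fst q}"
  let ?m = "\<lambda>((x, s), (_, t)). (x, s \<otimes>\<^bsub>stalk F x\<^esub> t)"
  have "openin ?Z {z \<in> topspace ?Z. ?m z \<in> W}" if W: "openin (etop F) W" for W
  proof (subst openin_subopen, intro ballI)
    fix z assume z: "z \<in> {z \<in> topspace ?Z. ?m z \<in> W}"
    then obtain x s t where xst: "z = ((x, s), (x, t))"
      by auto
    have "(x, s) \<in> topspace (etop F)" "(x, t) \<in> topspace (etop F)"
      using z xst by auto
    then obtain V g V' h where g: "S V g" "x \<in> V" "g x = s" and h: "S V' h" "x \<in> V'" "h x = t"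
      using thru' by meson
    let ?N = "{y \<in> V \<inter> V'. (y, g y \<otimes>\<^bsub>stalk F y\<^esub> h y) \<in> W}"
    \<comment> \<open>In the fibre product two points have the same base point \<open>y\<close>. If
      the first is on the graph of \<open>g\<close> and the second on the graph of \<open>h\<close>
      over \<open>?N\<close>, they are the values of both sections at one \<open>y\<close> in
      \<open>?N\<close>, so their product lies in \<open>W\<close>.\<close>
    let ?A = "(\<lambda>x. (x, g x)) ` V" and ?B = "(\<lambda>x. (x, h x)) ` V' \<inter> {e \<in> topspace (etop F). fst e \<in> ?N}"
    have "openin (etop F) ?B"
      using opn[OF h(1)] openin_continuous_map_preimage[OF proj local_section_preimage[OF mult[OF g(1) h(1)] W]]
      by blast
    then have "openin (prod_topology (etop F) (etop F)) (?A \<times> ?B)"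
      using opn[OF g(1)] by (simp add: openin_prod_Times_iff)
    then have "openin ?Z ({(p, q). fst p = fst q} \<inter> (?A \<times> ?B))"
      by (rule openin_subtopology_Int2)
    moreover have "z \<in> {(p, q). fst p = fst q} \<inter> (?A \<times> ?B)"
      using z xst g h by auto
    moreover have "{(p, q). fst p = fst q} \<inter> (?A \<times> ?B) \<subseteq> {z \<in> topspace ?Z. ?m z \<in> W}"
      using openin_subset[OF opn[OF g(1)]] by auto
    ultimately show "\<exists>T. openin ?Z T \<and> z \<in> T \<and> T \<subseteq> {z \<in> topspace ?Z. ?m z \<in> W}"
      by blast
  qed
  moreover have "?m z \<in> topspace (etop F)" if z: "z \<in> topspace ?Z" for z
  proof -
    obtain x s t where xst: "z = ((x, s), (x, t))"
      using z by auto
    then have "x \<in> topspace X" "s \<in> carrier (stalk F x)" "t \<in> carrier (stalk F x)"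
      using z by (auto simp: top)
    then show ?thesis
      using monoid.m_closed[OF group.is_monoid[OF Ab_group[OF st]]] by (simp add: xst top)
  qed
  ultimately have m: "continuous_map ?Z (etop F) ?m"
    by (simp add: continuous_map_def)
  have "openin (etop F) {e \<in> topspace (etop F). (\<lambda>(x, s). (x, inv\<^bsub>stalk F x\<^esub> s)) e \<in> W}"
    if W: "openin (etop F) W" for W
  proof (subst openin_subopen, intro ballI)
    fix e assume e: "e \<in> {e \<in> topspace (etop F). (\<lambda>(x, s). (x, inv\<^bsub>stalk F x\<^esub> s)) e \<in> W}"
    obtain x s where xs: "e = (x, s)" by (cases e)
    obtain V g where g: "S V g" "x \<in> V" "g x = s"
      using thru' e xs by blast
    let ?N = "{y \<in> V. (y, inv\<^bsub>stalk F y\<^esub> (g y)) \<in> W}"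
    have "openin (etop F) ((\<lambda>x. (x, g x)) ` V \<inter> {e \<in> topspace (etop F). fst e \<in> ?N})"
      using opn[OF g(1)] openin_continuous_map_preimage[OF proj local_section_preimage[OF inv[OF g(1)] W]]
      by blast
    then show "\<exists>T. openin (etop F) T \<and> e \<in> T \<and>
        T \<subseteq> {e \<in> topspace (etop F). (\<lambda>(x, s). (x, inv\<^bsub>stalk F x\<^esub> s)) e \<in> W}"
      using e xs g by (intro exI[of _ "(\<lambda>x. (x, g x)) ` V \<inter> {e \<in> topspace (etop F). fst e \<in> ?N}"]) auto
  qed
  moreover have "(x, inv\<^bsub>stalk F x\<^esub> s) \<in> topspace (etop F)" if "(x, s) \<in> topspace (etop F)" for x s
    using that by (auto simp: top intro!: group.inv_closed Ab_group st)
  ultimately have "continuous_map (etop F) (etop F) (\<lambda>(x, s). (x, inv\<^bsub>stalk F x\<^esub> s))"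
    by (auto simp: continuous_map_def)
  then show ?thesis
    unfolding is_sheaf_def using st top chart m by blast
qed

text \<open>Here the topology is not given but generated by the graphs. Openness of the agreement
  loci makes each distinguished section continuous, closure under restriction makes the projection
  continuous, and closure under the operations gives the rest of \<open>is_sheafI\<close>.\<close>

lemma generated_sheaf:
  assumes F: "etop F = topology_generated_by {(\<lambda>x. (x, g x)) ` V | V g. S V g}"
    and st: "\<And>x. x \<in> topspace X \<Longrightarrow> stalk F x \<in> Ob Ab"
    and opn: "\<And>V g. S V g \<Longrightarrow> openin X V"
    and val: "\<And>V g x. S V g \<Longrightarrow> x \<in> V \<Longrightarrow> g x \<in> carrier (stalk F x)"
    and thru: "\<And>x s. x \<in> topspace X \<Longrightarrow> s \<in> carrier (stalk F x) \<Longrightarrow> \<exists>V g. S V g \<and> x \<in> V \<and> g x = s"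
    and restr: "\<And>V g V'. S V g \<Longrightarrow> openin X V' \<Longrightarrow> V' \<subseteq> V \<Longrightarrow> S V' g"
    and agree: "\<And>V g W h. S V g \<Longrightarrow> S W h \<Longrightarrow> openin X {x \<in> V \<inter> W. g x = h x}"
    and mult: "\<And>V g W h. S V g \<Longrightarrow> S W h \<Longrightarrow> S (V \<inter> W) (\<lambda>x. g x \<otimes>\<^bsub>stalk F x\<^esub> h x)"
    and inv: "\<And>V g. S V g \<Longrightarrow> S V (\<lambda>x. inv\<^bsub>stalk F x\<^esub> (g x))"
  shows "is_sheaf X F" and "S V g \<Longrightarrow> local_section X F V g"
proof -
  have top: "topspace (etop F) = (SIGMA x : topspace X. carrier (stalk F x))"
  proof
    show "topspace (etop F) \<subseteq> (SIGMA x : topspace X. carrier (stalk F x))"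
    proof
      fix e assume "e \<in> topspace (etop F)"
      then obtain V g x where g: "S V g" "x \<in> V" "e = (x, g x)"
        unfolding F topology_generated_by_topspace by blast
      then show "e \<in> (SIGMA x : topspace X. carrier (stalk F x))"
        using val openin_subset[OF opn[OF g(1)]] by auto
    qed
    show "(SIGMA x : topspace X. carrier (stalk F x)) \<subseteq> topspace (etop F)"
    proof
      fix e assume "e \<in> (SIGMA x : topspace X. carrier (stalk F x))"
      then obtain V g where "S V g" "fst e \<in> V" "g (fst e) = snd e"
        using thru[of "fst e" "snd e"] by auto
      then have "e \<in> (\<lambda>x. (x, g x)) ` V" "S V g"
        by (auto simp: image_iff prod_eq_iff)
      then show "e \<in> topspace (etop F)"
        unfolding F topology_generated_by_topspace by blast
    qed
  qed
  have graph: "openin (etop F) ((\<lambda>x. (x, g x)) ` V)" if "S V g" for V g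
    unfolding F using that by (intro topology_generated_by_Basis) blast
  have sec: "local_section X F V g" if g: "S V g" for V g
  proof -
    have V: "openin X V" using opn[OF g] .
    have "continuous_map (subtopology X V) (etop F) (\<lambda>x. (x, g x))"
      unfolding F
    proof (rule continuous_on_generated_topo)
      fix A assume "A \<in> {(\<lambda>x. (x, g x)) ` V | V g. S V g}"
      then obtain W h where h: "S W h" "A = (\<lambda>x. (x, h x)) ` W" by blast
      \<comment> \<open>The preimage of the graph of \<open>h\<close> under the section given by
        \<open>g\<close> is the locus where the two agree; for a generated topology only such
        preimages have to be open.\<close>
      have "(\<lambda>x. (x, g x)) -` A \<inter> topspace (subtopology X V) = {x \<in> V \<inter> W. g x = h x}"
        using h openin_subset[OF V] by auto
      then show "openin (subtopology X V) ((\<lambda>x. (x, g x)) -` A \<inter> topspace (subtopology X V))"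
        using agree[OF g h(1)] V by (auto simp: openin_open_subtopology)
    next
      show "(\<lambda>x. (x, g x)) ` topspace (subtopology X V) \<subseteq> \<Union> {(\<lambda>x. (x, g x)) ` V | V g. S V g}"
        using g by auto
    qed
    then show ?thesis
      using V by (simp add: local_section_def)
  qed
  have "openin (etop F) {e \<in> topspace (etop F). fst e \<in> N}" if N: "openin X N" for N
  proof (subst openin_subopen, intro ballI)
    fix e assume e: "e \<in> {e \<in> topspace (etop F). fst e \<in> N}"
    then obtain V g where g: "S V g" "fst e \<in> V" "g (fst e) = snd e"
      using thru[of "fst e" "snd e"] by (auto simp: top)
    have "S (V \<inter> N) g"
      by (rule restr[OF g(1)]) (use opn[OF g(1)] N in auto)
    then show "\<exists>T. openin (etop F) T \<and> e \<in> T \<and> T \<subseteq> {e \<in> topspace (etop F). fst e \<in> N}"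
      using e g openin_subset[OF graph[OF g(1)]]
      by (intro exI[of _ "(\<lambda>x. (x, g x)) ` (V \<inter> N)"]) (auto intro: graph simp: prod_eq_iff image_iff)
  qed
  then have proj: "continuous_map (etop F) X fst"
    by (auto simp: continuous_map_def top)
  show "is_sheaf X F"
  proof (rule is_sheafI[where S = S])
    show "local_section X F (V \<inter> W) (\<lambda>x. g x \<otimes>\<^bsub>stalk F x\<^esub> h x)" if "S V g" "S W h" for V g W h
      using sec[OF mult[OF that]] .
    show "local_section X F V (\<lambda>x. inv\<^bsub>stalk F x\<^esub> (g x))" if "S V g" for V g
      using sec[OF inv[OF that]] .
  qed (fact top proj | erule st sec graph thru | erule (1) thru)+
  show "S V g \<Longrightarrow> local_section X F V g"
    by (rule sec)
qed

section \<open>Inverse and direct images as exact functors\<close>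

lemma Sh_Ob: "F \<in> Ob (Sh X) \<longleftrightarrow> is_sheaf X F"
  by (simp add: Sh_def)

lemma Sh_Hom:
  "\<phi> \<in> Hom (Sh X) F G \<longleftrightarrow> \<phi> \<in> extensional (topspace X) \<and>
    (\<forall>x \<in> topspace X. \<phi> x \<in> Hom Ab (stalk F x) (stalk G x)) \<and>
    continuous_map (etop F) (etop G) (\<lambda>(x, s). (x, \<phi> x s))"
  by (simp add: Sh_def)

lemma Sh_Idn: "Idn (Sh X) F = (\<lambda>x \<in> topspace X. Idn Ab (stalk F x))"
  and Sh_Cmp: "Cmp (Sh X) F G H \<psi> \<phi> =
    (\<lambda>x \<in> topspace X. Cmp Ab (stalk F x) (stalk G x) (stalk H x) (\<psi> x) (\<phi> x))"
  and Sh_Zero: "Zero (Sh X) F G = (\<lambda>x \<in> topspace X. Zero Ab (stalk F x) (stalk G x))"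
  by (simp_all add: Sh_def)

lemma Sh_HomD:
  assumes "\<phi> \<in> Hom (Sh X) F G"
  shows "\<phi> \<in> extensional (topspace X)"
    and "x \<in> topspace X \<Longrightarrow> \<phi> x \<in> Hom Ab (stalk F x) (stalk G x)"
    and "continuous_map (etop F) (etop G) (\<lambda>(x, s). (x, \<phi> x s))"
  using assms by (auto simp: Sh_Hom)

lemma cat_Sh: "cat (Sh X)"
proof -
  interpret AB: cat Ab by (rule cat_Ab)
  show ?thesis
  proof
    fix F :: "('a, 'b) sheaf" assume F: "F \<in> Ob (Sh X)"
    have "continuous_map (etop F) (etop F) (\<lambda>(x, s). (x, Idn (Sh X) F x s))"
      by (rule continuous_map_eq[OF continuous_map_id])
        (use F in \<open>auto simp: Sh_Ob Sh_Idn Ab_Idn sheaf_topspace\<close>)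
    then show "Idn (Sh X) F \<in> Hom (Sh X) F F"
      using F by (auto simp: Sh_Hom Sh_Ob Sh_Idn intro: AB.Idn_in sheaf_stalk)
  next
    fix F G H :: "('a, 'b) sheaf" and \<phi> \<psi>
    assume ob: "F \<in> Ob (Sh X)" "G \<in> Ob (Sh X)" "H \<in> Ob (Sh X)"
      and \<phi>: "\<phi> \<in> Hom (Sh X) F G" and \<psi>: "\<psi> \<in> Hom (Sh X) G H"
    have "continuous_map (etop F) (etop H) (\<lambda>(x, s). (x, Cmp (Sh X) F G H \<psi> \<phi> x s))"
      by (rule continuous_map_eq[OF continuous_map_compose[OF Sh_HomD(3)[OF \<phi>] Sh_HomD(3)[OF \<psi>]]])
        (use ob in \<open>auto simp: Sh_Ob Sh_Cmp Ab_Cmp sheaf_topspace compose_def\<close>)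
    then show "Cmp (Sh X) F G H \<psi> \<phi> \<in> Hom (Sh X) F H"
      using ob Sh_HomD(2)[OF \<phi>] Sh_HomD(2)[OF \<psi>]
      by (auto simp: Sh_Hom Sh_Ob Sh_Cmp sheaf_stalk intro!: AB.Cmp_in[where b = "stalk G _"])
  next
    fix F G :: "('a, 'b) sheaf" and \<phi>
    assume ob: "F \<in> Ob (Sh X)" "G \<in> Ob (Sh X)" and \<phi>: "\<phi> \<in> Hom (Sh X) F G"
    have st: "stalk F x \<in> Ob Ab" "stalk G x \<in> Ob Ab" if "x \<in> topspace X" for x
      using ob that by (auto simp: Sh_Ob sheaf_stalk)
    show "Cmp (Sh X) F F G \<phi> (Idn (Sh X) F) = \<phi>"
      using st Sh_HomD(1,2)[OF \<phi>]
      by (auto simp: Sh_Cmp Sh_Idn AB.Cmp_Idn fun_eq_iff[of _ \<phi>] extensional_def)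
    show "Cmp (Sh X) F G G (Idn (Sh X) G) \<phi> = \<phi>"
      using st Sh_HomD(1,2)[OF \<phi>]
      by (auto simp: Sh_Cmp Sh_Idn AB.Idn_Cmp fun_eq_iff[of _ \<phi>] extensional_def)
  next
    fix F G H K :: "('a, 'b) sheaf" and \<phi> \<psi> \<chi>
    assume ob: "F \<in> Ob (Sh X)" "G \<in> Ob (Sh X)" "H \<in> Ob (Sh X)" "K \<in> Ob (Sh X)"
      and arr: "\<phi> \<in> Hom (Sh X) F G" "\<psi> \<in> Hom (Sh X) G H" "\<chi> \<in> Hom (Sh X) H K"
    have "Cmp Ab (stalk F x) (stalk H x) (stalk K x) (\<chi> x) (Cmp Ab (stalk F x) (stalk G x) (stalk H x) (\<psi> x) (\<phi> x))
      = Cmp Ab (stalk F x) (stalk G x) (stalk K x) (Cmp Ab (stalk G x) (stalk H x) (stalk K x) (\<chi> x) (\<psi> x)) (\<phi> x)"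
      if "x \<in> topspace X" for x
      using ob that by (intro AB.Cmp_assoc Sh_HomD(2)[OF arr(1)] Sh_HomD(2)[OF arr(2)] Sh_HomD(2)[OF arr(3)])
        (auto simp: Sh_Ob sheaf_stalk)
    then show "Cmp (Sh X) F H K \<chi> (Cmp (Sh X) F G H \<psi> \<phi>) = Cmp (Sh X) F G K (Cmp (Sh X) G H K \<chi> \<psi>) \<phi>"
      by (auto simp: Sh_Cmp)
  qed
qed

lemma stalk_ftor_on_ob [simp]: "on_ob (stalk_ftor x) F = stalk F x"
  and stalk_ftor_on_arr [simp]: "on_arr (stalk_ftor x) F G \<phi> = \<phi> x"
  by (simp_all add: stalk_ftor_def)

lemma exact0_stalk: "x \<in> topspace X \<Longrightarrow> exact0 (Sh X) Ab (stalk_ftor x)"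
  by (auto simp: exact0_def is_functor_def Sh_Ob Sh_Idn Sh_Cmp Sh_Zero Sh_HomD(2) sheaf_stalk)

lemma exact0_comp: "exact0 C D T \<Longrightarrow> exact0 D E S \<Longrightarrow> exact0 C E (ftor_comp S T)"
  by (auto simp: exact0_def functor_Ob intro: is_functor_comp)

section \<open>Stalkwise tests for quasi-isomorphisms\<close>

text \<open>At each point this is \<open>qis_Ab_identity\<close>. It makes canonical morphisms
  invertible in the derived category without exhibiting a continuous inverse.\<close>

lemma qis_Sh_identity:
  assumes A: "A \<in> Ob (Ch (Sh X))" and B: "B \<in> Ob (Ch (Sh X))" and f: "f \<in> Hom (Ch (Sh X)) A B"
    and same: "\<And>n x. x \<in> topspace X \<Longrightarrow> stalk (fst B n) x = stalk (fst A n) x"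
    and id: "\<And>n x. x \<in> topspace X \<Longrightarrow> f n x = Idn Ab (stalk (fst A n) x)"
  shows "f \<in> qis_Sh X A B"
proof -
  have "on_arr (ch_ftor (stalk_ftor x)) A B f
      \<in> qis_Ab (on_ob (ch_ftor (stalk_ftor x)) A) (on_ob (ch_ftor (stalk_ftor x)) B)"
    if x: "x \<in> topspace X" for x
  proof -
    have F: "is_functor (Ch (Sh X)) (Ch Ab) (ch_ftor (stalk_ftor x))"
      by (intro is_functor_ch exact0_stalk x)
    show ?thesis
      by (intro qis_Ab_identity functor_Ob[OF F] functor_Hom[OF F] A B f)
        (simp_all add: same[OF x] id[OF x] ch_ftor_on_arr)
  qed
  then show ?thesis
    using f by (simp add: qis_Sh_def)
qed

text \<open>At each point the functor either leaves the stalk complexes and the map between them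
  unchanged, so the assumption on \<open>f\<close> applies, or produces a fixed stalk with identity
  maps, where \<open>qis_Ab_identity\<close> applies. Restriction is of the first kind; the two
  extensions are of the first kind on the subset and of the second kind off it.\<close>

lemma preserves_qis_Sh:
  fixes T :: "(('a, 'u) sheaf, 'a \<Rightarrow> 'u \<Rightarrow> 'u, ('a, 'u) sheaf, 'a \<Rightarrow> 'u \<Rightarrow> 'u) ftor"
  assumes T: "exact0 (Sh X) (Sh X') T"
    and st: "\<And>x. x \<in> topspace X' \<Longrightarrow>
      x \<in> topspace X \<and> (\<forall>F. stalk (on_ob T F) x = stalk F x) \<and> (\<forall>F G \<phi>. on_arr T F G \<phi> x = \<phi> x) \<or>
      (\<forall>F G \<phi>. stalk (on_ob T G) x = stalk (on_ob T F) x \<and> on_arr T F G \<phi> x = Idn Ab (stalk (on_ob T F) x))"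
  shows "preserves (Ch (Sh X)) (qis_Sh X) (qis_Sh X') (ch_ftor T)"
  unfolding preserves_def
proof (intro ballI impI)
  fix A B :: "('a, 'u) sh_complex" and f
  assume A: "A \<in> Ob (Ch (Sh X))" and B: "B \<in> Ob (Ch (Sh X))" and f: "f \<in> Hom (Ch (Sh X)) A B"
    and q: "f \<in> qis_Sh X A B"
  let ?A = "on_ob (ch_ftor T) A" and ?B = "on_ob (ch_ftor T) B" and ?f = "on_arr (ch_ftor T) A B f"
  have F: "is_functor (Ch (Sh X)) (Ch (Sh X')) (ch_ftor T)"
    by (rule is_functor_ch[OF T])
  note TF = functor_Ob[OF F A] functor_Ob[OF F B] functor_Hom[OF F A B f]
  have "on_arr (ch_ftor (stalk_ftor x)) ?A ?B ?f
      \<in> qis_Ab (on_ob (ch_ftor (stalk_ftor x)) ?A) (on_ob (ch_ftor (stalk_ftor x)) ?B)"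
    if x: "x \<in> topspace X'" for x
    using st[OF x]
  proof
    assume *: "x \<in> topspace X \<and> (\<forall>F. stalk (on_ob T F) x = stalk F x) \<and> (\<forall>F G \<phi>. on_arr T F G \<phi> x = \<phi> x)"
    have "on_ob (ch_ftor (stalk_ftor x)) (on_ob (ch_ftor T) E) = on_ob (ch_ftor (stalk_ftor x)) E" for E
      using * by (cases E) (simp add: ch_ftor_on_ob)
    moreover have "on_arr (ch_ftor (stalk_ftor x)) ?A ?B ?f = on_arr (ch_ftor (stalk_ftor x)) A B f"
      using * by (simp add: ch_ftor_on_arr)
    ultimately show ?thesis
      using q * by (simp add: qis_Sh_def)
  next
    assume *: "\<forall>F G \<phi>. stalk (on_ob T G) x = stalk (on_ob T F) x \<and> on_arr T F G \<phi> x = Idn Ab (stalk (on_ob T F) x)"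
    have S: "is_functor (Ch (Sh X')) (Ch Ab) (ch_ftor (stalk_ftor x))"
      by (intro is_functor_ch exact0_stalk x)
    show ?thesis
      by (intro qis_Ab_identity functor_Ob[OF S] functor_Hom[OF S] TF)
        (use * in \<open>simp_all add: ch_ftor_on_arr\<close>)
  qed
  then show "?f \<in> qis_Sh X' ?A ?B"
    using TF by (simp add: qis_Sh_def)
qed

section \<open>Restriction to a subspace\<close>

lemma restr_stalk [simp]: "stalk (on_ob (restr_ftor X S) F) = stalk F"
  and restr_etop: "etop (on_ob (restr_ftor X S) F) = subtopology (etop F) (S \<times> UNIV)"
  and restr_on_arr: "on_arr (restr_ftor X S) F G \<phi> = restrict \<phi> (topspace X \<inter> S)"
  by (simp_all add: restr_ftor_def)

lemma local_section_restr:
  assumes "local_section X F V g"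
  shows "local_section (subtopology X S) (on_ob (restr_ftor X S) F) (V \<inter> S) g"
proof -
  have V: "openin X V" and c: "continuous_map (subtopology X V) (etop F) (\<lambda>x. (x, g x))"
    using assms by (auto simp: local_section_def)
  have "continuous_map (subtopology (subtopology X V) S) (subtopology (etop F) (S \<times> UNIV)) (\<lambda>x. (x, g x))"
    by (rule continuous_map_into_subtopology[OF continuous_map_from_subtopology[OF c]]) auto
  moreover have "subtopology (subtopology X S) (V \<inter> S) = subtopology (subtopology X V) S"
    by (simp add: subtopology_subtopology Int_left_commute Int_commute)
  ultimately have "continuous_map (subtopology (subtopology X S) (V \<inter> S)) (subtopology (etop F) (S \<times> UNIV)) (\<lambda>x. (x, g x))"
    by simp
  then show ?thesis
    using V by (simp add: local_section_def restr_etop openin_subtopology_Int)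
qed

lemma local_section_restrD:
  assumes U: "openin X U" and g: "local_section (subtopology X U) (on_ob (restr_ftor X U) F) V g"
  shows "local_section X F V g"
proof -
  have V: "openin (subtopology X U) V"
    by (rule local_section_open[OF g])
  have "V \<subseteq> U"
    using openin_subset[OF V] by simp
  then have "subtopology (subtopology X U) V = subtopology X V"
    by (simp add: subtopology_subtopology Int_absorb1)
  then show ?thesis
    using g openin_trans_full[OF V U] continuous_map_into_fulltopology
    by (fastforce simp: local_section_def restr_etop)
qed

text \<open>For arbitrary \<open>S\<close> the distinguished sections are those restricted from open
  sets of \<open>X\<close>. They pass through every point, and their graphs are traces of open
  graphs on the subspace \<open>S \<times> UNIV\<close>.\<close>

lemma is_sheaf_restr:
  assumes F: "is_sheaf X F"
  shows "is_sheaf (subtopology X S) (on_ob (restr_ftor X S) F)"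
proof (rule is_sheafI[where S = "\<lambda>W g. \<exists>V. W = V \<inter> S \<and> local_section X F V g"])
  let ?R = "on_ob (restr_ftor X S) F"
  show "stalk ?R x \<in> Ob Ab" if "x \<in> topspace (subtopology X S)" for x
    using F that by (simp add: sheaf_stalk)
  show "topspace (etop ?R) = (SIGMA x : topspace (subtopology X S). carrier (stalk ?R x))"
    using F by (auto simp: restr_etop sheaf_topspace)
  show "continuous_map (etop ?R) (subtopology X S) fst"
    unfolding restr_etop
    by (rule continuous_map_into_subtopology[OF continuous_map_from_subtopology[OF sheaf_fst[OF F]]]) auto
  show "local_section (subtopology X S) ?R V g" if "\<exists>V'. V = V' \<inter> S \<and> local_section X F V' g" for V g
    using that by (elim exE conjE, simp only:, intro local_section_restr)
  show "openin (etop ?R) ((\<lambda>x. (x, g x)) ` V)" if g: "\<exists>V'. V = V' \<inter> S \<and> local_section X F V' g" for V g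
  proof -
    obtain V' where V': "V = V' \<inter> S" "local_section X F V' g" using g by blast
    have "(\<lambda>x. (x, g x)) ` V = (\<lambda>x. (x, g x)) ` V' \<inter> (S \<times> UNIV)"
      using V' by auto
    then show ?thesis
      using local_section_graph_open[OF F V'(2)] by (simp add: restr_etop openin_subtopology_Int)
  qed
  show "\<exists>V g. (\<exists>V'. V = V' \<inter> S \<and> local_section X F V' g) \<and> x \<in> V \<and> g x = s"
    if x: "x \<in> topspace (subtopology X S)" and s: "s \<in> carrier (stalk ?R x)" for x s
  proof -
    obtain V g where "local_section X F V g" "x \<in> V" "g x = s"
      using local_section_through[OF F, of x s] x s by auto
    then show ?thesis
      using x by (intro exI[of _ "V \<inter> S"] exI[of _ g]) auto
  qed
  show "local_section (subtopology X S) ?R (V \<inter> W) (\<lambda>x. g x \<otimes>\<^bsub>stalk ?R x\<^esub> h x)"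
    if g: "\<exists>V'. V = V' \<inter> S \<and> local_section X F V' g" and h: "\<exists>W'. W = W' \<inter> S \<and> local_section X F W' h"
    for V g W h
  proof -
    obtain V' W' where *: "V = V' \<inter> S" "local_section X F V' g" "W = W' \<inter> S" "local_section X F W' h"
      using g h by blast
    have "V \<inter> W = (V' \<inter> W') \<inter> S"
      using * by auto
    then show ?thesis
      using local_section_restr[OF local_section_mult[OF F *(2,4)], of S] by simp
  qed
  show "local_section (subtopology X S) ?R V (\<lambda>x. inv\<^bsub>stalk ?R x\<^esub> (g x))"
    if "\<exists>V'. V = V' \<inter> S \<and> local_section X F V' g" for V g
    using that local_section_restr[OF local_section_inv[OF F]] by fastforce
qed

lemma exact0_restr: "exact0 (Sh X) (Sh (subtopology X S)) (restr_ftor X S)"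
proof -
  have "on_arr (restr_ftor X S) F G \<phi>
      \<in> Hom (Sh (subtopology X S)) (on_ob (restr_ftor X S) F) (on_ob (restr_ftor X S) G)"
    if F: "is_sheaf X F" and \<phi>: "\<phi> \<in> Hom (Sh X) F G" for F G \<phi>
  proof -
    have "continuous_map (subtopology (etop F) (S \<times> UNIV)) (subtopology (etop G) (S \<times> UNIV)) (\<lambda>(x, s). (x, \<phi> x s))"
      by (rule continuous_map_into_subtopology[OF continuous_map_from_subtopology[OF Sh_HomD(3)[OF \<phi>]]]) auto
    then have "continuous_map (subtopology (etop F) (S \<times> UNIV)) (subtopology (etop G) (S \<times> UNIV))
        (\<lambda>(x, s). (x, restrict \<phi> (topspace X \<inter> S) x s))"
      by (rule continuous_map_eq) (use F in \<open>auto simp: sheaf_topspace\<close>)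
    then show ?thesis
      using Sh_HomD(2)[OF \<phi>] by (auto simp: Sh_Hom restr_on_arr restr_etop)
  qed
  then show ?thesis
    by (auto simp: exact0_def is_functor_def Sh_Ob Sh_Idn Sh_Cmp Sh_Zero is_sheaf_restr restr_on_arr
        fun_eq_iff)
qed

lemma preserves_restr:
  "preserves (Ch (Sh X)) (qis_Sh X) (qis_Sh (subtopology X S)) (ch_ftor (restr_ftor X S))"
  by (intro preserves_qis_Sh exact0_restr) (auto simp: restr_on_arr)

section \<open>Constant sheaves\<close>

lemma const_stalk [simp]: "stalk (on_ob (const_ftor X) M) x = M"
  and const_etop: "etop (on_ob (const_ftor X) M) = prod_topology X (discrete_topology (carrier M))"
  and const_on_arr: "on_arr (const_ftor X) M N h = (\<lambda>x \<in> topspace X. h)"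
  by (simp_all add: const_ftor_def)

text \<open>The distinguished sections are the constant functions on open sets: the graph over
  \<open>V\<close> with value \<open>c\<close> is the open box
  \<open>V \<times> {c}\<close>.\<close>

lemma is_sheaf_const:
  assumes M: "M \<in> Ob Ab"
  shows "is_sheaf X (on_ob (const_ftor X) M)"
proof (rule is_sheafI[where S = "\<lambda>V g. openin X V \<and> (\<exists>c \<in> carrier M. \<forall>x \<in> V. g x = c)"])
  interpret M: comm_group M by (rule Ab_comm_group[OF M])
  let ?R = "on_ob (const_ftor X) M"
  have const: "local_section X ?R V g" if "openin X V" "c \<in> carrier M" "\<forall>x \<in> V. g x = c" for V g c
  proof -
    have "continuous_map (subtopology X V) (prod_topology X (discrete_topology (carrier M))) (\<lambda>x. (x, c))"
      using that(2) by (intro continuous_map_pairedI) (auto intro: continuous_map_from_subtopology)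
    then have "local_section X ?R V (\<lambda>x. c)"
      using that(1) by (simp add: local_section_def const_etop)
    then show ?thesis
      by (rule local_section_cong) (use that in auto)
  qed
  show "stalk ?R x \<in> Ob Ab" for x
    using M by simp
  show "topspace (etop ?R) = (SIGMA x : topspace X. carrier (stalk ?R x))"
    by (simp add: const_etop)
  show "continuous_map (etop ?R) X fst"
    by (simp add: const_etop continuous_map_fst)
  show "local_section X ?R V g" if "openin X V \<and> (\<exists>c \<in> carrier M. \<forall>x \<in> V. g x = c)" for V g
    using that const by blast
  show "openin (etop ?R) ((\<lambda>x. (x, g x)) ` V)"
    if g: "openin X V \<and> (\<exists>c \<in> carrier M. \<forall>x \<in> V. g x = c)" for V g
  proof -
    obtain c where c: "c \<in> carrier M" "\<forall>x \<in> V. g x = c"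
      using g by blast
    then have "(\<lambda>x. (x, g x)) ` V = V \<times> {c}"
      by auto
    then show ?thesis
      using g c by (simp add: const_etop openin_prod_Times_iff)
  qed
  show "\<exists>V g. (openin X V \<and> (\<exists>c \<in> carrier M. \<forall>x \<in> V. g x = c)) \<and> x \<in> V \<and> g x = s"
    if "x \<in> topspace X" "s \<in> carrier (stalk ?R x)" for x s
    using that by (intro exI[of _ "topspace X"] exI[of _ "\<lambda>_. s"]) auto
  show "local_section X ?R (V \<inter> W) (\<lambda>x. g x \<otimes>\<^bsub>stalk ?R x\<^esub> h x)"
    if V: "openin X V \<and> (\<exists>c \<in> carrier M. \<forall>x \<in> V. g x = c)" and W: "openin X W \<and> (\<exists>c \<in> carrier M. \<forall>x \<in> W. h x = c)"
    for V g W h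
  proof -
    obtain c d where "c \<in> carrier M" "\<forall>x \<in> V. g x = c" "d \<in> carrier M" "\<forall>x \<in> W. h x = d"
      using V W by blast
    then show ?thesis
      using V W by (intro const[of _ "c \<otimes>\<^bsub>M\<^esub> d"]) auto
  qed
  show "local_section X ?R V (\<lambda>x. inv\<^bsub>stalk ?R x\<^esub> (g x))"
    if V: "openin X V \<and> (\<exists>c \<in> carrier M. \<forall>x \<in> V. g x = c)" for V g
  proof -
    obtain c where "c \<in> carrier M" "\<forall>x \<in> V. g x = c"
      using V by blast
    then show ?thesis
      using V by (intro const[of _ "inv\<^bsub>M\<^esub> c"]) auto
  qed
qed

lemma exact0_const: "exact0 Ab (Sh X) (const_ftor X)"
proof -
  have "on_arr (const_ftor X) M N h \<in> Hom (Sh X) (on_ob (const_ftor X) M) (on_ob (const_ftor X) N)"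
    if h: "h \<in> Hom Ab M N" for M N h
  proof -
    have "continuous_map (prod_topology X (discrete_topology (carrier M)))
        (prod_topology X (discrete_topology (carrier N))) (\<lambda>z. (fst z, (h \<circ> snd) z))"
      using Ab_Hom_carrier[OF h]
      by (intro continuous_map_pairedI continuous_map_fst continuous_map_compose[OF continuous_map_snd])
        (auto simp: continuous_map_from_discrete_topology)
    then have "continuous_map (prod_topology X (discrete_topology (carrier M)))
        (prod_topology X (discrete_topology (carrier N))) (\<lambda>(x, s). (x, (\<lambda>x \<in> topspace X. h) x s))"
      by (rule continuous_map_eq) auto
    then show ?thesis
      using h by (auto simp: Sh_Hom const_on_arr const_etop)
  qed
  then show ?thesis
    by (auto simp: exact0_def is_functor_def Sh_Ob Sh_Idn Sh_Cmp Sh_Zero is_sheaf_const const_on_arr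
        fun_eq_iff)
qed

text \<open>The stalk complexes of a constant complex are the original complex, at every
  point.\<close>

lemma preserves_const:
  fixes X :: "'a topology"
  shows "preserves (Ch Ab) qis_Ab (qis_Sh X :: ('a, 'u) sh_complex \<Rightarrow> _) (ch_ftor (const_ftor X))"
  unfolding preserves_def
proof (intro ballI impI)
  fix A B :: "'u ab_complex" and f
  assume A: "A \<in> Ob (Ch Ab)" and B: "B \<in> Ob (Ch Ab)" and f: "f \<in> Hom (Ch Ab) A B" and q: "f \<in> qis_Ab A B"
  have F: "is_functor (Ch Ab) (Ch (Sh X)) (ch_ftor (const_ftor X))"
    by (rule is_functor_ch[OF exact0_const])
  have "on_ob (ch_ftor (stalk_ftor x)) (on_ob (ch_ftor (const_ftor X)) E) = E"
    if "x \<in> topspace X" for x and E :: "'u ab_complex"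
    using that by (cases E) (simp add: ch_ftor_on_ob const_on_arr)
  then show "on_arr (ch_ftor (const_ftor X)) A B f
      \<in> qis_Sh X (on_ob (ch_ftor (const_ftor X)) A) (on_ob (ch_ftor (const_ftor X)) B)"
    using functor_Hom[OF F A B f] q by (simp add: qis_Sh_def ch_ftor_on_arr const_on_arr)
qed

section \<open>Extension of sheaves from a subset\<close>

lemma mem_sections_iff:
  assumes "openin X S"
  shows "\<sigma> \<in> sections X F S \<longleftrightarrow> \<sigma> \<in> extensional S \<and> local_section X F S \<sigma>"
  using assms by (simp add: sections_def local_section_def)

lemma local_section_empty: "local_section X F {} g"
  by (simp add: local_section_def continuous_map_def)

lemma ext_stalk [simp]:
  "stalk (on_ob (push_ftor X Y) G) x = (if x \<in> Y then stalk G x else singleton_group undefined)"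
  "stalk (on_ob (shriek_ftor X Y) G) x = (if x \<in> Y then stalk G x else singleton_group undefined)"
  by (simp_all add: push_ftor_def shriek_ftor_def ext_sheaf_def)

lemma ext_on_arr [simp]:
  "on_arr (push_ftor X Y) F G = ext_map X Y"
  "on_arr (shriek_ftor X Y) F G = ext_map X Y"
  by (simp_all add: push_ftor_def shriek_ftor_def)

lemma singleton_group_one [simp]: "\<one>\<^bsub>singleton_group a\<^esub> = a"
  and singleton_group_mult [simp]: "s \<otimes>\<^bsub>singleton_group a\<^esub> t = a"
  by (simp_all add: singleton_group_def)

lemma singleton_group_inv [simp]: "inv\<^bsub>singleton_group a\<^esub> a = a"
  using group.inv_closed[OF singleton_group, of a a] by simp

lemma ext_map_simps:
  "x \<in> topspace X \<Longrightarrow> x \<in> S \<Longrightarrow> ext_map X S \<phi> x = \<phi> x"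
  "x \<in> topspace X \<Longrightarrow> x \<notin> S \<Longrightarrow> ext_map X S \<phi> x = Idn Ab (singleton_group undefined)"
  by (auto simp: ext_map_def Ab_Idn)

lemma ext_map_extensional: "ext_map X S \<phi> \<in> extensional (topspace X)"
  by (simp add: ext_map_def)

text \<open>Direct image and extension by zero have the same stalks and the same action on morphisms
  and differ only in the etale topology. What depends on that topology is left as hypotheses
  \<open>ob\<close> and \<open>cont\<close>; the rest is checked on stalks, with identities of the
  singleton group off \<open>S\<close>.\<close>

lemma ext_functor:
  assumes S: "S \<subseteq> topspace X" and sing: "singleton_group (undefined :: 'u) \<in> Ob Ab"
    and ob: "\<And>G. is_sheaf (subtopology X S) G \<Longrightarrow> is_sheaf X (on_ob T G)"
    and st: "\<And>G x. stalk (on_ob T G) x = (if x \<in> S then stalk G x else singleton_group undefined)"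
    and arr: "\<And>F G. on_arr T F G = ext_map X S"
    and cont: "\<And>F G \<phi>. \<lbrakk>is_sheaf (subtopology X S) F; is_sheaf (subtopology X S) G;
        \<phi> \<in> Hom (Sh (subtopology X S)) F G\<rbrakk>
      \<Longrightarrow> continuous_map (etop (on_ob T F)) (etop (on_ob T G)) (\<lambda>(x, s). (x, ext_map X S \<phi> x s))"
  shows "exact0 (Sh (subtopology X S)) (Sh X)
    (T :: (('a, 'u) sheaf, 'a \<Rightarrow> 'u \<Rightarrow> 'u, ('a, 'u) sheaf, 'a \<Rightarrow> 'u \<Rightarrow> 'u) ftor)"
proof -
  interpret AB: cat Ab by (rule cat_Ab)
  let ?S = "Sh (subtopology X S)"
  note sing' = AB.Idn_in[OF sing] AB.Cmp_Idn[OF sing sing AB.Idn_in[OF sing]]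
  have "on_arr T F G \<phi> \<in> Hom (Sh X) (on_ob T F) (on_ob T G)"
    if "is_sheaf (subtopology X S) F" "is_sheaf (subtopology X S) G" and \<phi>: "\<phi> \<in> Hom ?S F G" for F G \<phi>
  proof -
    have "ext_map X S \<phi> x \<in> Hom Ab (stalk (on_ob T F) x) (stalk (on_ob T G) x)" if "x \<in> topspace X" for x
      using that Sh_HomD(2)[OF \<phi>, of x] sing' by (cases "x \<in> S") (simp_all add: st ext_map_simps)
    then show ?thesis
      using cont[OF that] by (simp add: Sh_Hom arr ext_map_extensional)
  qed
  moreover have "on_arr T F F (Idn ?S F) = Idn (Sh X) (on_ob T F)" for F
    using S by (auto simp: arr Sh_Idn st ext_map_def Ab_Idn fun_eq_iff)
  moreover have "on_arr T F H (Cmp ?S F G H \<psi> \<phi>)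
      = Cmp (Sh X) (on_ob T F) (on_ob T G) (on_ob T H) (on_arr T G H \<psi>) (on_arr T F G \<phi>)" for F G H \<psi> \<phi>
    using S by (auto simp: arr Sh_Cmp st ext_map_def Ab_Cmp compose_def fun_eq_iff)
  moreover have "on_arr T F G (Zero ?S F G) = Zero (Sh X) (on_ob T F) (on_ob T G)" for F G
    using S by (auto simp: arr Sh_Zero st ext_map_def Ab_Zero fun_eq_iff)
  ultimately show ?thesis
    using ob by (auto simp: exact0_def is_functor_def Sh_Ob)
qed

section \<open>Direct image along a closed subset\<close>

text \<open>The generators of the etale topology in the form that \<open>generated_sheaf\<close>
  expects: functions on all of \<open>V\<close>, with the only element \<open>undefined\<close> of
  the stalk as value off \<open>Y\<close>.\<close>

definition push_section :: "'a topology \<Rightarrow> 'a set \<Rightarrow> ('a, 'u) sheaf \<Rightarrow> 'a set \<Rightarrow> ('a \<Rightarrow> 'u) \<Rightarrow> bool" where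
  "push_section X Y G V g \<longleftrightarrow> openin X V \<and> local_section (subtopology X Y) G (V \<inter> Y) g \<and>
     (\<forall>x \<in> V - Y. g x = undefined)"

lemma push_etop:
  "etop (on_ob (push_ftor X Y) G) = topology_generated_by {(\<lambda>x. (x, g x)) ` V | V g. push_section X Y G V g}"
proof -
  have "{(\<lambda>x. (x, if x \<in> Y then \<sigma> x else undefined)) ` V | V \<sigma>.
      openin X V \<and> \<sigma> \<in> sections (subtopology X Y) G (V \<inter> Y)}
    = {(\<lambda>x. (x, g x)) ` V | V g. push_section X Y G V g}" (is "?L = ?R")
  proof
    show "?L \<subseteq> ?R"
    proof
      fix A assume "A \<in> ?L"
      then obtain V \<sigma> where V: "openin X V" and \<sigma>: "\<sigma> \<in> sections (subtopology X Y) G (V \<inter> Y)"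
        and A: "A = (\<lambda>x. (x, if x \<in> Y then \<sigma> x else undefined)) ` V" by blast
      have "local_section (subtopology X Y) G (V \<inter> Y) \<sigma>"
        using \<sigma> openin_subtopology_Int[OF V, of Y] by (simp add: mem_sections_iff)
      then have "local_section (subtopology X Y) G (V \<inter> Y) (\<lambda>x. if x \<in> Y then \<sigma> x else undefined)"
        by (rule local_section_cong) auto
      then have "push_section X Y G V (\<lambda>x. if x \<in> Y then \<sigma> x else undefined)"
        using V by (simp add: push_section_def)
      then show "A \<in> ?R"
        using A by (intro CollectI exI[of _ V] exI[of _ "\<lambda>x. if x \<in> Y then \<sigma> x else undefined"]) simp
    qed
    show "?R \<subseteq> ?L"
    proof
      fix A assume "A \<in> ?R"
      then obtain V g where g: "push_section X Y G V g" and A: "A = (\<lambda>x. (x, g x)) ` V" by blast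
      then have V: "openin X V" and l: "local_section (subtopology X Y) G (V \<inter> Y) g"
        and u: "\<forall>x \<in> V - Y. g x = undefined"
        by (auto simp: push_section_def)
      have "local_section (subtopology X Y) G (V \<inter> Y) (restrict g (V \<inter> Y))"
        using l by (rule local_section_cong) auto
      then have "restrict g (V \<inter> Y) \<in> sections (subtopology X Y) G (V \<inter> Y)"
        using openin_subtopology_Int[OF V, of Y] by (simp add: mem_sections_iff)
      moreover have "A = (\<lambda>x. (x, if x \<in> Y then restrict g (V \<inter> Y) x else undefined)) ` V"
        unfolding A using u by (intro image_cong) auto
      ultimately show "A \<in> ?L"
        using V by blast
    qed
  qed
  then show ?thesis
    by (simp add: push_ftor_def ext_sheaf_def)
qed

lemma push_section_trivial: "openin X V \<Longrightarrow> V \<inter> Y = {} \<Longrightarrow> push_section X Y G V (\<lambda>_. undefined)"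
  by (simp add: push_section_def local_section_empty)

lemma push_section_extend:
  assumes "openin X V" "local_section (subtopology X Y) G (V \<inter> Y) g"
  shows "push_section X Y G V (\<lambda>x. if x \<in> Y then g x else undefined)"
proof -
  have "local_section (subtopology X Y) G (V \<inter> Y) (\<lambda>x. if x \<in> Y then g x else undefined)"
    using assms(2) by (rule local_section_cong) auto
  then show ?thesis
    using assms(1) by (simp add: push_section_def)
qed

text \<open>A section over an open set of \<open>Y\<close> extends by \<open>undefined\<close> to
  any open set of \<open>X\<close> with that trace. Off \<open>Y\<close> the trivial section over
  the complement is used, which is open because \<open>Y\<close> is closed.\<close>

lemma push_section_through:
  assumes G: "is_sheaf (subtopology X Y) G" and Y: "closedin X Y"
    and x: "x \<in> topspace X" and s: "s \<in> carrier (stalk (on_ob (push_ftor X Y) G) x)"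
  shows "\<exists>V g. push_section X Y G V g \<and> x \<in> V \<and> g x = s"
proof (cases "x \<in> Y")
  case True
  obtain V0 g where g: "local_section (subtopology X Y) G V0 g" "x \<in> V0" "g x = s"
    using local_section_through[OF G, of x s] x s True by auto
  obtain V where V: "openin X V" "V0 = V \<inter> Y"
    using local_section_open[OF g(1)] by (auto simp: openin_subtopology)
  then have "push_section X Y G V (\<lambda>x. if x \<in> Y then g x else undefined)"
    using g(1) by (intro push_section_extend) auto
  then show ?thesis
    using True V g by (intro exI[of _ V] exI[of _ "\<lambda>x. if x \<in> Y then g x else undefined"]) auto
next
  case False
  have "push_section X Y G (topspace X - Y) (\<lambda>_. undefined)"
    using Y by (intro push_section_trivial) auto
  then show ?thesis
    using False x s by (intro exI[of _ "topspace X - Y"] exI[of _ "\<lambda>_. undefined"]) auto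
qed

lemma push_sheaf:
  fixes G :: "('a, 'u) sheaf"
  assumes G: "is_sheaf (subtopology X Y) G" and Y: "closedin X Y"
    and sing: "singleton_group (undefined :: 'u) \<in> Ob Ab"
  shows is_sheaf_push: "is_sheaf X (on_ob (push_ftor X Y) G)"
    and local_section_push: "push_section X Y G V g \<Longrightarrow> local_section X (on_ob (push_ftor X Y) G) V g"
proof -
  let ?P = "on_ob (push_ftor X Y) G" and ?S = "push_section X Y G"
  have st: "stalk ?P x \<in> Ob Ab" if "x \<in> topspace X" for x
    using sheaf_stalk[OF G, of x] that sing by simp
  have opn: "openin X V" if "?S V g" for V g
    using that by (simp add: push_section_def)
  have val: "g x \<in> carrier (stalk ?P x)" if "?S V g" "x \<in> V" for V g x
    using that local_section_carrier[OF G, of "V \<inter> Y" g x] by (auto simp: push_section_def)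
  have restr: "?S V' g" if g: "?S V g" and V': "openin X V'" "V' \<subseteq> V" for V g V'
  proof -
    have "local_section (subtopology X Y) G (V' \<inter> Y) g"
      by (rule local_section_mono[of _ _ "V \<inter> Y"]) (use g V' in \<open>auto simp: push_section_def openin_subtopology_Int\<close>)
    then show ?thesis
      using g V' by (auto simp: push_section_def)
  qed
  have agree: "openin X {x \<in> V \<inter> W. g x = h x}" if g: "?S V g" and h: "?S W h" for V g W h
  proof -
    have "openin (subtopology X Y) {x \<in> (V \<inter> Y) \<inter> (W \<inter> Y). g x = h x}"
      by (rule local_section_agree[OF G]) (use g h in \<open>auto simp: push_section_def\<close>)
    then obtain N where N: "openin X N" "{x \<in> (V \<inter> Y) \<inter> (W \<inter> Y). g x = h x} = N \<inter> Y"
      by (auto simp: openin_subtopology)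
    \<comment> \<open>Off \<open>Y\<close> both sections are \<open>undefined\<close> and agree, so
      the agreement locus is the one on \<open>Y\<close> together with the open complement of
      \<open>Y\<close>.\<close>
    have "{x \<in> V \<inter> W. g x = h x} = (V \<inter> W) \<inter> (N \<union> (topspace X - Y))"
      using g h N(2) openin_subset[OF opn[OF g]] by (auto simp: push_section_def)
    moreover have "openin X ((V \<inter> W) \<inter> (N \<union> (topspace X - Y)))"
      using opn[OF g] opn[OF h] N(1) Y by blast
    ultimately show ?thesis by simp
  qed
  have mult: "?S (V \<inter> W) (\<lambda>x. g x \<otimes>\<^bsub>stalk ?P x\<^esub> h x)" if g: "?S V g" and h: "?S W h" for V g W h
  proof -
    have "local_section (subtopology X Y) G ((V \<inter> Y) \<inter> (W \<inter> Y)) (\<lambda>x. g x \<otimes>\<^bsub>stalk G x\<^esub> h x)"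
      by (rule local_section_mult[OF G]) (use g h in \<open>auto simp: push_section_def\<close>)
    then have "local_section (subtopology X Y) G ((V \<inter> Y) \<inter> (W \<inter> Y)) (\<lambda>x. g x \<otimes>\<^bsub>stalk ?P x\<^esub> h x)"
      by (rule local_section_cong) auto
    moreover have "(V \<inter> Y) \<inter> (W \<inter> Y) = (V \<inter> W) \<inter> Y"
      by blast
    ultimately show ?thesis
      using opn[OF g] opn[OF h] by (auto simp: push_section_def)
  qed
  have inv: "?S V (\<lambda>x. inv\<^bsub>stalk ?P x\<^esub> (g x))" if g: "?S V g" for V g
  proof -
    have "local_section (subtopology X Y) G (V \<inter> Y) (\<lambda>x. inv\<^bsub>stalk G x\<^esub> (g x))"
      by (rule local_section_inv[OF G]) (use g in \<open>auto simp: push_section_def\<close>)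
    then have "local_section (subtopology X Y) G (V \<inter> Y) (\<lambda>x. inv\<^bsub>stalk ?P x\<^esub> (g x))"
      by (rule local_section_cong) auto
    then show ?thesis
      using g by (auto simp: push_section_def)
  qed
  show "is_sheaf X ?P"
    by (rule generated_sheaf(1)[where S = ?S])
      (rule push_etop | erule (2) restr | erule (1) val agree mult push_section_through[OF G Y] | erule st opn inv)+
  show "local_section X ?P V g" if "?S V g"
    by (rule generated_sheaf(2)[where S = ?S])
      (rule push_etop that | erule (2) restr | erule (1) val agree mult push_section_through[OF G Y] | erule st opn inv)+
qed

lemma exact0_push:
  fixes X :: "'a topology"
  assumes Y: "closedin X Y" and sing: "singleton_group (undefined :: 'u) \<in> Ob Ab"
  shows "exact0 (Sh (subtopology X Y)) (Sh X)
    (push_ftor X Y :: (('a, 'u) sheaf, 'a \<Rightarrow> 'u \<Rightarrow> 'u, ('a, 'u) sheaf, 'a \<Rightarrow> 'u \<Rightarrow> 'u) ftor)"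
proof (rule ext_functor)
  show "Y \<subseteq> topspace X"
    using Y closedin_subset by blast
  fix F G :: "('a, 'u) sheaf" and \<phi>
  assume F: "is_sheaf (subtopology X Y) F" and G: "is_sheaf (subtopology X Y) G"
    and \<phi>: "\<phi> \<in> Hom (Sh (subtopology X Y)) F G"
  let ?F = "on_ob (push_ftor X Y) F" and ?G = "on_ob (push_ftor X Y) G"
  show "continuous_map (etop ?F) (etop ?G) (\<lambda>(x, s). (x, ext_map X Y \<phi> x s))"
  proof (rule fibre_map_continuous[OF is_sheaf_push[OF F Y sing]])
    fix x s assume "x \<in> topspace X" "s \<in> carrier (stalk ?F x)"
    then obtain V g where g: "push_section X Y F V g" "x \<in> V" "g x = s"
      using push_section_through[OF F Y] by blast
    have V: "openin X V"
      using g(1) by (simp add: push_section_def)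
    have "local_section (subtopology X Y) G (V \<inter> Y) (\<lambda>y. \<phi> y (g y))"
      by (rule local_section_comp[OF _ Sh_HomD(3)[OF \<phi>]]) (use g in \<open>auto simp: push_section_def\<close>)
    then have "local_section (subtopology X Y) G (V \<inter> Y) (\<lambda>y. ext_map X Y \<phi> y (g y))"
      by (rule local_section_cong) (use openin_subset[OF V] in \<open>auto simp: ext_map_simps\<close>)
    then have "push_section X Y G V (\<lambda>y. ext_map X Y \<phi> y (g y))"
      using g openin_subset[OF V] by (auto simp: push_section_def ext_map_simps Ab_Idn)
    then show "\<exists>V g. x \<in> V \<and> local_section X ?F V g \<and> g x = s \<and> local_section X ?G V (\<lambda>y. ext_map X Y \<phi> y (g y))"
      using g local_section_push[OF F Y sing] local_section_push[OF G Y sing] by blast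
  qed
qed (use assms in \<open>simp_all add: is_sheaf_push\<close>)

section \<open>Extension by zero along an open subset\<close>

text \<open>As \<open>push_section\<close>, with the support condition added. Closedness of the
  support in the open set \<open>V\<close> is expressed as openness in \<open>X\<close> of its
  complement in \<open>V\<close>, which avoids nested subspaces.\<close>

definition shriek_section :: "'a topology \<Rightarrow> 'a set \<Rightarrow> ('a, 'u) sheaf \<Rightarrow> 'a set \<Rightarrow> ('a \<Rightarrow> 'u) \<Rightarrow> bool" where
  "shriek_section X U G V g \<longleftrightarrow> openin X V \<and> local_section (subtopology X U) G (V \<inter> U) g \<and>
     (\<forall>x \<in> V - U. g x = undefined) \<and> openin X (V - {x \<in> V \<inter> U. g x \<noteq> \<one>\<^bsub>stalk G x\<^esub>})"

lemma closedin_open_subtopology: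
  assumes "openin X V" "A \<subseteq> V"
  shows "closedin (subtopology X V) A \<longleftrightarrow> openin X (V - A)"
  using assms openin_subset[OF assms(1)] by (auto simp: closedin_def openin_open_subtopology Int_absorb1)

lemma shriek_etop:
  "etop (on_ob (shriek_ftor X U) G) = topology_generated_by {(\<lambda>x. (x, g x)) ` V | V g. shriek_section X U G V g}"
proof -
  let ?\<Gamma> = "\<lambda>V. {\<sigma> \<in> sections (subtopology X U) G (V \<inter> U).
           closedin (subtopology X V) {x \<in> V \<inter> U. \<sigma> x \<noteq> \<one>\<^bsub>stalk G x\<^esub>}}"
  have "{(\<lambda>x. (x, if x \<in> U then \<sigma> x else undefined)) ` V | V \<sigma>. openin X V \<and> \<sigma> \<in> ?\<Gamma> V}
    = {(\<lambda>x. (x, g x)) ` V | V g. shriek_section X U G V g}" (is "?L = ?R")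
  proof
    show "?L \<subseteq> ?R"
    proof
      fix A assume "A \<in> ?L"
      then obtain V \<sigma> where V: "openin X V" and \<sigma>: "\<sigma> \<in> ?\<Gamma> V"
        and A: "A = (\<lambda>x. (x, if x \<in> U then \<sigma> x else undefined)) ` V" by blast
      have "local_section (subtopology X U) G (V \<inter> U) \<sigma>"
        using \<sigma> openin_subtopology_Int[OF V, of U] by (simp add: mem_sections_iff)
      then have "local_section (subtopology X U) G (V \<inter> U) (\<lambda>x. if x \<in> U then \<sigma> x else undefined)"
        by (rule local_section_cong) auto
      moreover have "openin X (V - {x \<in> V \<inter> U. \<sigma> x \<noteq> \<one>\<^bsub>stalk G x\<^esub>})"
        using \<sigma> closedin_open_subtopology[OF V, of "{x \<in> V \<inter> U. \<sigma> x \<noteq> \<one>\<^bsub>stalk G x\<^esub>}"] by auto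
      moreover have "{x \<in> V \<inter> U. (if x \<in> U then \<sigma> x else undefined) \<noteq> \<one>\<^bsub>stalk G x\<^esub>}
          = {x \<in> V \<inter> U. \<sigma> x \<noteq> \<one>\<^bsub>stalk G x\<^esub>}"
        by auto
      ultimately have "shriek_section X U G V (\<lambda>x. if x \<in> U then \<sigma> x else undefined)"
        using V by (simp add: shriek_section_def)
      then show "A \<in> ?R"
        using A by (intro CollectI exI[of _ V] exI[of _ "\<lambda>x. if x \<in> U then \<sigma> x else undefined"]) simp
    qed
    show "?R \<subseteq> ?L"
    proof
      fix A assume "A \<in> ?R"
      then obtain V g where g: "shriek_section X U G V g" and A: "A = (\<lambda>x. (x, g x)) ` V" by blast
      then have V: "openin X V" and l: "local_section (subtopology X U) G (V \<inter> U) g"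
        and u: "\<forall>x \<in> V - U. g x = undefined"
        and c: "openin X (V - {x \<in> V \<inter> U. g x \<noteq> \<one>\<^bsub>stalk G x\<^esub>})"
        by (auto simp: shriek_section_def)
      have "local_section (subtopology X U) G (V \<inter> U) (restrict g (V \<inter> U))"
        using l by (rule local_section_cong) auto
      then have "restrict g (V \<inter> U) \<in> sections (subtopology X U) G (V \<inter> U)"
        using openin_subtopology_Int[OF V, of U] by (simp add: mem_sections_iff)
      moreover have "{x \<in> V \<inter> U. restrict g (V \<inter> U) x \<noteq> \<one>\<^bsub>stalk G x\<^esub>} = {x \<in> V \<inter> U. g x \<noteq> \<one>\<^bsub>stalk G x\<^esub>}"
        by auto
      moreover have "closedin (subtopology X V) {x \<in> V \<inter> U. g x \<noteq> \<one>\<^bsub>stalk G x\<^esub>}"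
        using c closedin_open_subtopology[OF V, of "{x \<in> V \<inter> U. g x \<noteq> \<one>\<^bsub>stalk G x\<^esub>}"] by auto
      ultimately have "restrict g (V \<inter> U) \<in> ?\<Gamma> V"
        by simp
      moreover have "A = (\<lambda>x. (x, if x \<in> U then restrict g (V \<inter> U) x else undefined)) ` V"
        unfolding A using u by (intro image_cong) auto
      ultimately show "A \<in> ?L"
        using V by blast
    qed
  qed
  then show ?thesis
    by (simp add: shriek_ftor_def ext_sheaf_def)
qed

text \<open>Inside \<open>U\<close> the locus where \<open>g\<close> is the unit is open anyway,
  being the agreement locus with the unit section. The support condition thus concerns only points
  of \<open>V - U\<close>, and it suffices that \<open>g\<close> is trivial on a neighbourhood
  \<open>N\<close> of them.\<close>

lemma shriek_sectionI:
  assumes G: "is_sheaf (subtopology X U) G" and U: "openin X U"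
    and V: "openin X V" and g: "local_section (subtopology X U) G (V \<inter> U) g"
    and u: "\<And>x. x \<in> V - U \<Longrightarrow> g x = undefined"
    and N: "openin X N" "V - U \<subseteq> N" "N \<subseteq> V" "\<And>x. x \<in> N \<inter> U \<Longrightarrow> g x = \<one>\<^bsub>stalk G x\<^esub>"
  shows "shriek_section X U G V g"
proof -
  have "openin (subtopology X U) (V \<inter> U)"
    by (rule local_section_open[OF g])
  then have "openin (subtopology X U) {x \<in> (V \<inter> U) \<inter> (V \<inter> U). g x = \<one>\<^bsub>stalk G x\<^esub>}"
    by (intro local_section_agree[OF G g] local_section_one[OF G])
  then have "openin X ({x \<in> (V \<inter> U) \<inter> (V \<inter> U). g x = \<one>\<^bsub>stalk G x\<^esub>} \<union> N)"
    using openin_trans_full[OF _ U] N(1) by blast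
  moreover have "{x \<in> (V \<inter> U) \<inter> (V \<inter> U). g x = \<one>\<^bsub>stalk G x\<^esub>} \<union> N = V - {x \<in> V \<inter> U. g x \<noteq> \<one>\<^bsub>stalk G x\<^esub>}"
    using N(2-4) by auto
  ultimately show ?thesis
    using V g u by (simp add: shriek_section_def)
qed

lemma shriek_section_inside:
  assumes G: "is_sheaf (subtopology X U) G" and U: "openin X U"
    and g: "local_section (subtopology X U) G V g"
  shows "shriek_section X U G V g"
proof (rule shriek_sectionI[OF G U])
  have V: "openin (subtopology X U) V" "V \<subseteq> U"
    using local_section_open[OF g] openin_subset[of "subtopology X U" V] by auto
  show "openin X V"
    by (rule openin_trans_full[OF V(1) U])
  show "local_section (subtopology X U) G (V \<inter> U) g"
    using g V by (simp add: Int_absorb2)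
  show "g x = undefined" if "x \<in> V - U" for x
    using that V by blast
  \<comment> \<open>A section over an open subset of \<open>U\<close> has no boundary points to
    control, so the empty set serves as \<open>N\<close>.\<close>
  show "V - U \<subseteq> {}"
    using V by blast
qed auto

lemma shriek_section_through:
  assumes G: "is_sheaf (subtopology X U) G" and U: "openin X U"
    and x: "x \<in> topspace X" and s: "s \<in> carrier (stalk (on_ob (shriek_ftor X U) G) x)"
  shows "\<exists>V g. shriek_section X U G V g \<and> x \<in> V \<and> g x = s"
proof (cases "x \<in> U")
  case True
  then obtain V g where "local_section (subtopology X U) G V g" "x \<in> V" "g x = s"
    using local_section_through[OF G, of x s] x s by auto
  then show ?thesis
    using shriek_section_inside[OF G U] by blast
next
  case False
  \<comment> \<open>Through the only element of the stalk at a point off \<open>U\<close> passes the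
    zero section, which is defined on all of \<open>X\<close>.\<close>
  let ?g = "\<lambda>x. if x \<in> U then \<one>\<^bsub>stalk G x\<^esub> else undefined"
  have "local_section (subtopology X U) G (topspace X \<inter> U) (\<lambda>x. \<one>\<^bsub>stalk G x\<^esub>)"
    by (rule local_section_one[OF G]) (simp add: openin_subtopology_Int)
  then have "local_section (subtopology X U) G (topspace X \<inter> U) ?g"
    by (rule local_section_cong) auto
  then have "shriek_section X U G (topspace X) ?g"
    by (intro shriek_sectionI[OF G U, where N = "topspace X"]) auto
  then show ?thesis
    using False x s by (intro exI[of _ "topspace X"] exI[of _ ?g]) auto
qed

lemma shriek_sheaf:
  fixes G :: "('a, 'u) sheaf"
  assumes G: "is_sheaf (subtopology X U) G" and U: "openin X U"
    and sing: "singleton_group (undefined :: 'u) \<in> Ob Ab"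
  shows is_sheaf_shriek: "is_sheaf X (on_ob (shriek_ftor X U) G)"
    and local_section_shriek: "shriek_section X U G V g \<Longrightarrow> local_section X (on_ob (shriek_ftor X U) G) V g"
proof -
  let ?P = "on_ob (shriek_ftor X U) G" and ?S = "shriek_section X U G"
  let ?N = "\<lambda>V g. V - {x \<in> V \<inter> U. g x \<noteq> \<one>\<^bsub>stalk G x\<^esub>}"
  have grp: "group (stalk G x)" if "x \<in> topspace X" "x \<in> U" for x
    using sheaf_stalk[OF G, of x] that by (simp add: Ab_group)
  have st: "stalk ?P x \<in> Ob Ab" if "x \<in> topspace X" for x
    using sheaf_stalk[OF G, of x] that sing by simp
  have opn: "openin X V" and sup: "openin X (?N V g)"
    and loc: "local_section (subtopology X U) G (V \<inter> U) g" and und: "\<And>x. x \<in> V - U \<Longrightarrow> g x = undefined"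
    if "?S V g" for V g
    using that by (auto simp: shriek_section_def)
  have val: "g x \<in> carrier (stalk ?P x)" if "?S V g" "x \<in> V" for V g x
    using that(2) local_section_carrier[OF G loc[OF that(1)], of x] und[OF that(1)] by auto
  have restr: "?S V' g" if g: "?S V g" and V': "openin X V'" "V' \<subseteq> V" for V g V'
  proof (rule shriek_sectionI[OF G U V'(1)])
    show "local_section (subtopology X U) G (V' \<inter> U) g"
      by (rule local_section_mono[OF loc[OF g]]) (use V' in \<open>auto simp: openin_subtopology_Int\<close>)
    show "openin X (V' \<inter> ?N V g)"
      using V' sup[OF g] by blast
  qed (use V' und[OF g] in auto)
  have agree: "openin X {x \<in> V \<inter> W. g x = h x}" if g: "?S V g" and h: "?S W h" for V g W h
  proof -
    have "openin (subtopology X U) {x \<in> (V \<inter> U) \<inter> (W \<inter> U). g x = h x}"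
      by (rule local_section_agree[OF G loc[OF g] loc[OF h]])
    then have "openin X ({x \<in> (V \<inter> U) \<inter> (W \<inter> U). g x = h x} \<union> (?N V g \<inter> ?N W h))"
      using openin_trans_full[OF _ U] sup[OF g] sup[OF h] by blast
    \<comment> \<open>Points of the agreement locus off \<open>U\<close> have both values
      \<open>undefined\<close> and lie in both complements of supports. Conversely, on the
      intersection of these complements both sections are the unit in \<open>U\<close> and
      \<open>undefined\<close> off \<open>U\<close>.\<close>
    moreover have "{x \<in> V \<inter> W. g x = h x} = {x \<in> (V \<inter> U) \<inter> (W \<inter> U). g x = h x} \<union> (?N V g \<inter> ?N W h)"
      (is "?A = ?B")
    proof (rule Set.set_eqI)
      show "x \<in> ?A \<longleftrightarrow> x \<in> ?B" for x
        using und[OF g, of x] und[OF h, of x] by auto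
    qed
    ultimately show ?thesis by simp
  qed
  have mult: "?S (V \<inter> W) (\<lambda>x. g x \<otimes>\<^bsub>stalk ?P x\<^esub> h x)" if g: "?S V g" and h: "?S W h" for V g W h
  proof (rule shriek_sectionI[OF G U])
    have "local_section (subtopology X U) G ((V \<inter> U) \<inter> (W \<inter> U)) (\<lambda>x. g x \<otimes>\<^bsub>stalk G x\<^esub> h x)"
      by (rule local_section_mult[OF G loc[OF g] loc[OF h]])
    then have "local_section (subtopology X U) G ((V \<inter> U) \<inter> (W \<inter> U)) (\<lambda>x. g x \<otimes>\<^bsub>stalk ?P x\<^esub> h x)"
      by (rule local_section_cong) auto
    moreover have "(V \<inter> U) \<inter> (W \<inter> U) = (V \<inter> W) \<inter> U"
      by blast
    ultimately show "local_section (subtopology X U) G ((V \<inter> W) \<inter> U) (\<lambda>x. g x \<otimes>\<^bsub>stalk ?P x\<^esub> h x)"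
      by simp
    show "openin X (?N V g \<inter> ?N W h)"
      using sup[OF g] sup[OF h] by blast
    show "g x \<otimes>\<^bsub>stalk ?P x\<^esub> h x = \<one>\<^bsub>stalk G x\<^esub>" if "x \<in> ?N V g \<inter> ?N W h \<inter> U" for x
    proof -
      have "x \<in> topspace X"
        using that openin_subset[OF opn[OF g]] by auto
      then have "monoid (stalk G x)"
        using grp that by (auto intro: group.is_monoid)
      then show ?thesis
        using that by (auto simp: monoid.l_one)
    qed
  qed (use opn[OF g] opn[OF h] in auto)
  have inv: "?S V (\<lambda>x. inv\<^bsub>stalk ?P x\<^esub> (g x))" if g: "?S V g" for V g
  proof (rule shriek_sectionI[OF G U opn[OF g]])
    have "local_section (subtopology X U) G (V \<inter> U) (\<lambda>x. inv\<^bsub>stalk G x\<^esub> (g x))"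
      by (rule local_section_inv[OF G loc[OF g]])
    then show "local_section (subtopology X U) G (V \<inter> U) (\<lambda>x. inv\<^bsub>stalk ?P x\<^esub> (g x))"
      by (rule local_section_cong) auto
    show "openin X (?N V g)"
      using sup[OF g] .
    show "inv\<^bsub>stalk ?P x\<^esub> (g x) = \<one>\<^bsub>stalk G x\<^esub>" if "x \<in> ?N V g \<inter> U" for x
    proof -
      have "x \<in> topspace X"
        using that openin_subset[OF opn[OF g]] by auto
      then show ?thesis
        using that grp[of x] by (auto simp: group.is_monoid monoid.inv_one)
    qed
  qed (use und[OF g] in auto)
  show "is_sheaf X ?P"
    by (rule generated_sheaf(1)[where S = ?S])
      (rule shriek_etop | erule (2) restr | erule (1) val agree mult shriek_section_through[OF G U] | erule st opn inv)+
  show "local_section X ?P V g" if "?S V g"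
    by (rule generated_sheaf(2)[where S = ?S])
      (rule shriek_etop that | erule (2) restr | erule (1) val agree mult shriek_section_through[OF G U] | erule st opn inv)+
qed

lemma exact0_shriek:
  fixes X :: "'a topology"
  assumes U: "openin X U" and sing: "singleton_group (undefined :: 'u) \<in> Ob Ab"
  shows "exact0 (Sh (subtopology X U)) (Sh X)
    (shriek_ftor X U :: (('a, 'u) sheaf, 'a \<Rightarrow> 'u \<Rightarrow> 'u, ('a, 'u) sheaf, 'a \<Rightarrow> 'u \<Rightarrow> 'u) ftor)"
proof (rule ext_functor)
  show "U \<subseteq> topspace X"
    using U openin_subset by blast
  fix F G :: "('a, 'u) sheaf" and \<phi>
  assume F: "is_sheaf (subtopology X U) F" and G: "is_sheaf (subtopology X U) G"
    and \<phi>: "\<phi> \<in> Hom (Sh (subtopology X U)) F G"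
  let ?F = "on_ob (shriek_ftor X U) F" and ?G = "on_ob (shriek_ftor X U) G"
  show "continuous_map (etop ?F) (etop ?G) (\<lambda>(x, s). (x, ext_map X U \<phi> x s))"
  proof (rule fibre_map_continuous[OF is_sheaf_shriek[OF F U sing]])
    fix x s assume "x \<in> topspace X" "s \<in> carrier (stalk ?F x)"
    then obtain V g where g: "shriek_section X U F V g" "x \<in> V" "g x = s"
      using shriek_section_through[OF F U] by blast
    have V: "openin X V" "V \<subseteq> topspace X"
      using g(1) openin_subset[of X V] by (auto simp: shriek_section_def)
    have "shriek_section X U G V (\<lambda>y. ext_map X U \<phi> y (g y))"
    proof (rule shriek_sectionI[OF G U V(1)])
      have "local_section (subtopology X U) G (V \<inter> U) (\<lambda>y. \<phi> y (g y))"
        by (rule local_section_comp[OF _ Sh_HomD(3)[OF \<phi>]]) (use g in \<open>auto simp: shriek_section_def\<close>)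
      then show "local_section (subtopology X U) G (V \<inter> U) (\<lambda>y. ext_map X U \<phi> y (g y))"
        by (rule local_section_cong) (use V in \<open>auto simp: ext_map_simps\<close>)
      \<comment> \<open>The complement of the support of \<open>g\<close> serves as \<open>N\<close>
        for the image section too, because homomorphisms map units to units.\<close>
      show "openin X (V - {x \<in> V \<inter> U. g x \<noteq> \<one>\<^bsub>stalk F x\<^esub>})"
        using g by (simp add: shriek_section_def)
      show "ext_map X U \<phi> y (g y) = \<one>\<^bsub>stalk G y\<^esub>"
        if y: "y \<in> (V - {x \<in> V \<inter> U. g x \<noteq> \<one>\<^bsub>stalk F x\<^esub>}) \<inter> U" for y
      proof -
        have "y \<in> topspace (subtopology X U)"
          using y V by auto
        then have "\<phi> y \<one>\<^bsub>stalk F y\<^esub> = \<one>\<^bsub>stalk G y\<^esub>"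
          using Sh_HomD(2)[OF \<phi>] sheaf_stalk[OF F] sheaf_stalk[OF G] by (intro Ab_Hom_one) auto
        then show ?thesis
          using y V by (auto simp: ext_map_simps)
      qed
    qed (use g V in \<open>auto simp: shriek_section_def ext_map_simps Ab_Idn\<close>)
    then show "\<exists>V g. x \<in> V \<and> local_section X ?F V g \<and> g x = s \<and> local_section X ?G V (\<lambda>y. ext_map X U \<phi> y (g y))"
      using g local_section_shriek[OF F U sing] local_section_shriek[OF G U sing] by blast
  qed
qed (use assms in \<open>simp_all add: is_sheaf_shriek\<close>)

lemma preserves_push:
  fixes X :: "'a topology"
  assumes Y: "closedin X Y" and sing: "singleton_group (undefined :: 'u) \<in> Ob Ab"
  shows "preserves (Ch (Sh (subtopology X Y))) (qis_Sh (subtopology X Y)) (qis_Sh X :: ('a, 'u) sh_complex \<Rightarrow> _)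
    (ch_ftor (push_ftor X Y))"
  by (intro preserves_qis_Sh exact0_push assms) (auto simp: ext_map_simps)

lemma preserves_shriek:
  fixes X :: "'a topology"
  assumes U: "openin X U" and sing: "singleton_group (undefined :: 'u) \<in> Ob Ab"
  shows "preserves (Ch (Sh (subtopology X U))) (qis_Sh (subtopology X U)) (qis_Sh X :: ('a, 'u) sh_complex \<Rightarrow> _)
    (ch_ftor (shriek_ftor X U))"
  by (intro preserves_qis_Sh exact0_shriek assms) (auto simp: ext_map_simps)

section \<open>Extension by zero is left adjoint to restriction\<close>

text \<open>The sheaf-level morphism behind \<open>open_part_incl\<close>, given by the same term,
  so that the latter is its termwise class in the derived category.\<close>

definition shriek_counit :: "'a topology \<Rightarrow> 'a set \<Rightarrow> ('a, 'u) sheaf \<Rightarrow> 'a \<Rightarrow> 'u \<Rightarrow> 'u" where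
  "shriek_counit X U F = (\<lambda>x \<in> topspace X. if x \<in> U then Idn Ab (stalk F x)
     else (\<lambda>s \<in> {undefined}. \<one>\<^bsub>stalk F x\<^esub>))"

text \<open>This is where the support condition pays off. A section \<open>g\<close> of the
  extension over \<open>V\<close> is carried to \<open>g\<close> itself on
  \<open>V \<inter> U\<close> and to the unit section on the complement of its support. Both sets
  are open and they cover \<open>V\<close>, so the image glues to a local section of
  \<open>F\<close>.\<close>

lemma shriek_counit_Hom:
  fixes F :: "('a, 'u) sheaf"
  assumes U: "openin X U" and sing: "singleton_group (undefined :: 'u) \<in> Ob Ab" and F: "is_sheaf X F"
  shows "shriek_counit X U F \<in> Hom (Sh X) (on_ob (shriek_ftor X U) (on_ob (restr_ftor X U) F)) F"
proof -
  interpret AB: cat Ab by (rule cat_Ab)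
  let ?R = "on_ob (restr_ftor X U) F"
  let ?J = "on_ob (shriek_ftor X U) ?R"
  have R: "is_sheaf (subtopology X U) ?R"
    by (rule is_sheaf_restr[OF F])
  have "continuous_map (etop ?J) (etop F) (\<lambda>(x, s). (x, shriek_counit X U F x s))"
  proof (rule fibre_map_continuous[OF is_sheaf_shriek[OF R U sing]])
    fix x s assume "x \<in> topspace X" "s \<in> carrier (stalk ?J x)"
    then obtain V g where g: "shriek_section X U ?R V g" "x \<in> V" "g x = s"
      using shriek_section_through[OF R U] by blast
    let ?N = "V - {x \<in> V \<inter> U. g x \<noteq> \<one>\<^bsub>stalk F x\<^esub>}"
    have V: "openin X V" "V \<subseteq> topspace X" and N: "openin X ?N"
      and und: "\<And>x. x \<in> V - U \<Longrightarrow> g x = undefined"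
      using g(1) openin_subset[of X V] by (auto simp: shriek_section_def)
    have loc: "local_section X F (V \<inter> U) g"
      using g(1) local_section_restrD[OF U] by (auto simp: shriek_section_def)
    have st: "group (stalk F y)" if "y \<in> V" for y
      using that V(2) sheaf_stalk[OF F] by (auto intro: Ab_group)
    have "local_section X F V (\<lambda>y. shriek_counit X U F y (g y))"
    proof (rule local_section_glue[OF V(1)])
      fix y assume y: "y \<in> V"
      show "\<exists>V' g'. local_section X F V' g' \<and> y \<in> V' \<and> V' \<subseteq> V \<and> (\<forall>z \<in> V'. g' z = shriek_counit X U F z (g z))"
      proof (cases "y \<in> U")
        case True
        have "g z = shriek_counit X U F z (g z)" if "z \<in> V \<inter> U" for z
          using that V(2) local_section_carrier[OF F loc that] by (auto simp: shriek_counit_def Ab_Idn)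
        then show ?thesis
          using loc y True by (intro exI[of _ "V \<inter> U"] exI[of _ g]) auto
      next
        case False
        have "\<one>\<^bsub>stalk F z\<^esub> = shriek_counit X U F z (g z)" if "z \<in> ?N" for z
          using that V(2) und[of z] group.is_monoid[OF st, of z]
          by (auto simp: shriek_counit_def Ab_Idn monoid.one_closed)
        then show ?thesis
          using local_section_one[OF F N] y False by (intro exI[of _ ?N] exI[of _ "\<lambda>z. \<one>\<^bsub>stalk F z\<^esub>"]) auto
      qed
    qed
    then show "\<exists>V g. x \<in> V \<and> local_section X ?J V g \<and> g x = s \<and> local_section X F V (\<lambda>y. shriek_counit X U F y (g y))"
      using g local_section_shriek[OF R U sing] by blast
  qed
  moreover have "shriek_counit X U F x \<in> Hom Ab (stalk ?J x) (stalk F x)" if x: "x \<in> topspace X" for x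
  proof (cases "x \<in> U")
    case True
    then show ?thesis
      using x AB.Idn_in[OF sheaf_stalk[OF F x]] by (simp add: shriek_counit_def)
  next
    case False
    interpret M: comm_group "stalk F x" by (rule Ab_comm_group[OF sheaf_stalk[OF F x]])
    show ?thesis
      using x False by (auto simp: shriek_counit_def Ab_Hom hom_def)
  qed
  ultimately show ?thesis
    by (auto simp: Sh_Hom shriek_counit_def)
qed

text \<open>Restricting the extension by zero gives back the stalks of \<open>G\<close> on
  \<open>U\<close>, but with a generated etale topology. The identity is continuous because a
  section of \<open>G\<close> over an open subset of \<open>U\<close> is also a section of the
  extension.\<close>

lemma shriek_unit_Hom:
  fixes G :: "('a, 'u) sheaf"
  assumes U: "openin X U" and sing: "singleton_group (undefined :: 'u) \<in> Ob Ab"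
    and G: "is_sheaf (subtopology X U) G"
  shows "Idn (Sh (subtopology X U)) G
    \<in> Hom (Sh (subtopology X U)) G (on_ob (restr_ftor X U) (on_ob (shriek_ftor X U) G))"
proof -
  interpret AB: cat Ab by (rule cat_Ab)
  let ?I = "Idn (Sh (subtopology X U)) G"
  let ?RJ = "on_ob (restr_ftor X U) (on_ob (shriek_ftor X U) G)"
  have "continuous_map (etop G) (etop ?RJ) (\<lambda>(x, s). (x, ?I x s))"
  proof (rule fibre_map_continuous[OF G])
    fix x s assume "x \<in> topspace (subtopology X U)" "s \<in> carrier (stalk G x)"
    then obtain V g where g: "local_section (subtopology X U) G V g" "x \<in> V" "g x = s"
      using local_section_through[OF G] by metis
    have V: "V \<subseteq> topspace X \<inter> U"
      using openin_subset[OF local_section_open[OF g(1)]] by simp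
    have "local_section (subtopology X U) ?RJ (V \<inter> U) g"
      by (intro local_section_restr local_section_shriek[OF G U sing] shriek_section_inside[OF G U g(1)])
    then have "local_section (subtopology X U) ?RJ V g"
      using V by (simp add: Int_absorb2)
    then have "local_section (subtopology X U) ?RJ V (\<lambda>y. ?I y (g y))"
      by (rule local_section_cong) (use V local_section_carrier[OF G g(1)] in \<open>auto simp: Sh_Idn Ab_Idn\<close>)
    then show "\<exists>V g. x \<in> V \<and> local_section (subtopology X U) G V g \<and> g x = s \<and>
        local_section (subtopology X U) ?RJ V (\<lambda>y. ?I y (g y))"
      using g by blast
  qed
  then show ?thesis
    using sheaf_stalk[OF G] by (auto simp: Sh_Hom Sh_Idn intro: AB.Idn_in)
qed

lemma unit_counit_shriek:
  fixes X :: "'a topology"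
  assumes U: "openin X U" and sing: "singleton_group (undefined :: 'u) \<in> Ob Ab"
  shows "unit_counit (Sh (subtopology X U)) (Sh X)
    (shriek_ftor X U :: (('a, 'u) sheaf, 'a \<Rightarrow> 'u \<Rightarrow> 'u, ('a, 'u) sheaf, 'a \<Rightarrow> 'u \<Rightarrow> 'u) ftor)
    (restr_ftor X U) (Idn (Sh (subtopology X U))) (shriek_counit X U)"
proof -
  interpret AB: cat Ab by (rule cat_Ab)
  let ?XU = "subtopology X U"
  let ?J = "shriek_ftor X U :: (('a, 'u) sheaf, 'a \<Rightarrow> 'u \<Rightarrow> 'u, ('a, 'u) sheaf, 'a \<Rightarrow> 'u \<Rightarrow> 'u) ftor"
  let ?R = "restr_ftor X U :: (('a, 'u) sheaf, 'a \<Rightarrow> 'u \<Rightarrow> 'u, ('a, 'u) sheaf, 'a \<Rightarrow> 'u \<Rightarrow> 'u) ftor"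
  have UX: "U \<subseteq> topspace X"
    using U openin_subset by blast
  have R0: "exact0 (Sh X) (Sh ?XU) ?R"
    by (rule exact0_restr)
  have unit: "natural (Sh ?XU) (Sh ?XU) id_ftor (ftor_comp ?R ?J) (Idn (Sh ?XU))"
    unfolding natural_def
  proof (intro conjI ballI)
    fix F G :: "('a, 'u) sheaf" and \<phi>
    assume "F \<in> Ob (Sh ?XU)" "G \<in> Ob (Sh ?XU)" and \<phi>: "\<phi> \<in> Hom (Sh ?XU) F G"
    then have st: "stalk F x \<in> Ob Ab" "stalk G x \<in> Ob Ab" if "x \<in> topspace X" "x \<in> U" for x
      using that by (auto simp: Sh_Ob sheaf_stalk)
    show "Cmp (Sh ?XU) (on_ob id_ftor F) (on_ob id_ftor G) (on_ob (ftor_comp ?R ?J) G) (Idn (Sh ?XU) G)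
        (on_arr id_ftor F G \<phi>)
      = Cmp (Sh ?XU) (on_ob id_ftor F) (on_ob (ftor_comp ?R ?J) F) (on_ob (ftor_comp ?R ?J) G)
        (on_arr (ftor_comp ?R ?J) F G \<phi>) (Idn (Sh ?XU) F)"
      using UX st Sh_HomD(2)[OF \<phi>]
      by (auto simp: Sh_Cmp Sh_Idn restr_on_arr ext_map_simps AB.Cmp_Idn AB.Idn_Cmp fun_eq_iff)
  qed (use shriek_unit_Hom[OF U sing] in \<open>auto simp: Sh_Ob\<close>)
  have counit: "natural (Sh X) (Sh X) (ftor_comp ?J ?R) id_ftor (shriek_counit X U)"
    unfolding natural_def
  proof (intro conjI ballI)
    fix F G :: "('a, 'u) sheaf" and \<phi>
    assume ob: "F \<in> Ob (Sh X)" "G \<in> Ob (Sh X)" and \<phi>: "\<phi> \<in> Hom (Sh X) F G"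
    have "Cmp Ab (stalk (on_ob ?J (on_ob ?R F)) x) (stalk (on_ob ?J (on_ob ?R G)) x) (stalk G x)
        (shriek_counit X U G x) (on_arr ?J (on_ob ?R F) (on_ob ?R G) (on_arr ?R F G \<phi>) x)
      = Cmp Ab (stalk (on_ob ?J (on_ob ?R F)) x) (stalk F x) (stalk G x) (\<phi> x) (shriek_counit X U F x)"
      if x: "x \<in> topspace X" for x
    proof -
      have st: "stalk F x \<in> Ob Ab" "stalk G x \<in> Ob Ab" and \<phi>x: "\<phi> x \<in> Hom Ab (stalk F x) (stalk G x)"
        using x ob Sh_HomD(2)[OF \<phi> x] by (auto simp: Sh_Ob sheaf_stalk)
      show ?thesis
      proof (cases "x \<in> U")
        case True
        then show ?thesis
          using x st \<phi>x by (simp add: ext_map_simps restr_on_arr shriek_counit_def AB.Cmp_Idn AB.Idn_Cmp)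
      next
        \<comment> \<open>Off \<open>U\<close> the source stalk is a singleton, and both composites
          send its element to the unit, since \<open>\<phi> x\<close> preserves units.\<close>
        case False
        then show ?thesis
          using x Ab_Hom_one[OF \<phi>x st]
          by (auto simp: ext_map_simps shriek_counit_def Ab_Cmp Ab_Idn compose_def fun_eq_iff)
      qed
    qed
    then show "Cmp (Sh X) (on_ob (ftor_comp ?J ?R) F) (on_ob (ftor_comp ?J ?R) G) (on_ob id_ftor G)
        (shriek_counit X U G) (on_arr (ftor_comp ?J ?R) F G \<phi>)
      = Cmp (Sh X) (on_ob (ftor_comp ?J ?R) F) (on_ob id_ftor F) (on_ob id_ftor G)
        (on_arr id_ftor F G \<phi>) (shriek_counit X U F)"
      by (simp add: Sh_Cmp cong: restrict_cong)
  qed (use shriek_counit_Hom[OF U sing] in \<open>auto simp: Sh_Ob\<close>)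
  have "Cmp (Sh X) (on_ob ?J G) (on_ob ?J (on_ob ?R (on_ob ?J G))) (on_ob ?J G)
      (shriek_counit X U (on_ob ?J G)) (on_arr ?J G (on_ob ?R (on_ob ?J G)) (Idn (Sh ?XU) G))
    = Idn (Sh X) (on_ob ?J G)" for G
    using UX by (auto simp: Sh_Cmp Sh_Idn ext_map_def shriek_counit_def Ab_Cmp Ab_Idn compose_def fun_eq_iff)
  moreover have "Cmp (Sh ?XU) (on_ob ?R F) (on_ob ?R (on_ob ?J (on_ob ?R F))) (on_ob ?R F)
      (on_arr ?R (on_ob ?J (on_ob ?R F)) F (shriek_counit X U F)) (Idn (Sh ?XU) (on_ob ?R F))
    = Idn (Sh ?XU) (on_ob ?R F)" for F
    by (auto simp: Sh_Cmp Sh_Idn restr_on_arr shriek_counit_def Ab_Cmp Ab_Idn compose_def fun_eq_iff)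
  ultimately show ?thesis
    using unit counit exact0_shriek[OF U sing] R0
    by (simp add: unit_counit_def exact0_def)
qed

section \<open>Exchange of closed support and extension by zero\<close>

text \<open>Because \<open>Y \<subseteq> U\<close>, both functors have the stalks of
  \<open>F\<close> on \<open>Y\<close> and singletons elsewhere, and they act equally on morphisms.
  Only the etale topologies are built differently, so the content is that one function is a local
  section for both constructions, through each point.\<close>

lemma closed_open_natural:
  fixes X :: "'a topology"
  assumes U: "openin X U" and Y: "closedin X Y" and YU: "Y \<subseteq> U"
    and sing: "singleton_group (undefined :: 'u) \<in> Ob Ab"
  defines "T \<equiv> ftor_comp (shriek_ftor X U) (ftor_comp (push_ftor (subtopology X U) Y)
      (ftor_comp (restr_ftor (subtopology X U) Y) (restr_ftor X U)))
      :: (('a, 'u) sheaf, 'a \<Rightarrow> 'u \<Rightarrow> 'u, ('a, 'u) sheaf, 'a \<Rightarrow> 'u \<Rightarrow> 'u) ftor"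
    and "S \<equiv> ftor_comp (push_ftor X Y) (ftor_comp (restr_ftor X Y)
      (ftor_comp (shriek_ftor X U) (restr_ftor X U)))
      :: (('a, 'u) sheaf, 'a \<Rightarrow> 'u \<Rightarrow> 'u, ('a, 'u) sheaf, 'a \<Rightarrow> 'u \<Rightarrow> 'u) ftor"
  shows "natural (Sh X) (Sh X) T S (\<lambda>F. Idn (Sh X) (on_ob T F))"
proof -
  interpret AB: cat Ab by (rule cat_Ab)
  let ?XU = "subtopology X U"
  have UX: "U \<subseteq> topspace X"
    using U openin_subset by blast
  have YX: "Y \<subseteq> topspace X"
    using YU UX by blast
  have YU': "closedin ?XU Y"
    by (rule closedin_subset_topspace[OF Y YU])
  have stT: "stalk (on_ob T F) x = (if x \<in> Y then stalk F x else singleton_group undefined)" for F x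
    using YU by (auto simp: T_def)
  have stS: "stalk (on_ob S F) x = (if x \<in> Y then stalk F x else singleton_group undefined)" for F x
    using YU by (auto simp: S_def)
  have arr: "on_arr T F G \<phi> x = on_arr S F G \<phi> x" if "x \<in> topspace X" for F G \<phi> x
    using that YU UX by (cases "x \<in> U"; cases "x \<in> Y") (auto simp: T_def S_def ext_map_simps restr_on_arr)
  have hom: "Idn (Sh X) (on_ob T F) \<in> Hom (Sh X) (on_ob T F) (on_ob S F)" if F: "is_sheaf X F" for F
  proof -
    let ?FU = "on_ob (restr_ftor X U) F"
    let ?FUY = "on_ob (restr_ftor ?XU Y) ?FU"
    let ?P = "on_ob (push_ftor ?XU Y) ?FUY"
    let ?J = "on_ob (shriek_ftor X U) ?FU"
    let ?JY = "on_ob (restr_ftor X Y) ?J"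
    have FU: "is_sheaf ?XU ?FU"
      by (rule is_sheaf_restr[OF F])
    have FUY: "is_sheaf (subtopology ?XU Y) ?FUY"
      by (rule is_sheaf_restr[OF FU])
    have P: "is_sheaf ?XU ?P"
      by (rule is_sheaf_push[OF FUY YU' sing])
    have T: "on_ob T F = on_ob (shriek_ftor X U) ?P" "is_sheaf X (on_ob T F)"
      using is_sheaf_shriek[OF P U sing] by (simp_all add: T_def)
    have J: "is_sheaf X ?J"
      by (rule is_sheaf_shriek[OF FU U sing])
    have JY: "is_sheaf (subtopology X Y) ?JY"
      by (rule is_sheaf_restr[OF J])
    have S: "on_ob S F = on_ob (push_ftor X Y) ?JY"
      by (simp add: S_def)
    have sec: "\<exists>V g. x \<in> V \<and> local_section X (on_ob T F) V g \<and> g x = s \<and> local_section X (on_ob S F) V g"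
      if x: "x \<in> topspace X" and s: "s \<in> carrier (stalk (on_ob T F) x)" for x s
    proof (cases "x \<in> Y")
      case True
      obtain V0 g where g0: "local_section X F V0 g" "x \<in> V0" "g x = s"
        using local_section_through[OF F x, of s] s True by (auto simp: stT)
      \<comment> \<open>Shrinking into \<open>U\<close> makes the support condition vacuous. The
        same section of \<open>F\<close>, cut off outside \<open>Y\<close>, is then a section for
        either order of the two extensions.\<close>
      let ?V = "V0 \<inter> U" and ?g = "\<lambda>y. if y \<in> Y then g y else undefined"
      have V: "openin X ?V"
        using local_section_open[OF g0(1)] U by blast
      have gU: "local_section ?XU ?FU ?V g"
        by (rule local_section_restr[OF g0(1)])
      have "push_section ?XU Y ?FUY ?V ?g"
        by (intro push_section_extend local_section_open[OF gU] local_section_restr[OF gU])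
      then have "local_section X (on_ob T F) ?V ?g"
        unfolding T(1)
        by (intro local_section_shriek[OF P U sing] shriek_section_inside[OF P U] local_section_push[OF FUY YU' sing])
      moreover have "local_section X ?J ?V g"
        by (intro local_section_shriek[OF FU U sing] shriek_section_inside[OF FU U] gU)
      then have "push_section X Y ?JY ?V ?g"
        by (intro push_section_extend V local_section_restr)
      then have "local_section X (on_ob S F) ?V ?g"
        unfolding S by (rule local_section_push[OF JY Y sing])
      ultimately show ?thesis
        using g0 True YU by (intro exI[of _ ?V] exI[of _ ?g]) auto
    next
      case False
      \<comment> \<open>A point off \<open>Y\<close> may lie outside \<open>U\<close>. The trivial
        section over the whole complement of \<open>Y\<close> handles all these points at once: its
        support is empty, so \<open>N\<close> can be all of \<open>?V\<close>.\<close>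
      let ?V = "topspace X - Y" and ?g = "\<lambda>y. undefined :: 'u"
      have V: "openin X ?V"
        using Y by blast
      have "push_section ?XU Y ?FUY (?V \<inter> U) ?g"
        using V by (intro push_section_trivial openin_subtopology_Int) auto
      then have "local_section ?XU ?P (?V \<inter> U) ?g"
        by (rule local_section_push[OF FUY YU' sing])
      then have "shriek_section X U ?P ?V ?g"
        using V by (intro shriek_sectionI[OF P U, where N = ?V]) auto
      then have "local_section X (on_ob T F) ?V ?g"
        unfolding T(1) by (rule local_section_shriek[OF P U sing])
      moreover have "local_section X (on_ob S F) ?V ?g"
        unfolding S by (intro local_section_push[OF JY Y sing] push_section_trivial V) auto
      ultimately show ?thesis
        using x s False by (intro exI[of _ ?V] exI[of _ ?g]) (auto simp: stT)
    qed
    have thru: "\<exists>V g. x \<in> V \<and> local_section X (on_ob T F) V g \<and> g x = s \<and>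
        local_section X (on_ob S F) V (\<lambda>y. Idn (Sh X) (on_ob T F) y (g y))"
      if x: "x \<in> topspace X" and s: "s \<in> carrier (stalk (on_ob T F) x)" for x s
    proof -
      obtain V g where g: "x \<in> V" "local_section X (on_ob T F) V g" "g x = s" "local_section X (on_ob S F) V g"
        using sec[OF x s] by blast
      have "local_section X (on_ob S F) V (\<lambda>y. Idn (Sh X) (on_ob T F) y (g y))"
        by (rule local_section_cong[OF g(4)])
          (use local_section_carrier[OF T(2) g(2)] local_section_topspace(2)[OF g(2)] in \<open>simp add: Sh_Idn Ab_Idn\<close>)
      then show ?thesis
        using g by blast
    qed
    show ?thesis
      unfolding Sh_Hom
    proof (intro conjI ballI)
      show "continuous_map (etop (on_ob T F)) (etop (on_ob S F)) (\<lambda>(x, s). (x, Idn (Sh X) (on_ob T F) x s))"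
        by (rule fibre_map_continuous[OF T(2) thru])
      show "Idn (Sh X) (on_ob T F) x \<in> Hom Ab (stalk (on_ob T F) x) (stalk (on_ob S F) x)"
        if x: "x \<in> topspace X" for x
      proof -
        have "stalk (on_ob S F) x = stalk (on_ob T F) x"
          by (simp add: stT stS)
        then show ?thesis
          using AB.Idn_in[OF sheaf_stalk[OF T(2) x]] x by (simp add: Sh_Idn)
      qed
    qed (simp add: Sh_Idn)
  qed
  have Tf: "is_functor (Sh X) (Sh X) T"
    unfolding T_def
    using exact0_shriek[OF U sing] exact0_push[OF YU' sing] exact0_restr[of X U] exact0_restr[of ?XU Y]
    by (intro is_functor_comp) (auto simp: exact0_def)
  show ?thesis
    unfolding natural_def
  proof (intro conjI ballI)
    fix F G :: "('a, 'u) sheaf" and \<phi>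
    assume ob: "F \<in> Ob (Sh X)" "G \<in> Ob (Sh X)" and \<phi>: "\<phi> \<in> Hom (Sh X) F G"
    have "is_sheaf X (on_ob T F)" "is_sheaf X (on_ob T G)"
      using functor_Ob[OF Tf] ob by (auto simp: Sh_Ob)
    note st = sheaf_stalk[OF this(1)] sheaf_stalk[OF this(2)]
    have stTS: "stalk (on_ob S H) x = stalk (on_ob T H) x" for H x
      by (simp add: stT stS)
    have "on_arr T F G \<phi> x \<in> Hom Ab (stalk (on_ob T F) x) (stalk (on_ob T G) x)" if "x \<in> topspace X" for x
      using Sh_HomD(2)[OF functor_Hom[OF Tf ob \<phi>] that] .
    then show "Cmp (Sh X) (on_ob T F) (on_ob T G) (on_ob S G) (Idn (Sh X) (on_ob T G)) (on_arr T F G \<phi>)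
      = Cmp (Sh X) (on_ob T F) (on_ob S F) (on_ob S G) (on_arr S F G \<phi>) (Idn (Sh X) (on_ob T F))"
      using st by (simp add: Sh_Cmp Sh_Idn stTS arr[symmetric] AB.Cmp_Idn AB.Idn_Cmp cong: restrict_cong)
  qed (use hom in \<open>auto simp: Sh_Ob\<close>)
qed

section \<open>The derived categories\<close>

lemma cat_DAb: "cat DAb" and cat_DSh: "cat (DSh X)"
  by (simp_all add: DAb_def DSh_def cat_localize cat_Ch cat_Ab cat_Sh)

lemma DAb_Ob [simp]: "Ob DAb = Ob (Ch Ab)" and DSh_Ob [simp]: "Ob (DSh X) = Ob (Ch (Sh X))"
  by (simp_all add: DAb_def DSh_def)

lemma der_Sh_on_ob [simp]: "on_ob (der_Sh X T) = on_ob (ch_ftor T)"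
  by (simp add: der_Sh_def)

section \<open>Induced functors between derived categories\<close>

lemma is_functor_const_D: "is_functor DAb (DSh X) (const_D X)"
  unfolding DAb_def DSh_def const_D_def der_Sh_def
  by (intro is_functor_loc_ftor is_functor_ch exact0_const preserves_const)

lemma is_functor_restr_D: "is_functor (DSh X) (DSh (subtopology X S)) (restr_D X S)"
  unfolding DSh_def restr_D_def der_Sh_def
  by (intro is_functor_loc_ftor is_functor_ch exact0_restr preserves_restr)

lemma is_functor_push_D:
  fixes X :: "'a topology"
  assumes "closedin X Y" "singleton_group (undefined :: 'u) \<in> Ob Ab"
  shows "is_functor (DSh (subtopology X Y)) (DSh X :: (('a, 'u) sh_complex, _) category) (push_D X Y)"
  unfolding DSh_def push_D_def der_Sh_def
  by (intro is_functor_loc_ftor is_functor_ch exact0_push preserves_push assms)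

lemma is_functor_closed_part:
  fixes X :: "'a topology"
  assumes "closedin X Y" "singleton_group (undefined :: 'u) \<in> Ob Ab"
  shows "is_functor (DSh X) (DSh X :: (('a, 'u) sh_complex, _) category) (closed_part X Y)"
  unfolding closed_part_def
  by (intro is_functor_comp[OF is_functor_restr_D] is_functor_push_D assms)

text \<open>The companion of \<open>restr_const_D\<close> for morphisms. Constant sheaves restrict
  literally to constant sheaves, so the two functors on complexes are equal and act alike on a
  zigzag representing \<open>g\<close>.\<close>

lemma restr_const_D_arr:
  fixes X :: "'a topology" and g :: "'u ab_darr"
  assumes g: "g \<in> Hom DAb M N"
  shows "on_arr (restr_D X U) (on_ob (const_D X) M) (on_ob (const_D X) N) (on_arr (const_D X) M N g)
    = on_arr (const_D (subtopology X U)) M N g"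
proof -
  let ?c = "ch_ftor (const_ftor X)
    :: ('u ab_complex, int \<Rightarrow> 'u \<Rightarrow> 'u, ('a, 'u) sh_complex, int \<Rightarrow> 'a \<Rightarrow> 'u \<Rightarrow> 'u) ftor"
  obtain p where p: "zigzag (Ch Ab) qis_Ab M p N" and gp: "g = zz_class (Ch Ab) qis_Ab M N p"
    using g unfolding DAb_def by (rule localize_HomE)
  have "on_ob (ftor_comp (restr_ftor X U) (const_ftor X)) A = on_ob (const_ftor (subtopology X U)) A"
    "on_arr (ftor_comp (restr_ftor X U) (const_ftor X)) A B h = on_arr (const_ftor (subtopology X U)) A B h"
    for A B :: "'u monoid" and h
    by (auto simp: restr_const restr_on_arr const_on_arr fun_eq_iff)
  then have "ftor_comp (restr_ftor X U) (const_ftor X)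
      = (const_ftor (subtopology X U) :: ('u monoid, 'u \<Rightarrow> 'u, ('a, 'u) sheaf, 'a \<Rightarrow> 'u \<Rightarrow> 'u) ftor)"
    by (intro ftor.equality) (auto simp: fun_eq_iff simp del: on_ob_ftor_comp on_arr_ftor_comp)
  then have eq: "ftor_comp (ch_ftor (restr_ftor X U)) ?c = ch_ftor (const_ftor (subtopology X U))"
    by (simp add: ch_ftor_comp[symmetric])
  note F = is_functor_ch[OF exact0_const] preserves_const
  have c: "on_arr (const_D Z) M N g = zz_class (Ch (Sh Z)) (qis_Sh Z)
      (on_ob (ch_ftor (const_ftor Z)) M) (on_ob (ch_ftor (const_ftor Z)) N) (map (map_step (ch_ftor (const_ftor Z))) p)"
    for Z :: "'a topology"
    unfolding const_D_def der_Sh_def gp by (rule loc_ftor_class[OF F p])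
  have "on_arr (restr_D X U) (on_ob (const_D X) M) (on_ob (const_D X) N) (on_arr (const_D X) M N g)
    = zz_class (Ch (Sh (subtopology X U))) (qis_Sh (subtopology X U))
       (on_ob (ch_ftor (restr_ftor X U)) (on_ob ?c M)) (on_ob (ch_ftor (restr_ftor X U)) (on_ob ?c N))
       (map (map_step (ch_ftor (restr_ftor X U))) (map (map_step ?c) p))"
    unfolding c restr_D_def der_Sh_def
    unfolding const_D_def der_Sh_on_ob
    by (rule loc_ftor_class[OF is_functor_ch[OF exact0_restr] preserves_restr zigzag_map[OF F p]])
  also have "\<dots> = zz_class (Ch (Sh (subtopology X U))) (qis_Sh (subtopology X U))
       (on_ob (ftor_comp (ch_ftor (restr_ftor X U)) ?c) M) (on_ob (ftor_comp (ch_ftor (restr_ftor X U)) ?c) N)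
       (map (map_step (ftor_comp (ch_ftor (restr_ftor X U)) ?c)) p)"
    by (simp add: map_step_ftor_comp)
  finally show ?thesis
    unfolding eq c .
qed

section \<open>Universal arrows\<close>

text \<open>The part of \<open>left_adjoint\<close> that concerns a single object \<open>c\<close>:
  the pair \<open>l\<close>, \<open>e\<close> represents the functor sending \<open>d\<close> to
  \<open>Hom C c (on_ob R d)\<close>. The comparison of the two left adjoints takes place at one
  sheaf complex, so a statement at one object is what it requires.\<close>

definition universal_arrow :: "('o, 'x, 'z) category_scheme \<Rightarrow> ('p, 'y, 'w) category_scheme \<Rightarrow>
    ('p, 'y, 'o, 'x) ftor \<Rightarrow> 'o \<Rightarrow> 'p \<Rightarrow> 'x \<Rightarrow> bool" where
  "universal_arrow C D R c l e \<longleftrightarrow> l \<in> Ob D \<and> e \<in> Hom C c (on_ob R l) \<and>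
     (\<forall>d \<in> Ob D. bij_betw (\<lambda>g. Cmp C c (on_ob R l) (on_ob R d) (on_arr R l d g) e)
        (Hom D l d) (Hom C c (on_ob R d)))"

lemma left_adjoint_universal:
  "left_adjoint C D L R eta \<Longrightarrow> c \<in> Ob C \<Longrightarrow> universal_arrow C D R c (on_ob L c) (eta c)"
  by (auto simp: left_adjoint_def universal_arrow_def intro: functor_Ob)

text \<open>Representing objects are unique: each arrow factors through the other, and the composite
  of the two factorizations fixes the universal arrow, hence is an identity. The description by
  \<open>THE\<close> is that of \<open>adj_transpose\<close>, so the result applies to
  \<open>shriek_ident\<close>.\<close>

lemma universal_arrow_iso:
  assumes C: "cat C" and D: "cat D" and R: "is_functor D C R" and c: "c \<in> Ob C"
    and e: "universal_arrow C D R c l e" and u: "universal_arrow C D R c l' u"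
  shows "is_isomorphism D l l'
    (THE g. g \<in> Hom D l l' \<and> Cmp C c (on_ob R l) (on_ob R l') (on_arr R l l' g) e = u)"
proof -
  interpret C: cat C by fact
  interpret D: cat D by fact
  have factor: "\<exists>!g. g \<in> Hom D m d \<and> Cmp C c (on_ob R m) (on_ob R d) (on_arr R m d g) v = w"
    if v: "universal_arrow C D R c m v" "d \<in> Ob D" and w: "w \<in> Hom C c (on_ob R d)" for m v d w
  proof -
    have b: "bij_betw (\<lambda>g. Cmp C c (on_ob R m) (on_ob R d) (on_arr R m d g) v)
        (Hom D m d) (Hom C c (on_ob R d))"
      using v by (simp add: universal_arrow_def)
    have "w \<in> (\<lambda>g. Cmp C c (on_ob R m) (on_ob R d) (on_arr R m d g) v) ` Hom D m d"
      unfolding bij_betw_imp_surj_on[OF b] by (rule w)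
    then obtain g where g: "g \<in> Hom D m d" "Cmp C c (on_ob R m) (on_ob R d) (on_arr R m d g) v = w"
      by (elim imageE) simp
    have "h = g" if "h \<in> Hom D m d \<and> Cmp C c (on_ob R m) (on_ob R d) (on_arr R m d h) v = w" for h
      using inj_onD[OF bij_betw_imp_inj_on[OF b], of h g] that g by simp
    with conjI[OF g] show ?thesis
      by (rule ex1I)
  qed
  have l: "l \<in> Ob D" "e \<in> Hom C c (on_ob R l)" and l': "l' \<in> Ob D" "u \<in> Hom C c (on_ob R l')"
    using e u by (auto simp: universal_arrow_def)
  note Rl = functor_Ob[OF R l(1)] and Rl' = functor_Ob[OF R l'(1)]
  have comp: "Cmp C c (on_ob R m) (on_ob R m) (on_arr R m m (Cmp D m d m h g)) v = v"
    if "m \<in> Ob D" "v \<in> Hom C c (on_ob R m)" "d \<in> Ob D" "w \<in> Hom C c (on_ob R d)"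
      "g \<in> Hom D m d" "Cmp C c (on_ob R m) (on_ob R d) (on_arr R m d g) v = w"
      "h \<in> Hom D d m" "Cmp C c (on_ob R d) (on_ob R m) (on_arr R d m h) w = v" for m v d w g h
  proof -
    have "Cmp C c (on_ob R m) (on_ob R m) (on_arr R m m (Cmp D m d m h g)) v
      = Cmp C c (on_ob R m) (on_ob R m)
         (Cmp C (on_ob R m) (on_ob R d) (on_ob R m) (on_arr R d m h) (on_arr R m d g)) v"
      using functor_Cmp[OF R] that by simp
    also have "\<dots> = Cmp C c (on_ob R d) (on_ob R m) (on_arr R d m h)
         (Cmp C c (on_ob R m) (on_ob R d) (on_arr R m d g) v)"
      using that c functor_Ob[OF R] functor_Hom[OF R] by (intro C.Cmp_assoc[symmetric]) auto
    finally show ?thesis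
      using that by simp
  qed
  \<comment> \<open>Both \<open>f\<close> and the identity factor \<open>v\<close> through itself,
    so uniqueness of factorizations identifies them.\<close>
  have unique: "f = Idn D m"
    if "universal_arrow C D R c m v" "f \<in> Hom D m m"
      "Cmp C c (on_ob R m) (on_ob R m) (on_arr R m m f) v = v" for m v f
  proof -
    have m: "m \<in> Ob D" "v \<in> Hom C c (on_ob R m)"
      using that by (auto simp: universal_arrow_def)
    have "Cmp C c (on_ob R m) (on_ob R m) (on_arr R m m (Idn D m)) v = v"
      using m c functor_Ob[OF R] by (simp add: functor_Idn[OF R] C.Idn_Cmp)
    then show ?thesis
      using factor[OF that(1) m] that(2,3) D.Idn_in[OF m(1)] by blast
  qed
  let ?P = "\<lambda>g. g \<in> Hom D l l' \<and> Cmp C c (on_ob R l) (on_ob R l') (on_arr R l l' g) e = u"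
  define g where "g = (THE g. ?P g)"
  have g: "g \<in> Hom D l l'" "Cmp C c (on_ob R l) (on_ob R l') (on_arr R l l' g) e = u"
    using theI'[OF factor[OF e l']] by (auto simp: g_def)
  obtain h where h: "h \<in> Hom D l' l" "Cmp C c (on_ob R l') (on_ob R l) (on_arr R l' l h) u = e"
    using factor[OF u l] by blast
  have "Cmp D l l' l h g = Idn D l"
    by (rule unique[OF e]) (use comp[OF l l' g h] D.Cmp_in l l' g h in auto)
  moreover have "Cmp D l' l l' g h = Idn D l'"
    by (rule unique[OF u]) (use comp[OF l' l h g] D.Cmp_in l l' g h in auto)
  ultimately show ?thesis
    using g(1) h(1) unfolding g_def[symmetric] is_isomorphism_def by blast
qed

section \<open>Comparison of the left adjoints on an open subset\<close>

text \<open>\<open>loc_adjunction\<close> for the termwise adjunction on complexes. The morphism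
  \<open>shriek_unit\<close> is by definition the class of the termwise identity, which is the unit
  there.\<close>

lemma shriek_restr_D_bij:
  fixes X :: "'a topology" and G K :: "('a, 'u) sh_complex"
  assumes U: "openin X U" and sing: "singleton_group (undefined :: 'u) \<in> Ob Ab"
    and G: "G \<in> Ob (DSh (subtopology X U))" and K: "K \<in> Ob (DSh X)"
  shows "bij_betw (\<lambda>h. Cmp (DSh (subtopology X U)) G (on_ob (restr_D X U) (on_ob (shriek_D X U) G))
      (on_ob (restr_D X U) K) (on_arr (restr_D X U) (on_ob (shriek_D X U) G) K h) (shriek_unit X U G))
    (Hom (DSh X) (on_ob (shriek_D X U) G) K) (Hom (DSh (subtopology X U)) G (on_ob (restr_D X U) K))"
    and "shriek_unit X U G \<in> Hom (DSh (subtopology X U)) G (on_ob (restr_D X U) (on_ob (shriek_D X U) G))"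
proof -
  let ?\<eta> = "\<lambda>(A :: ('a, 'u) sh_complex) n. Idn (Sh (subtopology X U)) (fst A n)"
  have uc: "unit_counit (Ch (Sh (subtopology X U))) (Ch (Sh X)) (ch_ftor (shriek_ftor X U)) (ch_ftor (restr_ftor X U))
      ?\<eta> (\<lambda>(A :: ('a, 'u) sh_complex) n. shriek_counit X U (fst A n))"
    by (intro unit_counit_ch exact0_shriek exact0_restr unit_counit_shriek assms)
  have u: "shriek_unit X U G = loc_arr (Ch (Sh (subtopology X U))) (qis_Sh (subtopology X U)) G
      (on_ob (ch_ftor (restr_ftor X U)) (on_ob (ch_ftor (shriek_ftor X U)) G)) (?\<eta> G)"
    by (simp add: shriek_unit_def stalkwise_id_def Ch_Idn restr_D_def shriek_D_def)
  have GK: "G \<in> Ob (Ch (Sh (subtopology X U)))" "K \<in> Ob (Ch (Sh X))"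
    using G K by auto
  show "bij_betw (\<lambda>h. Cmp (DSh (subtopology X U)) G (on_ob (restr_D X U) (on_ob (shriek_D X U) G))
      (on_ob (restr_D X U) K) (on_arr (restr_D X U) (on_ob (shriek_D X U) G) K h) (shriek_unit X U G))
    (Hom (DSh X) (on_ob (shriek_D X U) G) K) (Hom (DSh (subtopology X U)) G (on_ob (restr_D X U) K))"
    using loc_adjunction[OF uc preserves_shriek[OF U sing] preserves_restr GK]
    unfolding u DSh_def restr_D_def shriek_D_def der_Sh_def loc_ftor_on_ob .
  have "?\<eta> G \<in> Hom (Ch (Sh (subtopology X U))) G
      (on_ob (ch_ftor (restr_ftor X U)) (on_ob (ch_ftor (shriek_ftor X U)) G))"
    using uc GK(1) by (simp add: unit_counit_def natural_def)
  moreover have "on_ob (ch_ftor (restr_ftor X U)) (on_ob (ch_ftor (shriek_ftor X U)) G) \<in> Ob (Ch (Sh (subtopology X U)))"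
    using uc GK(1) by (auto simp: unit_counit_def intro: functor_Ob)
  ultimately show "shriek_unit X U G \<in> Hom (DSh (subtopology X U)) G (on_ob (restr_D X U) (on_ob (shriek_D X U) G))"
    unfolding u DSh_def restr_D_def shriek_D_def der_Sh_on_ob using GK(1) by (intro loc_arr_in)
qed

text \<open>The bijections of the two adjunctions are composed at \<open>G\<close>; evaluated at the
  identity of \<open>?L\<close> this yields \<open>u\<close>, the morphism whose transpose
  \<open>shriek_ident\<close> is. So \<open>?L\<close> with \<open>u\<close> is a second universal
  arrow from \<open>G\<close>, next to the one given by \<open>LU\<close>.\<close>

lemma shriek_ident_isomorphism:
  fixes X :: "'a topology" and G :: "('a, 'u) sh_complex"
  assumes LX: "left_adjoint (DSh X) DAb LX (const_D X) etaX"
    and LU: "left_adjoint (DSh (subtopology X U)) DAb LU (const_D (subtopology X U)) etaU"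
    and U: "openin X U" and sing: "singleton_group (undefined :: 'u) \<in> Ob Ab"
    and G: "G \<in> Ob (DSh (subtopology X U))"
  shows "is_isomorphism DAb (on_ob LU G) (on_ob LX (on_ob (shriek_D X U) G)) (shriek_ident X U LX etaX LU etaU G)"
proof -
  let ?XU = "subtopology X U"
  let ?jG = "on_ob (shriek_D X U) G"
  let ?L = "on_ob LX ?jG"
  let ?R = "restr_D X U :: (('a, 'u) sh_complex, ('a, 'u) sh_darr, ('a, 'u) sh_complex, ('a, 'u) sh_darr) ftor"
  let ?cX = "const_D X :: ('u ab_complex, 'u ab_darr, ('a, 'u) sh_complex, ('a, 'u) sh_darr) ftor"
  let ?cU = "const_D ?XU :: ('u ab_complex, 'u ab_darr, ('a, 'u) sh_complex, ('a, 'u) sh_darr) ftor"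
  let ?eta = "shriek_unit X U G"
  interpret DU: cat "DSh ?XU" by (rule cat_DSh)
  note R = is_functor_restr_D[of X U] and cX = is_functor_const_D[of X] and cU = is_functor_const_D[of ?XU]
  have jG: "?jG \<in> Ob (DSh X)"
    using functor_Ob[OF is_functor_ch[OF exact0_shriek[OF U sing]]] G by (simp add: shriek_D_def)
  have uX: "universal_arrow (DSh X) DAb ?cX ?jG ?L (etaX ?jG)"
    by (rule left_adjoint_universal[OF LX jG])
  then have L: "?L \<in> Ob DAb" and eta: "etaX ?jG \<in> Hom (DSh X) ?jG (on_ob ?cX ?L)"
    by (auto simp: universal_arrow_def)
  have unit: "?eta \<in> Hom (DSh ?XU) G (on_ob ?R ?jG)"
    by (rule shriek_restr_D_bij(2)[OF U sing G jG])
  have cXO: "on_ob ?cX M \<in> Ob (DSh X)" and RcX: "on_ob ?R (on_ob ?cX M) \<in> Ob (DSh ?XU)" if "M \<in> Ob DAb" for M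
    using functor_Ob[OF cX that] functor_Ob[OF R functor_Ob[OF cX that]] by auto
  have RjG: "on_ob ?R ?jG \<in> Ob (DSh ?XU)"
    using functor_Ob[OF R jG] .
  define u where "u = Cmp (DSh ?XU) G (on_ob ?R ?jG) (on_ob ?R (on_ob ?cX ?L))
      (on_arr ?R ?jG (on_ob ?cX ?L) (etaX ?jG)) ?eta"
  have Reta: "on_arr ?R ?jG (on_ob ?cX ?L) (etaX ?jG) \<in> Hom (DSh ?XU) (on_ob ?R ?jG) (on_ob ?R (on_ob ?cX ?L))"
    by (rule functor_Hom[OF R jG cXO[OF L] eta])
  have "universal_arrow (DSh ?XU) DAb ?cU G ?L u"
    unfolding universal_arrow_def
  proof (intro conjI ballI)
    have "u \<in> Hom (DSh ?XU) G (on_ob ?R (on_ob ?cX ?L))"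
      unfolding u_def by (rule DU.Cmp_in[OF G RjG RcX[OF L] unit Reta])
    then show "u \<in> Hom (DSh ?XU) G (on_ob ?cU ?L)"
      by (simp only: restr_const_D)
    fix M :: "'u ab_complex" assume M: "M \<in> Ob DAb"
    let ?\<Phi> = "\<lambda>g. Cmp (DSh X) ?jG (on_ob ?cX ?L) (on_ob ?cX M) (on_arr ?cX ?L M g) (etaX ?jG)"
    let ?\<Psi> = "\<lambda>h. Cmp (DSh ?XU) G (on_ob ?R ?jG) (on_ob ?R (on_ob ?cX M)) (on_arr ?R ?jG (on_ob ?cX M) h) ?eta"
    have "bij_betw ?\<Phi> (Hom DAb ?L M) (Hom (DSh X) ?jG (on_ob ?cX M))"
      using uX M by (simp add: universal_arrow_def)
    moreover have "bij_betw ?\<Psi> (Hom (DSh X) ?jG (on_ob ?cX M)) (Hom (DSh ?XU) G (on_ob ?R (on_ob ?cX M)))"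
      by (rule shriek_restr_D_bij(1)[OF U sing G cXO[OF M]])
    ultimately have "bij_betw (?\<Psi> \<circ> ?\<Phi>) (Hom DAb ?L M) (Hom (DSh ?XU) G (on_ob ?R (on_ob ?cX M)))"
      by (rule bij_betw_trans)
    \<comment> \<open>Functoriality of restriction and associativity bring the composite bijection
      into the form demanded by \<open>universal_arrow\<close>. What remains is to read the
      restriction of a constant complex as a constant complex on \<open>U\<close>.\<close>
    moreover have "(?\<Psi> \<circ> ?\<Phi>) g = Cmp (DSh ?XU) G (on_ob ?cU ?L) (on_ob ?cU M) (on_arr ?cU ?L M g) u"
      if g: "g \<in> Hom DAb ?L M" for g
    proof -
      have cg: "on_arr ?cX ?L M g \<in> Hom (DSh X) (on_ob ?cX ?L) (on_ob ?cX M)"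
        by (rule functor_Hom[OF cX L M g])
      have "(?\<Psi> \<circ> ?\<Phi>) g = Cmp (DSh ?XU) G (on_ob ?R ?jG) (on_ob ?R (on_ob ?cX M))
         (Cmp (DSh ?XU) (on_ob ?R ?jG) (on_ob ?R (on_ob ?cX ?L)) (on_ob ?R (on_ob ?cX M))
           (on_arr ?R (on_ob ?cX ?L) (on_ob ?cX M) (on_arr ?cX ?L M g))
           (on_arr ?R ?jG (on_ob ?cX ?L) (etaX ?jG))) ?eta"
        using functor_Cmp[OF R jG cXO[OF L] cXO[OF M] eta cg] by simp
      also have "\<dots> = Cmp (DSh ?XU) G (on_ob ?R (on_ob ?cX ?L)) (on_ob ?R (on_ob ?cX M))
           (on_arr ?R (on_ob ?cX ?L) (on_ob ?cX M) (on_arr ?cX ?L M g)) u"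
        unfolding u_def
        by (rule DU.Cmp_assoc[symmetric, OF G RjG RcX[OF L] RcX[OF M] unit Reta
              functor_Hom[OF R cXO[OF L] cXO[OF M] cg]])
      finally show ?thesis
        unfolding restr_const_D_arr[OF g] restr_const_D .
    qed
    ultimately show "bij_betw (\<lambda>g. Cmp (DSh ?XU) G (on_ob ?cU ?L) (on_ob ?cU M) (on_arr ?cU ?L M g) u)
        (Hom DAb ?L M) (Hom (DSh ?XU) G (on_ob ?cU M))"
      unfolding restr_const_D by (rule bij_betw_cong[THEN iffD1, rotated])
  qed (rule L)
  then have "is_isomorphism DAb (on_ob LU G) ?L
    (THE g. g \<in> Hom DAb (on_ob LU G) ?L \<and>
       Cmp (DSh ?XU) G (on_ob ?cU (on_ob LU G)) (on_ob ?cU ?L) (on_arr ?cU (on_ob LU G) ?L g) (etaU G) = u)"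
    by (rule universal_arrow_iso[OF cat_DSh cat_DAb cU G left_adjoint_universal[OF LU G]])
  then show ?thesis
    by (simp add: shriek_ident_def adj_transpose_def Let_def u_def)
qed

section \<open>Invertibility of the comparison morphisms of sheaves\<close>

text \<open>\<open>stalkwise_id\<close> takes the identity of \<open>A\<close> as a morphism to
  \<open>B\<close>, which is meaningful only once it is known to lie in that Hom set.
  \<open>closed_open_natural\<close> provides this in each degree, and its naturality the
  compatibility with the differentials.\<close>

lemma closed_open_stalkwise_id:
  fixes X :: "'a topology" and F :: "('a, 'u) sh_complex"
  assumes U: "openin X U" and Y: "closedin X Y" "Y \<subseteq> U"
    and sing: "singleton_group (undefined :: 'u) \<in> Ob Ab" and F: "F \<in> Ob (DSh X)"
  defines "A \<equiv> on_ob (shriek_D X U) (on_ob (closed_part (subtopology X U) Y) (on_ob (restr_D X U) F))"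
    and "B \<equiv> on_ob (closed_part X Y) (on_ob (open_part X U) F)"
  shows "A \<in> Ob (DSh X)" "B \<in> Ob (DSh X)" "is_isomorphism (DSh X) A B (stalkwise_id X A B)"
proof -
  let ?T = "ftor_comp (shriek_ftor X U) (ftor_comp (push_ftor (subtopology X U) Y)
      (ftor_comp (restr_ftor (subtopology X U) Y) (restr_ftor X U)))
      :: (('a, 'u) sheaf, 'a \<Rightarrow> 'u \<Rightarrow> 'u, ('a, 'u) sheaf, 'a \<Rightarrow> 'u \<Rightarrow> 'u) ftor"
  let ?S = "ftor_comp (push_ftor X Y) (ftor_comp (restr_ftor X Y)
      (ftor_comp (shriek_ftor X U) (restr_ftor X U)))
      :: (('a, 'u) sheaf, 'a \<Rightarrow> 'u \<Rightarrow> 'u, ('a, 'u) sheaf, 'a \<Rightarrow> 'u \<Rightarrow> 'u) ftor"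
  have YU: "closedin (subtopology X U) Y"
    by (rule closedin_subset_topspace[OF Y])
  have T: "exact0 (Sh X) (Sh X) ?T"
    by (rule exact0_comp[OF exact0_comp[OF exact0_comp[OF exact0_restr exact0_restr]
          exact0_push[OF YU sing]] exact0_shriek[OF U sing]])
  have S: "exact0 (Sh X) (Sh X) ?S"
    by (rule exact0_comp[OF exact0_comp[OF exact0_comp[OF exact0_restr exact0_shriek[OF U sing]]
          exact0_restr] exact0_push[OF Y(1) sing]])
  have AB: "A = on_ob (ch_ftor ?T) F" "B = on_ob (ch_ftor ?S) F"
    by (simp_all add: A_def B_def closed_part_def open_part_def shriek_D_def push_D_def restr_D_def ch_ftor_comp)
  have F': "F \<in> Ob (Ch (Sh X))"
    using F by simp
  show ob: "A \<in> Ob (DSh X)" "B \<in> Ob (DSh X)"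
    unfolding AB DSh_Ob by (rule functor_Ob[OF is_functor_ch[OF T] F'] functor_Ob[OF is_functor_ch[OF S] F'])+
  have "natural (Sh X) (Sh X) ?T ?S (\<lambda>E. Idn (Sh X) (on_ob ?T E))"
    by (rule closed_open_natural[OF U Y sing])
  then have "natural (Ch (Sh X)) (Ch (Sh X)) (ch_ftor ?T) (ch_ftor ?S) (\<lambda>E n. Idn (Sh X) (on_ob ?T (fst E n)))"
    using T S by (intro natural_ch) (auto simp: exact0_def)
  then have hom: "Idn (Ch (Sh X)) A \<in> Hom (Ch (Sh X)) A B"
    using F' by (simp add: natural_def AB Ch_Idn)
  have "Idn (Ch (Sh X)) A \<in> qis_Sh X A B"
    using ob hom Y(2) by (intro qis_Sh_identity) (auto simp: AB Ch_Idn Sh_Idn)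
  then show "is_isomorphism (DSh X) A B (stalkwise_id X A B)"
    unfolding stalkwise_id_def DSh_def using ob hom by (intro loc_arr_isomorphism) auto
qed

text \<open>The inclusion of the open part need not be a quasi-isomorphism at points off
  \<open>U\<close>. Passing to the closed part trivializes the stalks off \<open>Y\<close>, and at
  points of \<open>Y \<subseteq> U\<close> the counit is the identity.\<close>

lemma closed_part_open_part_incl:
  fixes X :: "'a topology" and F :: "('a, 'u) sh_complex"
  assumes U: "openin X U" and Y: "closedin X Y" "Y \<subseteq> U"
    and sing: "singleton_group (undefined :: 'u) \<in> Ob Ab" and F: "F \<in> Ob (DSh X)"
  shows "is_isomorphism (DSh X) (on_ob (closed_part X Y) (on_ob (open_part X U) F)) (on_ob (closed_part X Y) F)
    (on_arr (closed_part X Y) (on_ob (open_part X U) F) F (open_part_incl X U F))"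
proof -
  let ?J = "shriek_ftor X U :: (('a, 'u) sheaf, 'a \<Rightarrow> 'u \<Rightarrow> 'u, ('a, 'u) sheaf, 'a \<Rightarrow> 'u \<Rightarrow> 'u) ftor"
  let ?C = "ftor_comp (push_ftor X Y) (restr_ftor X Y)
      :: (('a, 'u) sheaf, 'a \<Rightarrow> 'u \<Rightarrow> 'u, ('a, 'u) sheaf, 'a \<Rightarrow> 'u \<Rightarrow> 'u) ftor"
  let ?FU = "on_ob (open_part X U) F"
  let ?\<epsilon> = "\<lambda>n. shriek_counit X U (fst F n)"
  have F': "F \<in> Ob (Ch (Sh X))"
    using F by simp
  have FU: "?FU = on_ob (ch_ftor (ftor_comp ?J (restr_ftor X U))) F"
    by (simp add: open_part_def shriek_D_def restr_D_def ch_ftor_comp)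
  have JR: "exact0 (Sh X) (Sh X) (ftor_comp ?J (restr_ftor X U))"
    by (intro exact0_comp[OF exact0_restr] exact0_shriek U sing)
  have FUo: "?FU \<in> Ob (Ch (Sh X))"
    unfolding FU by (rule functor_Ob[OF is_functor_ch[OF JR] F'])
  have "natural (Sh X) (Sh X) (ftor_comp ?J (restr_ftor X U)) id_ftor (shriek_counit X U)"
    using unit_counit_shriek[OF U sing] by (simp add: unit_counit_def)
  then have "natural (Ch (Sh X)) (Ch (Sh X)) (ch_ftor (ftor_comp ?J (restr_ftor X U))) (ch_ftor id_ftor)
      (\<lambda>E n. shriek_counit X U (fst E n))"
    using JR by (intro natural_ch is_functor_id_ftor) (auto simp: exact0_def)
  then have \<epsilon>: "?\<epsilon> \<in> Hom (Ch (Sh X)) ?FU F"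
    using F' by (simp add: natural_def FU ch_ftor_id)
  have C: "exact0 (Sh X) (Sh X) ?C"
    by (intro exact0_comp[OF exact0_restr] exact0_push Y sing)
  note Cf = is_functor_ch[OF C]
  have incl: "open_part_incl X U F = loc_arr (Ch (Sh X)) (qis_Sh X) ?FU F ?\<epsilon>"
    by (simp add: open_part_incl_def shriek_counit_def)
  have C_ob: "on_ob (closed_part X Y) E = on_ob (ch_ftor ?C) E" for E
    by (simp add: closed_part_def push_D_def restr_D_def ch_ftor_comp)
  have R_loc: "on_arr (restr_D X Y) ?FU F (loc_arr (Ch (Sh X)) (qis_Sh X) ?FU F ?\<epsilon>)
    = loc_arr (Ch (Sh (subtopology X Y))) (qis_Sh (subtopology X Y))
       (on_ob (ch_ftor (restr_ftor X Y)) ?FU) (on_ob (ch_ftor (restr_ftor X Y)) F)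
       (on_arr (ch_ftor (restr_ftor X Y)) ?FU F ?\<epsilon>)"
    unfolding restr_D_def der_Sh_def
    by (rule loc_ftor_loc_arr[OF is_functor_ch[OF exact0_restr] preserves_restr FUo F' \<epsilon>])
  note RF = is_functor_ch[OF exact0_restr[of X Y]]
  \<comment> \<open>\<open>open_part_incl\<close> is the class of a single forward step, so
    \<open>loc_ftor_loc_arr\<close> can be applied twice, for the restriction and for the direct
    image. The result is again the class of one morphism of complexes.\<close>
  have C_arr: "on_arr (closed_part X Y) ?FU F (open_part_incl X U F)
    = loc_arr (Ch (Sh X)) (qis_Sh X) (on_ob (ch_ftor ?C) ?FU) (on_ob (ch_ftor ?C) F) (on_arr (ch_ftor ?C) ?FU F ?\<epsilon>)"
    unfolding incl closed_part_def on_arr_ftor_comp R_loc push_D_def der_Sh_def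
    unfolding restr_D_def der_Sh_on_ob ch_ftor_comp on_arr_ftor_comp on_ob_ftor_comp
    by (rule loc_ftor_loc_arr[OF is_functor_ch[OF exact0_push[OF Y(1) sing]] preserves_push[OF Y(1) sing]
          functor_Ob[OF RF FUo] functor_Ob[OF RF F'] functor_Hom[OF RF FUo F' \<epsilon>]])
  note CF = functor_Ob[OF Cf FUo] functor_Ob[OF Cf F'] functor_Hom[OF Cf FUo F' \<epsilon>]
  have "on_arr (ch_ftor ?C) ?FU F ?\<epsilon> \<in> qis_Sh X (on_ob (ch_ftor ?C) ?FU) (on_ob (ch_ftor ?C) F)"
  proof (rule qis_Sh_identity[OF CF])
    fix n x assume x: "x \<in> topspace X"
    show "stalk (fst (on_ob (ch_ftor ?C) F) n) x = stalk (fst (on_ob (ch_ftor ?C) ?FU) n) x"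
      using Y(2) by (auto simp: FU)
    show "on_arr (ch_ftor ?C) ?FU F ?\<epsilon> n x = Idn Ab (stalk (fst (on_ob (ch_ftor ?C) ?FU) n) x)"
      using x Y(2) by (cases "x \<in> Y")
        (auto simp: FU ch_ftor_on_arr ext_map_simps restr_on_arr shriek_counit_def)
  qed
  then show ?thesis
    unfolding C_arr C_ob DSh_def using CF by (intro loc_arr_isomorphism)
qed

theorem proposition2p26:
  fixes X :: "'a topology" and U Y :: "'a set"
    and LX LU :: "(('a, 'u) sh_complex, ('a, 'u) sh_darr, 'u ab_complex, 'u ab_darr) ftor"
    and etaX etaU :: "('a, 'u) sh_complex \<Rightarrow> ('a, 'u) sh_darr"
    and F :: "('a, 'u) sh_complex"
  assumes "left_adjoint (DSh X) DAb LX (const_D X) etaX"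
    and "openin X U"
    and "left_adjoint (DSh (subtopology X U)) DAb LU (const_D (subtopology X U)) etaU"
    and "closedin X Y"
    and "Y \<subseteq> U"
    and "F \<in> Ob (DSh X)"
  shows "is_isomorphism DAb
    (on_ob (supported (subtopology X U) Y LU) (on_ob (restr_D X U) F))
    (on_ob (supported X Y LX) F)
    (natural_morphism X U Y LX etaX LU etaU F)"
proof -
  note LX = assms(1) and U = assms(2) and LU = assms(3) and Y = assms(4,5) and F = assms(6)
  interpret DAb: cat DAb by (rule cat_DAb)
  have LXf: "is_functor (DSh X) DAb LX" and LUf: "is_functor (DSh (subtopology X U)) DAb LU"
    using LX LU by (auto simp: left_adjoint_def)
  have "fst (on_ob LX F) 0 \<in> Ob Ab"
    using functor_Ob[OF LXf F] by (simp add: Ch_Ob_fst)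
  then have sing: "singleton_group (undefined :: 'u) \<in> Ob Ab"
    by (rule singleton_group_Ab)
  have YU: "closedin (subtopology X U) Y"
    by (rule closedin_subset_topspace[OF Y])
  define G where "G = on_ob (closed_part (subtopology X U) Y) (on_ob (restr_D X U) F)"
  define jG where "jG = on_ob (shriek_D X U) G"
  define FUY where "FUY = on_ob (closed_part X Y) (on_ob (open_part X U) F)"
  define FY where "FY = on_ob (closed_part X Y) F"
  have G: "G \<in> Ob (DSh (subtopology X U))"
    unfolding G_def by (rule functor_Ob[OF is_functor_closed_part[OF YU sing] functor_Ob[OF is_functor_restr_D F]])
  have FY: "FY \<in> Ob (DSh X)"
    unfolding FY_def by (rule functor_Ob[OF is_functor_closed_part[OF Y(1) sing] F])
  have jG: "jG \<in> Ob (DSh X)" and FUY: "FUY \<in> Ob (DSh X)" and t2: "is_isomorphism (DSh X) jG FUY (stalkwise_id X jG FUY)"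
    using closed_open_stalkwise_id[OF U Y sing F] by (simp_all add: jG_def G_def FUY_def)
  have t1: "is_isomorphism DAb (on_ob LU G) (on_ob LX jG) (shriek_ident X U LX etaX LU etaU G)"
    unfolding jG_def by (rule shriek_ident_isomorphism[OF LX LU U sing G])
  have t3: "is_isomorphism (DSh X) FUY FY (on_arr (closed_part X Y) (on_ob (open_part X U) F) F (open_part_incl X U F))"
    unfolding FUY_def FY_def by (rule closed_part_open_part_incl[OF U Y sing F])
  note L2 = functor_isomorphism[OF LXf jG FUY t2] and L3 = functor_isomorphism[OF LXf FUY FY t3]
  note ob = functor_Ob[OF LUf G] functor_Ob[OF LXf jG] functor_Ob[OF LXf FUY] functor_Ob[OF LXf FY]
  have "is_isomorphism DAb (on_ob LU G) (on_ob LX FY)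
    (Cmp DAb (on_ob LU G) (on_ob LX FUY) (on_ob LX FY)
      (on_arr LX FUY FY (on_arr (closed_part X Y) (on_ob (open_part X U) F) F (open_part_incl X U F)))
      (Cmp DAb (on_ob LU G) (on_ob LX jG) (on_ob LX FUY)
        (on_arr LX jG FUY (stalkwise_id X jG FUY)) (shriek_ident X U LX etaX LU etaU G)))"
    by (rule DAb.isomorphism_Cmp[OF ob(1,3,4) DAb.isomorphism_Cmp[OF ob(1-3) t1 L2] L3])
  then show ?thesis
    unfolding natural_morphism_def supported_def on_ob_ftor_comp on_arr_ftor_comp Let_def
      G_def jG_def FUY_def FY_def .
qed

end
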